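(* Put $\alpha=1.230175$ and $\beta=\frac{\log 3}{\log 2}-1$, so that $(1+\beta)/2\approx0.792481$. For a suitable choice of its parameters, the space-improved algorithm (described in the context) computes $\Vert n\Vert$ for all $n\le N$ in time $O(N^{\alpha})$ using $O(N^{(1+\beta)/2}\log\log N)$ bits of storage.
   Context: For a positive integer $n$, the complexity $\Vert n\Vert$ is the least number of $1$'s needed to express $n$ using only $+$, $\times$ and parentheses. Time is the number of elementary operations (arithmetic operations and comparisons on integers, reads and writes of array entries). The algorithm computes the values $\Vert n\Vert$, $n\le N$, successively in increasing order; they need not all be stored simultaneously, and values no longer needed are discarded. The function $E$: $E(0)=1$, $E(1)=1$, and for $j\ge1$: $E(3j)=3^j$, $E(3j+1)=4\cdot3^{j-1}$, $E(3j-1)=2\cdot3^{j-1}$. For $n\ge2$ the number $\mathrm{kMax}=\mathrm{kMax}(n)$ is obtained as follows: put $T=\Vert n-1\Vert$, $t=\lfloor T/2\rfloor$; while $E(t)+E(T-t)<n$, replace $t$ by $t-1$; when the loop stops put $\mathrm{kMax}=E(t)$. Time-improved algorithm (used as a subroutine), with input $M$. An array $\mathrm{Compl}[1..M]$ is initialized with all entries equal to $\lfloor 3\log M/\log 2\rfloor+1$, except $\mathrm{Compl}[1]=1$. For $n=2,\dots,M$ in increasing order: replace $\mathrm{Compl}[n]$ by $\min(\mathrm{Compl}[n],\mathrm{Compl}[n-1]+1)$; compute $\mathrm{kMax}(n)$; for $6\le m\le\mathrm{kMax}(n)$ replace $\mathrm{Compl}[n]$ by $\min(\mathrm{Compl}[n],\mathrm{Compl}[m]+\mathrm{Compl}[n-m])$;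 for $2\le k\le\min(n,\lfloor M/n\rfloor)$ replace $\mathrm{Compl}[kn]$ by $\min(\mathrm{Compl}[kn],\mathrm{Compl}[k]+\mathrm{Compl}[n])$. Space-improved algorithm. Parameters: positive integers $N,H,\ell$ and $L=2\ell$ satisfying $$\mathrm{kMax}(n)<\ell\ (\text{for all } n\le N),\quad N\le \ell H,\quad \ell\mid H,\quad \ell\mid N,\quad H\ge\sqrt{LN};$$ if needed, $N$ may be increased a little so that these conditions can be met. A fixed block $B_0$ stores $\Vert n\Vert$ for $1\le n\le H$ and is computed with the time-improved algorithm. Running blocks $B_j$ ($j\ge1$), each of length $L$, store $\Vert n\Vert$ for $H_j-L<n\le H_j$. When a running block $B_j$ is initialized, one sets $H_j=H$ and copies its entries from $B_0$. At the start $B_1$ is initialized. Main loop: while $H_1<N$, set $h=\min(H_1+\ell,N)$ and, for $j=\lceil h/H\rceil-1,\dots,2,1$ in descending order: put $\mathrm{newH}=\ell\lceil h/(j\ell)\rceil$; if $B_j$ is not initialized and $\mathrm{newH}>H$, initialize it; then if $H_j<\mathrm{newH}$, shift $B_j$ (increase $H_j$ by $\ell$, copy the upper half of the old block into the lower half of the new one, and set the $\ell$ new entries to an upper bound of order $\log N$ for the complexities) and compute its new entries as follows. (i) Products: for all integers $2\le a\le b$ with $H_j-\ell<ab\le H_j$, read $\Vert a\Vert$ from $B_0$, read $\Vert b\Vert$ from $B_0$ if $\lfloor H_j/a\rfloor\le H$ and from $B_{aj}$ otherwise, and replace the entry for $ab$ by $\Vert a\Vert+\Vert b\Vert$ if this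 is smaller. (ii) Sums: for each $n$ with $H_j-\ell<n\le H_j$ in ascending order, replace the entry for $n$ by $\Vert n-1\Vert+1$ if this is smaller; compute $\mathrm{kMax}(n)$; for each $6\le k\le\mathrm{kMax}(n)$, read $\Vert k\Vert$ from $B_0$ and $\Vert n-k\Vert$ from $B_j$ and replace the entry for $n$ by $\Vert k\Vert+\Vert n-k\Vert$ if this is smaller. *)

theory Defs
  imports Complex_Main "HOL-Library.Landau_Symbols" "HOL-Library.Log_Nat"
begin

section \<open>Integer complexity\<close>

datatype ones_expr = One | Sum ones_expr ones_expr | Prod ones_expr ones_expr

fun ones_value :: "ones_expr \<Rightarrow> nat" where
  "ones_value One = 1"
| "ones_value (Sum e f) = ones_value e + ones_value f"
| "ones_value (Prod e f) = ones_value e * ones_value f"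

fun ones_count :: "ones_expr \<Rightarrow> nat" where
  "ones_count One = 1"
| "ones_count (Sum e f) = ones_count e + ones_count f"
| "ones_count (Prod e f) = ones_count e + ones_count f"

text \<open>Meaningful only for positive arguments: no expression has the value 0.\<close>

definition complexity :: "nat \<Rightarrow> nat" where
  "complexity n = (LEAST k. \<exists>e. ones_value e = n \<and> ones_count e = k)"

definition E :: "nat \<Rightarrow> nat" where
  "E j = (if j \<le> 1 then 1
          else if j mod 3 = 0 then 3 ^ (j div 3)
          else if j mod 3 = 1 then 4 * 3 ^ (j div 3 - 1)
          else 2 * 3 ^ (j div 3))"

lemma E_eqs:
  "E 0 = 1" "E 1 = 1"
  "j \<ge> 1 \<Longrightarrow> E (3 * j) = 3 ^ j"
  "j \<ge> 1 \<Longrightarrow> E (3 * j + 1) = 4 * 3 ^ (j - 1)"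
  "j \<ge> 1 \<Longrightarrow> E (3 * j - 1) = 2 * 3 ^ (j - 1)"
proof -
  show "E 0 = 1" "E 1 = 1" by (simp_all add: E_def)
  show "j \<ge> 1 \<Longrightarrow> E (3 * j) = 3 ^ j" by (simp add: E_def)
  show "j \<ge> 1 \<Longrightarrow> E (3 * j + 1) = 4 * 3 ^ (j - 1)" by (simp add: E_def)
  show "E (3 * j - 1) = 2 * 3 ^ (j - 1)" if j: "j \<ge> 1"
  proof -
    obtain i where "j = Suc i" using j by (cases j) auto
    moreover have "(3 * i + 2) div 3 = i" "(3 * i + 2) mod 3 = 2" by presburger+
    ultimately show ?thesis by (simp add: E_def)
  qed
qed

text \<open>
  The loop that decreases \<open>t\<close> while \<open>E t + E (T - t) < n\<close>. The stop at \<open>t = 0\<close> only makes the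
  recursion primitive: for \<open>T = complexity (n - 1)\<close> the condition fails at \<open>t = 0\<close> anyway, since
  \<open>E T\<close> is the greatest number of complexity at most \<open>T\<close>.
\<close>

fun kmax_loop :: "nat \<Rightarrow> nat \<Rightarrow> nat \<Rightarrow> nat" where
  "kmax_loop n T 0 = 0"
| "kmax_loop n T (Suc t) = (if E (Suc t) + E (T - Suc t) < n then kmax_loop n T t else Suc t)"

definition kMax :: "nat \<Rightarrow> nat" where
  "kMax n = (let T = complexity (n - 1) in E (kmax_loop n T (T div 2)))"

section \<open>A machine model with explicit time and storage\<close>

text \<open>
  Comparisons return 1 or 0. Evaluation fails on an array access out of bounds and on a division
  by zero, and a program that evaluates a failing expression has no execution at all.
\<close>

datatype binop = Add | Sub | Mul | Div | Less | LessEq | Equal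

datatype exp =
    Const int
  | Var string
  | Bin binop exp exp
  | Read string exp

abbreviation Plus_exp (infixl "\<^bold>+" 65) where "a \<^bold>+ b \<equiv> Bin Add a b"
abbreviation Minus_exp (infixl "\<^bold>-" 65) where "a \<^bold>- b \<equiv> Bin Sub a b"
abbreviation Times_exp (infixl "\<^bold>*" 70) where "a \<^bold>* b \<equiv> Bin Mul a b"
abbreviation Div_exp (infixl "\<^bold>'/" 70) where "a \<^bold>/ b \<equiv> Bin Div a b"
abbreviation Less_exp (infix "\<^bold><" 50) where "a \<^bold>< b \<equiv> Bin Less a b"
abbreviation Le_exp (infix "\<^bold>\<le>" 50) where "a \<^bold>\<le> b \<equiv> Bin LessEq a b"
abbreviation Eq_exp (infix "\<^bold>=" 50) where "a \<^bold>= b \<equiv> Bin Equal a b"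

datatype com =
    Skip
  | Assign string exp          ("_ ::= _" [1000, 61] 61)
  | Alloc string exp exp       \<comment> \<open>array name, length, common initial value of the entries\<close>
  | Write string exp exp       \<comment> \<open>array name, index, value\<close>
  | Emit exp
  | Seq com com                ("_;;/ _" [60, 61] 60)
  | If exp com com             ("(IF _/ THEN _/ ELSE _)" [0, 0, 61] 61)
  | While exp com              ("(WHILE _/ DO _)" [0, 61] 61)

record state =
  vars :: "string \<Rightarrow> int"
  arrs :: "string \<Rightarrow> int list"
  emitted :: "int list"

fun apply_op :: "binop \<Rightarrow> int \<Rightarrow> int \<Rightarrow> int option" where
  "apply_op Add x y = Some (x + y)"
| "apply_op Sub x y = Some (x - y)"
| "apply_op Mul x y = Some (x * y)"
| "apply_op Div x y = (if y = 0 then None else Some (x div y))"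
| "apply_op Less x y = Some (of_bool (x < y))"
| "apply_op LessEq x y = Some (of_bool (x \<le> y))"
| "apply_op Equal x y = Some (of_bool (x = y))"

fun exp_val :: "exp \<Rightarrow> state \<Rightarrow> int option" where
  "exp_val (Const i) s = Some i"
| "exp_val (Var x) s = Some (vars s x)"
| "exp_val (Bin f a b) s =
     (case (exp_val a s, exp_val b s) of (Some x, Some y) \<Rightarrow> apply_op f x y | _ \<Rightarrow> None)"
| "exp_val (Read A i) s =
     (case exp_val i s of
        Some k \<Rightarrow> if 0 \<le> k \<and> k < int (length (arrs s A)) then Some (arrs s A ! nat k) else None
      | None \<Rightarrow> None)"

fun exp_time :: "exp \<Rightarrow> nat" where
  "exp_time (Const i) = 0"
| "exp_time (Var x) = 0"
| "exp_time (Bin f a b) = exp_time a + exp_time b + 1"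
| "exp_time (Read A i) = exp_time i + 1"

text \<open>One bit for the sign, and the binary digits of the absolute value.\<close>

definition bits :: "int \<Rightarrow> nat" where
  "bits i = 1 + floorlog 2 (nat \<bar>i\<bar>)"

text \<open>Working storage of an evaluation: all intermediate results are charged as if kept at once.\<close>

fun exp_bits :: "exp \<Rightarrow> state \<Rightarrow> nat" where
  "exp_bits (Const i) s = bits i"
| "exp_bits (Var x) s = bits (vars s x)"
| "exp_bits (Bin f a b) s = exp_bits a s + exp_bits b s +
     (case exp_val (Bin f a b) s of Some v \<Rightarrow> bits v | None \<Rightarrow> 0)"
| "exp_bits (Read A i) s = exp_bits i s +
     (case exp_val (Read A i) s of Some v \<Rightarrow> bits v | None \<Rightarrow> 0)"

text \<open>All entries of an array occupy the same number of bits, that of the widest one.\<close>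

definition array_bits :: "int list \<Rightarrow> nat" where
  "array_bits xs = length xs * Max (insert 0 (bits ` set xs))"

fun exp_vars :: "exp \<Rightarrow> string set" where
  "exp_vars (Const i) = {}"
| "exp_vars (Var x) = {x}"
| "exp_vars (Bin f a b) = exp_vars a \<union> exp_vars b"
| "exp_vars (Read A i) = exp_vars i"

fun exp_arrs :: "exp \<Rightarrow> string set" where
  "exp_arrs (Const i) = {}"
| "exp_arrs (Var x) = {}"
| "exp_arrs (Bin f a b) = exp_arrs a \<union> exp_arrs b"
| "exp_arrs (Read A i) = insert A (exp_arrs i)"

fun com_vars :: "com \<Rightarrow> string set" where
  "com_vars Skip = {}"
| "com_vars (x ::= e) = insert x (exp_vars e)"
| "com_vars (Alloc A n e) = exp_vars n \<union> exp_vars e"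
| "com_vars (Write A i e) = exp_vars i \<union> exp_vars e"
| "com_vars (Emit e) = exp_vars e"
| "com_vars (c ;; d) = com_vars c \<union> com_vars d"
| "com_vars (IF e THEN c ELSE d) = exp_vars e \<union> com_vars c \<union> com_vars d"
| "com_vars (WHILE e DO c) = exp_vars e \<union> com_vars c"

fun com_arrs :: "com \<Rightarrow> string set" where
  "com_arrs Skip = {}"
| "com_arrs (x ::= e) = exp_arrs e"
| "com_arrs (Alloc A n e) = insert A (exp_arrs n \<union> exp_arrs e)"
| "com_arrs (Write A i e) = insert A (exp_arrs i \<union> exp_arrs e)"
| "com_arrs (Emit e) = exp_arrs e"
| "com_arrs (c ;; d) = com_arrs c \<union> com_arrs d"
| "com_arrs (IF e THEN c ELSE d) = exp_arrs e \<union> com_arrs c \<union> com_arrs d"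
| "com_arrs (WHILE e DO c) = exp_arrs e \<union> com_arrs c"

lemma finite_com_vars: "finite (com_vars c)"
proof -
  have "finite (exp_vars e)" for e by (induction e) auto
  thus ?thesis by (induction c) auto
qed

lemma finite_com_arrs: "finite (com_arrs c)"
proof -
  have "finite (exp_arrs e)" for e by (induction e) auto
  thus ?thesis by (induction c) auto
qed

text \<open>Storage occupied by a state of a run of \<open>p\<close>. The output is write-only and is not counted.\<close>

definition state_bits :: "com \<Rightarrow> state \<Rightarrow> nat" where
  "state_bits p s =
     (\<Sum>x\<in>com_vars p. bits (vars s x)) + (\<Sum>A\<in>com_arrs p. array_bits (arrs s A))"

text \<open>
  \<open>exec sz c s t m s'\<close>: started in \<open>s\<close>, the command \<open>c\<close> terminates in \<open>s'\<close> after \<open>t\<close> elementary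
  operations, and \<open>m\<close> is the greatest amount of storage in use at any moment, where \<open>sz\<close> measures
  the storage occupied by a state. Assignments, writes, outputs and tests cost one operation in
  addition to the operations of the expressions involved, and an allocation costs one operation
  per entry.
\<close>

inductive exec :: "(state \<Rightarrow> nat) \<Rightarrow> com \<Rightarrow> state \<Rightarrow> nat \<Rightarrow> nat \<Rightarrow> state \<Rightarrow> bool"
  for sz :: "state \<Rightarrow> nat" where
  Skip: "exec sz Skip s 1 (sz s) s"
| Assign: "exp_val e s = Some v \<Longrightarrow> s' = s\<lparr>vars := (vars s)(x := v)\<rparr> \<Longrightarrow>
    exec sz (x ::= e) s (exp_time e + 1) (max (sz s + exp_bits e s) (sz s')) s'"
| Alloc: "exp_val n s = Some k \<Longrightarrow> 0 \<le> k \<Longrightarrow> exp_val e s = Some v \<Longrightarrow>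
    s' = s\<lparr>arrs := (arrs s)(A := replicate (nat k) v)\<rparr> \<Longrightarrow>
    exec sz (Alloc A n e) s (exp_time n + exp_time e + nat k + 1)
      (max (sz s + exp_bits n s + exp_bits e s) (sz s')) s'"
| Write: "exp_val i s = Some k \<Longrightarrow> 0 \<le> k \<Longrightarrow> k < int (length (arrs s A)) \<Longrightarrow> exp_val e s = Some v \<Longrightarrow>
    s' = s\<lparr>arrs := (arrs s)(A := (arrs s A)[nat k := v])\<rparr> \<Longrightarrow>
    exec sz (Write A i e) s (exp_time i + exp_time e + 1)
      (max (sz s + exp_bits i s + exp_bits e s) (sz s')) s'"
| Emit: "exp_val e s = Some v \<Longrightarrow>
    exec sz (Emit e) s (exp_time e + 1) (sz s + exp_bits e s) (s\<lparr>emitted := emitted s @ [v]\<rparr>)"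
| Seq: "exec sz c s t1 m1 s1 \<Longrightarrow> exec sz d s1 t2 m2 s2 \<Longrightarrow>
    exec sz (c ;; d) s (t1 + t2) (max m1 m2) s2"
| IfTrue: "exp_val e s = Some v \<Longrightarrow> v \<noteq> 0 \<Longrightarrow> exec sz c s t m s' \<Longrightarrow>
    exec sz (IF e THEN c ELSE d) s (exp_time e + 1 + t) (max (sz s + exp_bits e s) m) s'"
| IfFalse: "exp_val e s = Some 0 \<Longrightarrow> exec sz d s t m s' \<Longrightarrow>
    exec sz (IF e THEN c ELSE d) s (exp_time e + 1 + t) (max (sz s + exp_bits e s) m) s'"
| WhileFalse: "exp_val e s = Some 0 \<Longrightarrow>
    exec sz (WHILE e DO c) s (exp_time e + 1) (sz s + exp_bits e s) s"
| WhileTrue: "exp_val e s = Some v \<Longrightarrow> v \<noteq> 0 \<Longrightarrow>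
    exec sz c s t1 m1 s1 \<Longrightarrow> exec sz (WHILE e DO c) s1 t2 m2 s2 \<Longrightarrow>
    exec sz (WHILE e DO c) s (exp_time e + 1 + t1 + t2)
      (max (sz s + exp_bits e s) (max m1 m2)) s2"

definition run :: "com \<Rightarrow> state \<Rightarrow> nat \<Rightarrow> nat \<Rightarrow> state \<Rightarrow> bool" where
  "run p = exec (state_bits p) p"

section \<open>The algorithms\<close>

definition For :: "string \<Rightarrow> exp \<Rightarrow> exp \<Rightarrow> com \<Rightarrow> com"
    ("(FOR _ FROM _ TO _/ DO _)" [0, 0, 0, 61] 61) where
  "(FOR x FROM lo TO hi DO c) =
     (x ::= lo;; WHILE Var x \<^bold>\<le> hi DO (c;; x ::= Var x \<^bold>+ Const 1))"

definition lower_to :: "string \<Rightarrow> exp \<Rightarrow> exp \<Rightarrow> com" where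
  "lower_to A i e = (IF e \<^bold>< Read A i THEN Write A i e ELSE Skip)"

text \<open>\<open>x\<close> becomes \<open>\<lfloor>3 log M / log 2\<rfloor> + 1\<close>, the least \<open>d \<ge> 1\<close> with \<open>2 ^ d > M ^ 3\<close>.\<close>

definition compute_bound :: "string \<Rightarrow> exp \<Rightarrow> com" where
  "compute_bound x M =
    (x ::= Const 1;;
     ''p'' ::= Const 2;;
     WHILE Var ''p'' \<^bold>\<le> M \<^bold>* M \<^bold>* M DO
       (x ::= Var x \<^bold>+ Const 1;; ''p'' ::= Const 2 \<^bold>* Var ''p''))"

text \<open>\<open>x\<close> becomes \<open>E j\<close>, from \<open>E (j + 3) = 3 * E j\<close> for \<open>j \<ge> 2\<close> and \<open>E j = j\<close> for \<open>1 \<le> j \<le> 4\<close>.\<close>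

definition compute_E :: "string \<Rightarrow> exp \<Rightarrow> com" where
  "compute_E x j =
    (x ::= Const 1;;
     ''r'' ::= j;;
     WHILE Const 4 \<^bold>< Var ''r'' DO
       (x ::= Const 3 \<^bold>* Var x;; ''r'' ::= Var ''r'' \<^bold>- Const 3);;
     IF Const 1 \<^bold>< Var ''r'' THEN x ::= Var x \<^bold>* Var ''r'' ELSE Skip)"

definition compute_kMax :: "exp \<Rightarrow> com" where
  "compute_kMax T =
    (''T'' ::= T;;
     ''t'' ::= Var ''T'' \<^bold>/ Const 2;;
     compute_E ''E1'' (Var ''t'');;
     compute_E ''E2'' (Var ''T'' \<^bold>- Var ''t'');;
     WHILE Var ''E1'' \<^bold>+ Var ''E2'' \<^bold>< Var ''n'' DO
       (''t'' ::= Var ''t'' \<^bold>- Const 1;;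
        compute_E ''E1'' (Var ''t'');;
        compute_E ''E2'' (Var ''T'' \<^bold>- Var ''t''));;
     ''kMax'' ::= Var ''E1'')"

text \<open>The entry for \<open>n\<close> is stored at index \<open>n\<close>; index 0 is unused.\<close>

definition time_improved :: "string \<Rightarrow> exp \<Rightarrow> com" where
  "time_improved Compl M =
    (compute_bound ''d'' M;;
     Alloc Compl (M \<^bold>+ Const 1) (Var ''d'');;
     Write Compl (Const 1) (Const 1);;
     FOR ''n'' FROM Const 2 TO M DO
       (lower_to Compl (Var ''n'') (Read Compl (Var ''n'' \<^bold>- Const 1) \<^bold>+ Const 1);;
        compute_kMax (Read Compl (Var ''n'' \<^bold>- Const 1));;
        FOR ''m'' FROM Const 6 TO Var ''kMax'' DO
          lower_to Compl (Var ''n'')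
            (Read Compl (Var ''m'') \<^bold>+ Read Compl (Var ''n'' \<^bold>- Var ''m''));;
        ''u'' ::= M \<^bold>/ Var ''n'';;
        (IF Var ''n'' \<^bold>< Var ''u'' THEN ''u'' ::= Var ''n'' ELSE Skip);;
        FOR ''k'' FROM Const 2 TO Var ''u'' DO
          lower_to Compl (Var ''k'' \<^bold>* Var ''n'')
            (Read Compl (Var ''k'') \<^bold>+ Read Compl (Var ''n''))))"

text \<open>
  In the space-improved algorithm the array \<open>B0\<close> is the fixed block, \<open>Hs\<close> holds the \<open>H\<^sub>j\<close>, and
  \<open>init\<close> tells which running blocks are initialized. The running blocks lie one after the other
  in the array \<open>B\<close>, and the entry of \<open>B\<^sub>j\<close> for \<open>n\<close>, where \<open>H\<^sub>j - L < n \<le> H\<^sub>j\<close>, has offset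
  \<open>n - (H\<^sub>j - L) - 1\<close> in its block.
\<close>

definition base :: "exp \<Rightarrow> exp" where
  "base j = (j \<^bold>- Const 1) \<^bold>* Var ''L''"

definition slot :: "exp \<Rightarrow> exp \<Rightarrow> exp" where
  "slot j n = base j \<^bold>+ (n \<^bold>- (Read ''Hs'' j \<^bold>- Var ''L'') \<^bold>- Const 1)"

definition initialize :: "exp \<Rightarrow> com" where
  "initialize j =
    (Write ''Hs'' j (Var ''H'');;
     FOR ''i'' FROM Var ''H'' \<^bold>- Var ''L'' \<^bold>+ Const 1 TO Var ''H'' DO
       Write ''B'' (slot j (Var ''i'')) (Read ''B0'' (Var ''i''));;
     Write ''init'' j (Const 1))"

definition shift :: "exp \<Rightarrow> com" where
  "shift j =
    (Write ''Hs'' j (Read ''Hs'' j \<^bold>+ Var ''l'');;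
     FOR ''i'' FROM Const 0 TO Var ''l'' \<^bold>- Const 1 DO
       Write ''B'' (base j \<^bold>+ Var ''i'') (Read ''B'' (base j \<^bold>+ Var ''l'' \<^bold>+ Var ''i''));;
     FOR ''i'' FROM Var ''l'' TO Var ''L'' \<^bold>- Const 1 DO
       Write ''B'' (base j \<^bold>+ Var ''i'') (Var ''U''))"

text \<open>
  For each \<open>a \<ge> 2\<close> with \<open>a\<^sup>2 \<le> H\<^sub>j\<close>, the relevant \<open>b\<close> start at
  \<open>max a (\<lfloor>(H\<^sub>j - l) / a\<rfloor> + 1)\<close>.
\<close>

definition product_step :: "exp \<Rightarrow> com" where
  "product_step j =
    (''a'' ::= Const 2;;
     WHILE Var ''a'' \<^bold>* Var ''a'' \<^bold>\<le> Read ''Hs'' j DO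
       (''b'' ::= (Read ''Hs'' j \<^bold>- Var ''l'') \<^bold>/ Var ''a'' \<^bold>+ Const 1;;
        (IF Var ''b'' \<^bold>< Var ''a'' THEN ''b'' ::= Var ''a'' ELSE Skip);;
        WHILE Var ''a'' \<^bold>* Var ''b'' \<^bold>\<le> Read ''Hs'' j DO
          ((IF Read ''Hs'' j \<^bold>/ Var ''a'' \<^bold>\<le> Var ''H''
            THEN ''c'' ::= Read ''B0'' (Var ''b'')
            ELSE ''c'' ::= Read ''B'' (slot (Var ''a'' \<^bold>* j) (Var ''b'')));;
           lower_to ''B'' (slot j (Var ''a'' \<^bold>* Var ''b''))
             (Read ''B0'' (Var ''a'') \<^bold>+ Var ''c'');;
           ''b'' ::= Var ''b'' \<^bold>+ Const 1);;
        ''a'' ::= Var ''a'' \<^bold>+ Const 1))"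

definition sum_step :: "exp \<Rightarrow> com" where
  "sum_step j =
    (FOR ''n'' FROM Read ''Hs'' j \<^bold>- Var ''l'' \<^bold>+ Const 1 TO Read ''Hs'' j DO
       (lower_to ''B'' (slot j (Var ''n''))
          (Read ''B'' (slot j (Var ''n'' \<^bold>- Const 1)) \<^bold>+ Const 1);;
        compute_kMax (Read ''B'' (slot j (Var ''n'' \<^bold>- Const 1)));;
        FOR ''k'' FROM Const 6 TO Var ''kMax'' DO
          lower_to ''B'' (slot j (Var ''n''))
            (Read ''B0'' (Var ''k'') \<^bold>+ Read ''B'' (slot j (Var ''n'' \<^bold>- Var ''k'')))))"

text \<open>
  On input \<open>N\<close>, \<open>H\<close>, \<open>l\<close>. The values are output as soon as they are final, that is, once \<open>B0\<close> has
  been computed and after each shift of \<open>B\<^sub>1\<close>. The indices of running blocks are at most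
  \<open>\<lceil>N / H\<rceil> - 1\<close>, except that \<open>B\<^sub>1\<close> also exists when \<open>N \<le> H\<close>.
\<close>

definition space_improved :: com where
  "space_improved =
    (''L'' ::= Const 2 \<^bold>* Var ''l'';;
     time_improved ''B0'' (Var ''H'');;
     FOR ''i'' FROM Const 1 TO Var ''H'' DO
       (IF Var ''i'' \<^bold>\<le> Var ''N'' THEN Emit (Read ''B0'' (Var ''i'')) ELSE Skip);;
     compute_bound ''U'' (Var ''N'');;
     ''J'' ::= (Var ''N'' \<^bold>+ Var ''H'' \<^bold>- Const 1) \<^bold>/ Var ''H'';;
     Alloc ''Hs'' (Var ''J'' \<^bold>+ Const 1) (Const 0);;
     Alloc ''init'' (Var ''J'' \<^bold>+ Const 1) (Const 0);;
     Alloc ''B'' (Var ''J'' \<^bold>* Var ''L'') (Const 0);;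
     initialize (Const 1);;
     WHILE Read ''Hs'' (Const 1) \<^bold>< Var ''N'' DO
       (''h'' ::= Read ''Hs'' (Const 1) \<^bold>+ Var ''l'';;
        (IF Var ''N'' \<^bold>< Var ''h'' THEN ''h'' ::= Var ''N'' ELSE Skip);;
        ''j'' ::= (Var ''h'' \<^bold>+ Var ''H'' \<^bold>- Const 1) \<^bold>/ Var ''H'' \<^bold>- Const 1;;
        WHILE Const 1 \<^bold>\<le> Var ''j'' DO
          (''newH'' ::= Var ''l'' \<^bold>*
             ((Var ''h'' \<^bold>+ Var ''j'' \<^bold>* Var ''l'' \<^bold>- Const 1) \<^bold>/ (Var ''j'' \<^bold>* Var ''l''));;
           (IF Read ''init'' (Var ''j'') \<^bold>= Const 0
            THEN IF Var ''H'' \<^bold>< Var ''newH'' THEN initialize (Var ''j'') ELSE Skip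
            ELSE Skip);;
           (IF Read ''init'' (Var ''j'') \<^bold>= Const 1
            THEN IF Read ''Hs'' (Var ''j'') \<^bold>< Var ''newH''
                 THEN shift (Var ''j'');;
                      product_step (Var ''j'');;
                      sum_step (Var ''j'');;
                      (IF Var ''j'' \<^bold>= Const 1
                       THEN FOR ''i'' FROM Read ''Hs'' (Const 1) \<^bold>- Var ''l'' \<^bold>+ Const 1
                                TO Read ''Hs'' (Const 1) DO
                              Emit (Read ''B'' (slot (Const 1) (Var ''i'')))
                       ELSE Skip)
                 ELSE Skip
            ELSE Skip);;
           ''j'' ::= Var ''j'' \<^bold>- Const 1)))"

definition input_state :: "nat \<Rightarrow> nat \<Rightarrow> nat \<Rightarrow> state" where
  "input_state N H l =
     \<lparr>vars = (\<lambda>_. 0)(''N'' := int N, ''H'' := int H, ''l'' := int l),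
      arrs = (\<lambda>_. []), emitted = []\<rparr>"

definition admissible :: "nat \<Rightarrow> nat \<Rightarrow> nat \<Rightarrow> bool" where
  "admissible N H l \<longleftrightarrow>
     N > 0 \<and> H > 0 \<and> l > 0 \<and>
     (\<forall>n\<in>{2..N}. kMax n < l) \<and>
     N \<le> l * H \<and> l dvd H \<and> l dvd N \<and>
     real H \<ge> sqrt (real (2 * l) * real N)"

end

theory Submission
  imports Defs "HOL-Real_Asymp.Real_Asymp" "HOL-Library.Discrete_Functions"
begin

text \<open>
  A sum of complexity at most \<open>T = \<parallel>n - 1\<parallel>\<close> that represents \<open>n\<close> has its smaller summand bounded by
  \<open>kMax n\<close>, because \<open>E j\<close> is the greatest number of complexity \<open>j\<close>; summands below 6 are covered by
  \<open>\<parallel>n - 1\<parallel> + 1\<close>. Hence all candidates are examined. For the running blocks the point is that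
  \<open>\<lceil>\<lceil>K / j\<rceil> / a\<rceil> = \<lceil>K / (a j)\<rceil>\<close>, so that a cofactor beyond \<open>H\<close> always lies in the block \<open>B\<^sub>a\<^sub>j\<close>,
  updated before \<open>B\<^sub>j\<close>.

  The time is governed by the sum of \<open>kMax n \<le> 2 \<cdot> 3 powr (\<parallel>n - 1\<parallel> / 3) / n\<close>. Splitting \<open>n = q m + s\<close>
  with \<open>q \<in> {2, 3}\<close> chosen by the residue class of \<open>n\<close> modulo 24 gives a linear recursion for the sums
  over residue classes, and a numerical subsolution shows that they grow at most like \<open>N powr (27/22)\<close>.
  This exponent is below \<open>\<alpha>\<close>, which leaves room for the logarithms, and all other contributions are smaller.

  The bound \<open>kMax n \<le> 2 n powr \<beta>\<close> allows a block length \<open>\<ell>\<close> of order \<open>N powr \<beta>\<close>, hence \<open>H\<close> of order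
  \<open>N powr ((1 + \<beta>) / 2)\<close>, while all running blocks together occupy at most \<open>2 H\<close> entries of
  \<open>O (ln (ln N))\<close> bits.
\<close>



subsection \<open>Integer complexity\<close>

lemma ones_value_pos: "ones_value e \<ge> 1"
  by (induction e) auto

lemma ones_count_pos: "ones_count e \<ge> 1"
  by (induction e) auto

lemma ones_expr_exists:
  assumes "n \<ge> 1"
  shows "\<exists>e. ones_value e = n"
  using assms
proof (induction n rule: nat_induct_at_least)
  case base
  show ?case by (rule exI[of _ One]) simp
next
  case (Suc n)
  then obtain e where "ones_value e = n" by blast
  then show ?case by (intro exI[of _ "Sum e One"]) simp
qed

lemma complexity_le: "complexity (ones_value e) \<le> ones_count e"
  unfolding complexity_def by (rule Least_le) auto

lemma complexity_witness:
  assumes "n \<ge> 1"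
  obtains e where "ones_value e = n" "ones_count e = complexity n"
proof -
  obtain e0 where "ones_value e0 = n" using ones_expr_exists[OF assms] by blast
  then have "\<exists>k e. ones_value e = n \<and> ones_count e = k" by blast
  from LeastI_ex[OF this] that show thesis unfolding complexity_def by blast
qed

lemma complexity_pos: "n \<ge> 1 \<Longrightarrow> complexity n \<ge> 1"
  by (metis complexity_witness ones_count_pos)

lemma complexity_1: "complexity (Suc 0) = 1"
  using complexity_le[of One] complexity_pos[of 1] by simp

lemma complexity_add:
  assumes "a \<ge> 1" "b \<ge> 1"
  shows "complexity (a + b) \<le> complexity a + complexity b"
proof -
  obtain e f where "ones_value e = a" "ones_count e = complexity a"
    "ones_value f = b" "ones_count f = complexity b"
    using complexity_witness assms by metis
  then show ?thesis using complexity_le[of "Sum e f"] by simp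
qed

lemma complexity_mult:
  assumes "a \<ge> 1" "b \<ge> 1"
  shows "complexity (a * b) \<le> complexity a + complexity b"
proof -
  obtain e f where "ones_value e = a" "ones_count e = complexity a"
    "ones_value f = b" "ones_count f = complexity b"
    using complexity_witness assms by metis
  then show ?thesis using complexity_le[of "Prod e f"] by simp
qed

lemma complexity_Suc: "n \<ge> 1 \<Longrightarrow> complexity (Suc n) \<le> complexity n + 1"
  using complexity_add[of n 1] complexity_1 by simp

lemma complexity_le_self: "n \<ge> 1 \<Longrightarrow> complexity n \<le> n"
  by (induction n rule: nat_induct_at_least) (use complexity_1 complexity_Suc in fastforce)+

lemma complexity_decomp:
  assumes "n \<ge> 2"
  obtains (sum) a b where "1 \<le> a" "a \<le> b" "a + b = n" "complexity n = complexity a + complexity b"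
    | (prod) a b where "2 \<le> a" "a \<le> b" "a * b = n" "complexity n = complexity a + complexity b"
proof -
  obtain e where e: "ones_value e = n" "ones_count e = complexity n"
    using complexity_witness assms by (metis One_nat_def Suc_1 Suc_leD)
  show thesis
  proof (cases e)
    case One
    then show ?thesis using e assms by simp
  next
    case (Sum f g)
    let ?a = "ones_value f" and ?b = "ones_value g"
    have ab: "?a + ?b = n" "?a \<ge> 1" "?b \<ge> 1" using e Sum ones_value_pos by auto
    have "complexity n = complexity ?a + complexity ?b"
      using e Sum complexity_le[of f] complexity_le[of g] complexity_add[OF ab(2,3)] ab(1) by simp
    then show ?thesis using ab sum[of ?a ?b] sum[of ?b ?a] by (cases "?a \<le> ?b") auto
  next
    case (Prod f g)
    let ?a = "ones_value f" and ?b = "ones_value g"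
    have ab: "?a * ?b = n" "?a \<ge> 1" "?b \<ge> 1" using e Prod ones_value_pos by auto
    have c: "complexity n = complexity ?a + complexity ?b"
      using e Prod complexity_le[of f] complexity_le[of g] complexity_mult[OF ab(2,3)] ab(1) by simp
    have "?a \<noteq> 1" using c ab complexity_pos[of ?a] by auto
    moreover have "?b \<noteq> 1" using c ab complexity_pos[of ?b] by auto
    ultimately have "?a \<ge> 2" "?b \<ge> 2" using ab by auto
    then show ?thesis using ab c prod[of ?a ?b] prod[of ?b ?a]
      by (cases "?a \<le> ?b") (auto simp: mult.commute)
  qed
qed

lemma two_pow_complexity:
  assumes "n \<ge> 2"
  shows "2 ^ complexity n \<le> n ^ 3"
  using assms
proof (induction n rule: less_induct)
  case (less n)
  have c2: "complexity 2 \<le> 2" using complexity_le_self[of 2] by simp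
  have c3: "complexity 3 \<le> 3" using complexity_le_self[of 3] by simp
  consider "n = 2" | "n = 3" | m where "m \<ge> 2" "n = 2 * m" | m where "m \<ge> 2" "n = 2 * m + 1"
  proof -
    have "n = 2 * (n div 2) \<or> n = 2 * (n div 2) + 1" by presburger
    moreover have "n = 2 \<or> n = 3 \<or> n div 2 \<ge> 2" using less.prems by presburger
    ultimately show thesis using that by blast
  qed
  then show ?case
  proof cases
    case 1
    then have "(2::nat) ^ complexity n \<le> 2 ^ 2" using c2 by (intro power_increasing) auto
    then show ?thesis using 1 by simp
  next
    case 2
    then have "(2::nat) ^ complexity n \<le> 2 ^ 3" using c3 by (intro power_increasing) auto
    then show ?thesis using 2 by simp
  next
    case 3
    have "complexity n \<le> 3 + complexity m" using complexity_mult[of 2 m] 3 c2 by simp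
    then have "(2::nat) ^ complexity n \<le> 2 ^ (3 + complexity m)" by (intro power_increasing) auto
    also have "\<dots> \<le> 8 * m ^ 3" using less.IH[of m] 3 by (simp add: power_add)
    finally show ?thesis using 3 by (simp add: power_mult_distrib)
  next
    case 4
    have "complexity (2 * m) \<le> 2 + complexity m" using complexity_mult[of 2 m] 4 c2 by simp
    then have "complexity n \<le> 3 + complexity m" using complexity_Suc[of "2 * m"] 4 by simp
    then have "(2::nat) ^ complexity n \<le> 2 ^ (3 + complexity m)" by (intro power_increasing) auto
    also have "\<dots> \<le> (2 * m) ^ 3" using less.IH[of m] 4 by (simp add: power_add power_mult_distrib)
    also have "\<dots> \<le> n ^ 3" using 4 by (intro power_mono) auto
    finally show ?thesis .
  qed
qed

subsection \<open>The greatest number of a given complexity\<close>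

lemma E_small: "E 0 = 1" "E (Suc 0) = 1" "E (Suc (Suc 0)) = 2" "E (Suc (Suc (Suc 0))) = 3" "E 2 = 2" "E 3 = 3" "E 4 = 4"
    "E 5 = 6" "E 6 = 9" "E 7 = 12" "E 8 = 18"
  by (simp_all add: E_def)

lemma E_step:
  assumes "j \<ge> 2"
  shows "E (j + 3) = 3 * E j"
proof -
  have j: "j \<noteq> 0" "j \<noteq> 1" using assms by auto
  show ?thesis
  proof (cases "j mod 3 = 1")
    case True
    then have "j div 3 \<ge> 1" using j by presburger
    then obtain k where "j div 3 = Suc k" by (cases "j div 3") auto
    then show ?thesis using True j by (simp add: E_def)
  qed (use j in \<open>simp add: E_def\<close>)
qed

lemma E_induct [case_names small step]:
  assumes "\<And>j. j < 5 \<Longrightarrow> P j" "\<And>j. 2 \<le> j \<Longrightarrow> P j \<Longrightarrow> P (j + 3)"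
  shows "P (j::nat)"
proof (induction j rule: less_induct)
  case (less j)
  show ?case
  proof (cases "j < 5")
    case False
    then show ?thesis using assms(2)[of "j - 3"] less[of "j - 3"] by simp
  qed (use assms(1) in auto)
qed

lemma less_5_cases: "(j::nat) < 5 \<longleftrightarrow> j = 0 \<or> j = 1 \<or> j = 2 \<or> j = 3 \<or> j = 4"
  by auto

lemma E_Suc: "E j \<le> E (Suc j)"
proof (induction j rule: E_induct)
  case (small j)
  then show ?case by (auto simp: less_5_cases E_small)
next
  case (step j)
  then show ?case using E_step[of j] E_step[of "Suc j"] by simp
qed

lemma E_mono: "i \<le> j \<Longrightarrow> E i \<le> E j"
  by (rule lift_Suc_mono_le[of E, OF E_Suc])

lemma E_cube: "E j ^ 3 \<le> 3 ^ j"
  by (induction j rule: E_induct)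
     (auto simp: less_5_cases E_small E_step power_mult_distrib power_add)

lemma E_ge_self: "j \<le> E j"
  by (induction j rule: E_induct) (auto simp: less_5_cases E_small E_step)

lemma E_mult: "E i * E j \<le> E (i + j)"
proof (induction i rule: E_induct)
  case (small i)
  then show ?case
  proof (induction j rule: E_induct)
    case (small j)
    then show ?case by (auto simp: less_5_cases E_small)
  next
    case (step j)
    then show ?case using E_step[of j] E_step[of "i + j"] by (simp add: add.assoc)
  qed
next
  case (step i)
  then show ?case using E_step[of i] E_step[of "i + j"] by (simp add: ac_simps)
qed

lemma E_add:
  assumes "i \<ge> 1" "j \<ge> 1"
  shows "E i + E j \<le> E (i + j)"
proof -
  have *: "E (Suc j) \<ge> E j + 1" if "j \<ge> 1" for j
    using that
  proof (induction j rule: E_induct)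
    case (small j)
    then show ?case by (auto simp: less_5_cases E_small)
  next
    case (step j)
    then show ?case using E_step[of j] E_step[of "Suc j"] by simp
  qed
  consider "i = 1" | "j = 1" | "i \<ge> 2" "j \<ge> 2" using assms by linarith
  then show ?thesis
  proof cases
    case 1
    then show ?thesis using *[of j] assms by (simp add: E_small)
  next
    case 2
    then show ?thesis using *[of i] assms by (simp add: E_small)
  next
    case 3
    then have "E i \<ge> 2" "E j \<ge> 2" using E_mono[of 2 i] E_mono[of 2 j] by (simp_all add: E_small)
    then obtain x y where "E i = x + 2" "E j = y + 2" by (metis add.commute le_Suc_ex)
    then have "E i + E j \<le> E i * E j" by simp
    also have "\<dots> \<le> E (i + j)" by (rule E_mult)
    finally show ?thesis .
  qed
qed

lemma ones_value_le_E: "ones_value e \<le> E (ones_count e)"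
proof (induction e)
  case (Sum e f)
  then show ?case using E_add[of "ones_count e" "ones_count f"] ones_count_pos[of e] ones_count_pos[of f]
    by simp
next
  case (Prod e f)
  then have "ones_value e * ones_value f \<le> E (ones_count e) * E (ones_count f)"
    by (rule mult_le_mono)
  then show ?case using E_mult[of "ones_count e" "ones_count f"] by simp
qed (simp add: E_small)

lemma le_E_complexity: "n \<ge> 1 \<Longrightarrow> n \<le> E (complexity n)"
  by (metis complexity_witness ones_value_le_E)

subsection \<open>The bound on the smaller summand\<close>

lemma kmax_loop_le: "kmax_loop n T t \<le> t"
  by (induction t) auto

lemma kmax_loop_ge:
  assumes "s \<le> t" "n \<le> E s + E (T - s)"
  shows "s \<le> kmax_loop n T t"
  using assms(1)
proof (induction t)
  case (Suc t)
  then show ?case using assms(2) by (cases "s = Suc t") auto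
qed simp

lemma kmax_loop_cond:
  assumes "n \<le> E 0 + E T"
  shows "n \<le> E (kmax_loop n T t) + E (T - kmax_loop n T t)"
  by (induction t) (use assms in auto)

lemma kmax_loop_above:
  assumes "kmax_loop n T t < s" "s \<le> t"
  shows "E s + E (T - s) < n"
  using assms
proof (induction t)
  case (Suc t)
  then show ?case by (cases "s = Suc t") (auto split: if_splits)
qed simp

definition kmax_index :: "nat \<Rightarrow> nat" where
  "kmax_index n = kmax_loop n (complexity (n - 1)) (complexity (n - 1) div 2)"

lemma kMax_eq: "kMax n = E (kmax_index n)"
  by (simp add: kMax_def kmax_index_def Let_def)

lemma kmax_index_le: "kmax_index n \<le> complexity (n - 1) div 2"
  unfolding kmax_index_def by (rule kmax_loop_le)

lemma kmax_index_cond: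
  assumes "n \<ge> 2"
  shows "n \<le> E (kmax_index n) + E (complexity (n - 1) - kmax_index n)"
  unfolding kmax_index_def
  by (rule kmax_loop_cond) (use le_E_complexity[of "n - 1"] assms E_small in linarith)

lemma complexity_eq_if_candidates:
  assumes "n \<ge> 2" "complexity n \<le> v" "v \<le> complexity (n - 1) + 1"
    and sums: "\<And>k. 6 \<le> k \<Longrightarrow> k \<le> kMax n \<Longrightarrow> k < n \<Longrightarrow> v \<le> complexity k + complexity (n - k)"
    and prods: "\<And>a b. 2 \<le> a \<Longrightarrow> a \<le> b \<Longrightarrow> a * b = n \<Longrightarrow> v \<le> complexity a + complexity b"
  shows "v = complexity n"
proof -
  define T where "T = complexity (n - 1)"
  from \<open>n \<ge> 2\<close> have "v \<le> complexity n"
  proof (cases rule: complexity_decomp)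
    case (prod a b)
    then show ?thesis using prods by simp
  next
    case (sum a b)
    show ?thesis
    proof (cases "T + 1 \<le> complexity n")
      case True
      then show ?thesis using assms(3) unfolding T_def by simp
    next
      case False
      then have T: "complexity a + complexity b \<le> T" using sum by simp
      define s where "s = min (complexity a) (complexity b)"
      define s' where "s' = max (complexity a) (complexity b)"
      have ss: "s + s' \<le> T" "s \<le> s'" using T unfolding s_def s'_def by auto
      have a: "a \<le> E (complexity a)" and b: "b \<le> E (complexity b)"
        using le_E_complexity sum by auto
      have as: "a \<le> E s" using a b sum unfolding s_def by (auto simp: min_def)
      have "n \<le> E s + E s'"
        using a b sum unfolding s_def s'_def by (auto simp: min_def max_def)
      also have "E s' \<le> E (T - s)" using ss by (intro E_mono) simp
      finally have "s \<le> kmax_index n" unfolding kmax_index_def T_def[symmetric]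
        using ss by (intro kmax_loop_ge) auto
      then have "a \<le> kMax n" using as E_mono unfolding kMax_eq by (meson order_trans)
      moreover have "\<not> a < 6"
      proof
        assume "a < 6"
        have "complexity a \<ge> a"
        proof (rule ccontr)
          assume "\<not> ?thesis"
          then have "complexity a \<le> a - 1" by simp
          then have "a \<le> E (a - 1)" using a E_mono le_trans by blast
          moreover have "a = 1 \<or> a = 2 \<or> a = 3 \<or> a = 4 \<or> a = 5" using \<open>a < 6\<close> \<open>1 \<le> a\<close> by auto
          ultimately show False using \<open>\<not> complexity a \<ge> a\<close> complexity_1 by (auto simp: E_small)
        qed
        have "complexity (n - 1) + 1 \<le> complexity n"
        proof (cases "a = 1")
          case True
          then have "n - 1 = b" using sum by simp
          then show ?thesis using True sum complexity_1 by simp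
        next
          case False
          then have "complexity (a - 1 + b) \<le> complexity (a - 1) + complexity b"
            using sum by (intro complexity_add) auto
          moreover have "complexity (a - 1) \<le> a - 1" using False sum by (intro complexity_le_self) auto
          moreover have "a - 1 + b = n - 1" using False sum by simp
          ultimately show ?thesis using \<open>complexity a \<ge> a\<close> sum by simp
        qed
        then show False using \<open>\<not> T + 1 \<le> complexity n\<close> unfolding T_def by simp
      qed
      ultimately show ?thesis using sums[of a] sum by auto
    qed
  qed
  then show ?thesis using assms(2) by simp
qed

lemma E_square_le:
  assumes "n \<ge> 2" "2 * j \<le> complexity n"
  shows "E j < n"
proof -
  have "E j ^ 12 = (E j ^ 3) ^ 4" by (simp flip: power_mult)
  also have "\<dots> \<le> (3 ^ j) ^ 4" by (intro power_mono E_cube) simp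
  also have "\<dots> = 3 ^ (2 * (2 * j))" by (simp flip: power_mult add: mult.commute)
  also have "\<dots> \<le> (3::nat) ^ (2 * complexity n)" using assms by (intro power_increasing) auto
  finally have 1: "E j ^ 12 \<le> 9 ^ complexity n" by (simp add: power_mult)
  have "(9 ^ complexity n) ^ 3 = (729::nat) ^ complexity n"
    by (simp flip: power_mult add: mult.commute[of _ 3]) (simp add: power_mult)
  also have "\<dots> < 1024 ^ complexity n"
    using assms complexity_pos[of n] by (intro power_strict_mono) auto
  also have "\<dots> = (2 ^ complexity n) ^ 10"
    by (simp flip: power_mult add: mult.commute[of _ 10]) (simp add: power_mult)
  also have "\<dots> \<le> (n ^ 3) ^ 10" by (intro power_mono two_pow_complexity assms) simp
  finally have "(9 ^ complexity n) ^ 3 < (n ^ 10) ^ 3" by (simp flip: power_mult)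
  then have "9 ^ complexity n < n ^ 10" by (rule power_less_imp_less_base) simp
  also have "\<dots> \<le> n ^ 12" using assms by (intro power_increasing) auto
  finally have "E j ^ 12 < n ^ 12" using 1 by simp
  then show ?thesis by (rule power_less_imp_less_base) simp
qed

lemma kMax_less:
  assumes "n \<ge> 2"
  shows "kMax n < n"
proof (cases "n = 2")
  case True
  then show ?thesis using kmax_index_le[of 2] by (simp add: kMax_eq complexity_1 E_small)
next
  case False
  then have "n - 1 \<ge> 2" using assms by simp
  then have "E (kmax_index n) < n - 1"
    by (rule E_square_le) (use kmax_index_le[of n] in simp)
  then show ?thesis by (simp add: kMax_eq)
qed

lemma kMax_cube_le:
  assumes "n \<ge> 2"
  shows "kMax n ^ 3 * n ^ 3 \<le> 8 * 3 ^ complexity (n - 1)"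
proof -
  define T where "T = complexity (n - 1)"
  define t where "t = kmax_index n"
  have t: "t \<le> T div 2" using kmax_index_le[of n] by (simp add: t_def T_def)
  have "n \<le> E t + E (T - t)" using kmax_index_cond[OF assms] by (simp add: t_def T_def)
  also have "E t \<le> E (T - t)" using t by (intro E_mono) simp
  finally have "n ^ 3 \<le> (2 * E (T - t)) ^ 3" by (intro power_mono) auto
  then have n: "n ^ 3 \<le> 8 * E (T - t) ^ 3" by (simp add: power_mult_distrib)
  have "kMax n ^ 3 * n ^ 3 \<le> E t ^ 3 * (8 * E (T - t) ^ 3)"
    using n by (simp add: kMax_eq t_def)
  also have "\<dots> = 8 * (E t ^ 3 * E (T - t) ^ 3)" by simp
  also have "\<dots> \<le> 8 * (3 ^ t * 3 ^ (T - t))" by (intro mult_le_mono E_cube le_refl)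
  also have "3 ^ t * 3 ^ (T - t) = (3::nat) ^ T" using t by (simp flip: power_add)
  finally show ?thesis by (simp add: T_def)
qed


subsection \<open>Growth of the complexity on average\<close>

definition cube_root_3 :: real where "cube_root_3 = root 3 3"

lemma cube_root_3_pow: "cube_root_3 ^ 3 = 3" "cube_root_3 > 0" "cube_root_3 \<ge> 1"
  by (simp_all add: cube_root_3_def real_root_pow_pos2)

definition weight :: "nat \<Rightarrow> real" where
  "weight n = cube_root_3 ^ complexity n / real n"

lemma weight_nonneg: "weight n \<ge> 0"
  using cube_root_3_pow by (simp add: weight_def)

definition class_sum :: "nat \<Rightarrow> nat \<Rightarrow> real" where
  "class_sum c N = (\<Sum>n | n \<in> {1..N} \<and> n mod 24 = c. weight n)"

lemma class_sum_nonneg: "class_sum c N \<ge> 0"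
  unfolding class_sum_def by (intro sum_nonneg weight_nonneg)

lemma weight_step:
  assumes "m \<ge> 1" "q \<ge> 1"
  shows "weight (q * m + s) \<le> cube_root_3 ^ (q + s) / real q * weight m"
proof -
  have "complexity (q * m) \<le> q + complexity m"
    using complexity_mult[of q m] complexity_le_self[of q] assms by simp
  moreover have "complexity (q * m + s) \<le> complexity (q * m) + s"
  proof (cases "s = 0")
    case False
    then show ?thesis using complexity_add[of "q * m" s] complexity_le_self[of s] assms by simp
  qed simp
  ultimately have "cube_root_3 ^ complexity (q * m + s) \<le> cube_root_3 ^ (q + s + complexity m)"
    using cube_root_3_pow by (intro power_increasing) auto
  then have "weight (q * m + s) \<le> cube_root_3 ^ (q + s + complexity m) / real (q * m)"
    unfolding weight_def using assms cube_root_3_pow by (intro frac_le) auto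
  then show ?thesis by (simp add: weight_def power_add)
qed

lemma class_sum_step:
  assumes q: "q dvd 24" "q \<ge> 1"
  shows "class_sum c N \<le> (\<Sum>n\<in>{1..<q}. weight n) + cube_root_3 ^ (q + c mod q) / real q *
    (\<Sum>d | d < 24 \<and> (q * d + c mod q) mod 24 = c. class_sum d (N div q))"
proof -
  define s where "s = c mod q"
  define f where "f = cube_root_3 ^ (q + s) / real q"
  define X where "X = {n. n \<in> {1..N} \<and> n mod 24 = c}"
  define D where "D = {d. d < 24 \<and> (q * d + s) mod 24 = c}"
  define Y where "Y = {m. m \<in> {1..N div q} \<and> m mod 24 \<in> D}"
  have f: "f \<ge> 0" using cube_root_3_pow by (simp add: f_def)
  have fin: "finite X" "finite Y" "finite D" by (auto simp: X_def Y_def D_def)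
  have inj: "inj_on (\<lambda>m. q * m + s) Y" using q by (auto intro!: inj_onI)
  have "X \<subseteq> {1..<q} \<union> (\<lambda>m. q * m + s) ` Y"
  proof
    fix n assume "n \<in> X"
    then have n: "1 \<le> n" "n \<le> N" "n mod 24 = c" by (auto simp: X_def)
    show "n \<in> {1..<q} \<union> (\<lambda>m. q * m + s) ` Y"
    proof (cases "n < q")
      case False
      define m where "m = n div q"
      have "n mod q = s" unfolding s_def n(3)[symmetric] using q by (simp add: mod_mod_cancel)
      then have nm: "n = q * m + s" by (metis m_def mult_div_mod_eq)
      have "m \<ge> 1" using False q by (simp add: m_def div_greater_zero_iff Suc_le_eq)
      moreover have "m \<le> N div q" using n by (simp add: m_def div_le_mono)
      moreover have "(q * (m mod 24) + s) mod 24 = (q * m + s) mod 24"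
        by (metis mod_add_left_eq mod_mult_right_eq)
      then have "m mod 24 \<in> D" using n nm by (simp add: D_def)
      ultimately show ?thesis using nm by (auto simp: Y_def)
    qed (use n in auto)
  qed
  then have "sum weight X \<le> sum weight ({1..<q} \<union> (\<lambda>m. q * m + s) ` Y)"
    using fin weight_nonneg by (intro sum_mono2) auto
  also have "\<dots> \<le> sum weight {1..<q} + sum weight ((\<lambda>m. q * m + s) ` Y)"
    using fin weight_nonneg by (subst sum_Un) (auto intro: sum_nonneg)
  also have "sum weight ((\<lambda>m. q * m + s) ` Y) = (\<Sum>m\<in>Y. weight (q * m + s))"
    using inj by (simp add: sum.reindex)
  also have "\<dots> \<le> (\<Sum>m\<in>Y. f * weight m)"
    unfolding f_def using q by (intro sum_mono weight_step) (auto simp: Y_def)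
  also have "\<dots> = f * sum weight Y" by (simp add: sum_distrib_left)
  also have "Y = (\<Union>d\<in>D. {m. m \<in> {1..N div q} \<and> m mod 24 = d})"
    by (auto simp: Y_def)
  also have "sum weight \<dots> = (\<Sum>d\<in>D. class_sum d (N div q))"
    unfolding class_sum_def using fin by (intro sum.UNION_disjoint) auto
  finally show ?thesis by (simp add: class_sum_def X_def f_def D_def s_def)
qed

text \<open>
  A subsolution of the recursion in \<open>class_sum_step\<close>, found by value iteration: in the residue
  class \<open>c\<close> modulo 24 the divisor \<open>divisor ! c\<close> is used. The margin of one part in a thousand
  absorbs the additive terms.
\<close>

definition potential :: "nat list" where
  "potential = [273, 394, 394, 376, 394, 569, 347, 500, 361, 450, 520, 751,
     339, 489, 489, 412, 414, 597, 414, 597, 567, 520, 750, 1082]"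

definition divisor :: "nat list" where
  "divisor = [2, 2, 2, 3, 2, 2, 3, 3, 2, 3, 2, 2, 3, 3, 2, 3, 2, 2, 3, 3, 2, 3, 3, 3]"

text \<open>Lower bounds for \<open>2 powr (27/22)\<close> and \<open>3 powr (27/22)\<close> and upper bounds for \<open>3 powr (j / 3)\<close>, times 1000.\<close>

definition divisor_powr :: "nat \<Rightarrow> nat" where
  "divisor_powr q = (if q = 2 then 2341 else 3850)"

definition root_pow :: "nat \<Rightarrow> nat" where
  "root_pow j = (if j = 2 then 2081 else if j = 3 then 3000 else if j = 4 then 4327 else 6241)"

lemma residue_list: "[0..<24] = [0, 1, 2, 3, 4, 5, 6, 7, 8, 9, 10, 11, 12, 13, 14, 15, 16, 17,
    18, 19, 20, 21, 22, 23]"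
  by (simp add: upt_conv_Cons)

lemma potential_subsolution:
  "list_all (\<lambda>c. let q = divisor ! c in
     1000 * root_pow (q + c mod q) *
       sum_list (map (\<lambda>d. potential ! d) (filter (\<lambda>d. (q * d + c mod q) mod 24 = c) [0..<24]))
     \<le> 999 * q * divisor_powr q * potential ! c) [0..<24]"
  unfolding residue_list list.pred_inject
  by (simp add: Let_def potential_def divisor_def root_pow_def divisor_powr_def)

lemma divisor_values:
  "list_all (\<lambda>c. (divisor ! c = 2 \<or> divisor ! c = 3) \<and> potential ! c \<ge> 55) [0..<24]"
  unfolding residue_list list.pred_inject
  by (simp add: potential_def divisor_def)

lemma powr_rational_ge:
  fixes p x d n k :: nat
  assumes le: "p ^ n \<le> x ^ k * d ^ n" and "d > 0" "n > 0" "x \<ge> 1" "a \<ge> real k / real n"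
  shows "real p / real d \<le> real x powr a"
proof (cases "p = 0")
  case False
  have "real (p ^ n) \<le> real (x ^ k * d ^ n)" using le by (rule of_nat_mono)
  then have pow: "(real p / real d) ^ n \<le> real x ^ k"
    using \<open>d > 0\<close> by (simp add: power_divide divide_le_eq)
  have "real p / real d = ((real p / real d) ^ n) powr (1 / real n)"
    using assms False by (simp add: powr_powr flip: powr_realpow)
  also have "\<dots> \<le> (real x ^ k) powr (1 / real n)" using pow by (intro powr_mono2) auto
  also have "\<dots> = real x powr (real k / real n)"
    using assms by (simp add: powr_powr flip: powr_realpow)
  also have "\<dots> \<le> real x powr a" using assms by (intro powr_mono) auto
  finally show ?thesis .
qed simp

lemma divisor_powr_le:
  assumes "q = 2 \<or> q = 3" "a \<ge> 27/22"
  shows "real (divisor_powr q) / 1000 \<le> real q powr a"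
proof -
  have "(2341::nat) ^ 22 \<le> 2 ^ 27 * 1000 ^ 22" "(3850::nat) ^ 22 \<le> 3 ^ 27 * 1000 ^ 22"
    by simp_all
  from this[THEN powr_rational_ge[where a = a]] assms show ?thesis
    by (auto simp: divisor_powr_def)
qed

lemma root_pow_ge:
  assumes "2 \<le> j" "j \<le> 5"
  shows "cube_root_3 ^ j \<le> real (root_pow j) / 1000"
proof -
  have "j = 2 \<or> j = 3 \<or> j = 4 \<or> j = 5" using assms by auto
  moreover have "(cube_root_3 ^ j) ^ 3 = 3 ^ j" for j
    by (metis cube_root_3_pow(1) mult.commute power_mult)
  ultimately have "(cube_root_3 ^ j) ^ 3 \<le> (real (root_pow j) / 1000) ^ 3"
    by (auto simp: root_pow_def power_divide field_simps)
  then show ?thesis by (rule power_mono_iff[THEN iffD1, rotated -1]) (use cube_root_3_pow in auto)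
qed

lemma class_sum_le:
  fixes a :: real
  assumes "a \<ge> 27/22" "c < 24"
  shows "class_sum c N \<le> 20 * (weight 1 + weight 2) * real (potential ! c) * real N powr a"
  using \<open>c < 24\<close>
proof (induction N arbitrary: c rule: less_induct)
  case (less N)
  define K where "K = weight 1 + weight 2"
  define v where "v c = real (potential ! c)" for c
  have K: "K \<ge> 0" by (simp add: K_def weight_nonneg)
  show ?case
  proof (cases "N = 0")
    case True
    then show ?thesis by (simp add: class_sum_def)
  next
    case False
    define q where "q = divisor ! c"
    define D where "D = {d. d < 24 \<and> (q * d + c mod q) mod 24 = c}"
    have q: "q = 2 \<or> q = 3" and vc: "v c \<ge> 55"
      using divisor_values less.prems by (auto simp: q_def v_def list_all_iff)
    have j: "2 \<le> q + c mod q" "q + c mod q \<le> 5" using q by (auto simp: less_Suc_eq_le)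
    have "1000 * root_pow (q + c mod q) * sum_list (map (\<lambda>d. potential ! d)
        (filter (\<lambda>d. (q * d + c mod q) mod 24 = c) [0..<24])) \<le> 999 * q * divisor_powr q * potential ! c"
      using potential_subsolution less.prems unfolding q_def Let_def list_all_iff by auto
    also have "sum_list (map (\<lambda>d. potential ! d)
        (filter (\<lambda>d. (q * d + c mod q) mod 24 = c) [0..<24])) = (\<Sum>d\<in>D. potential ! d)"
      by (subst sum_list_distinct_conv_sum_set) (auto simp: D_def intro!: sum.cong)
    finally have "real (1000 * root_pow (q + c mod q) * (\<Sum>d\<in>D. potential ! d))
      \<le> real (999 * q * divisor_powr q * potential ! c)" by (rule of_nat_mono)
    then have cert: "1000 * real (root_pow (q + c mod q)) * (\<Sum>d\<in>D. v d)
      \<le> 999 * real q * real (divisor_powr q) * v c" by (simp add: v_def)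
    have vD: "(\<Sum>d\<in>D. v d) \<ge> 0" by (intro sum_nonneg) (simp add: v_def)
    have "{1..<q} \<subseteq> {1, 2}" using q by auto
    then have k1: "(\<Sum>n\<in>{1..<q}. weight n) \<le> K"
      using sum_mono2[of "{1,2}" "{1..<q}" weight] weight_nonneg by (simp add: K_def)
    have "(\<Sum>d\<in>D. class_sum d (N div q)) \<le> (\<Sum>d\<in>D. 20 * K * v d * real (N div q) powr a)"
      unfolding K_def v_def using q False by (intro sum_mono less.IH) (auto simp: D_def)
    also have "\<dots> = 20 * K * (\<Sum>d\<in>D. v d) * real (N div q) powr a"
      by (simp add: sum_distrib_left sum_distrib_right)
    also have "\<dots> \<le> 20 * K * (\<Sum>d\<in>D. v d) * (real N / real q) powr a"
      using K vD assms by (intro mult_left_mono powr_mono2 of_nat_div_le_of_nat) auto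
    also have "(real N / real q) powr a = real N powr a / real q powr a"
      by (simp add: powr_divide)
    finally have "cube_root_3 ^ (q + c mod q) / real q * (\<Sum>d\<in>D. class_sum d (N div q))
      \<le> (real (root_pow (q + c mod q)) / 1000) / real q *
        (20 * K * (\<Sum>d\<in>D. v d) * (real N powr a / real q powr a))"
      using root_pow_ge[OF j] cube_root_3_pow K vD
      by (intro mult_mono divide_right_mono sum_nonneg class_sum_nonneg mult_nonneg_nonneg) auto
    also have "\<dots> \<le> (real (root_pow (q + c mod q)) / 1000) / real q *
        (20 * K * (\<Sum>d\<in>D. v d) * (real N powr a / (real (divisor_powr q) / 1000)))"
      using K vD q divisor_powr_le[OF q assms(1)]
      by (intro mult_left_mono divide_left_mono mult_nonneg_nonneg mult_pos_pos)
         (auto simp: divisor_powr_def)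
    also have "\<dots> = 20 * K * real N powr a *
        (1000 * real (root_pow (q + c mod q)) * (\<Sum>d\<in>D. v d)) / (1000 * real q * real (divisor_powr q))"
      using q by (auto simp: field_simps)
    also have "\<dots> \<le> 20 * K * real N powr a *
        (999 * real q * real (divisor_powr q) * v c) / (1000 * real q * real (divisor_powr q))"
      using K cert by (intro divide_right_mono mult_left_mono) auto
    also have "\<dots> = 20 * K * real N powr a * (999 / 1000 * v c)"
      using q by (auto simp: divisor_powr_def)
    finally have main: "cube_root_3 ^ (q + c mod q) / real q * (\<Sum>d\<in>D. class_sum d (N div q))
      \<le> 20 * K * real N powr a * (999 / 1000 * v c)" .
    have "K * 1 \<le> K * (1 / 50 * (v c * real N powr a))"
    proof (intro mult_left_mono K)
      have "1 \<le> real N powr a" using False assms by (intro ge_one_powr_ge_zero) auto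
      then have "55 * 1 \<le> v c * real N powr a" using vc by (intro mult_mono) auto
      then show "1 \<le> 1 / 50 * (v c * real N powr a)" by simp
    qed
    moreover have "q dvd 24" "q \<ge> 1" using q by auto
    ultimately show ?thesis
      using class_sum_step[of q c N] k1 main unfolding D_def[symmetric] K_def[symmetric] v_def[symmetric]
      by (simp add: algebra_simps)
  qed
qed

lemma weight_sum_le:
  fixes a :: real
  assumes "a \<ge> 27/22"
  obtains C where "C \<ge> 0" "\<And>N. (\<Sum>n\<in>{1..N}. weight n) \<le> C * real N powr a"
proof
  define C where "C = (\<Sum>c<24. 20 * (weight 1 + weight 2) * real (potential ! c))"
  show "C \<ge> 0" unfolding C_def by (intro sum_nonneg mult_nonneg_nonneg) (auto simp: weight_nonneg)
  show "(\<Sum>n\<in>{1..N}. weight n) \<le> C * real N powr a" for N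
  proof -
    have "{1..N} = (\<Union>c<24. {n. n \<in> {1..N} \<and> n mod 24 = c})" by auto
    also have "sum weight \<dots> = (\<Sum>c<24. class_sum c N)"
      unfolding class_sum_def by (intro sum.UNION_disjoint) auto
    also have "\<dots> \<le> (\<Sum>c<24. 20 * (weight 1 + weight 2) * real (potential ! c) * real N powr a)"
      using assms by (intro sum_mono class_sum_le) auto
    finally show ?thesis by (simp add: C_def sum_distrib_right)
  qed
qed

lemma kMax_le_weight:
  assumes "n \<ge> 2"
  shows "real (kMax n) \<le> 2 * weight (n - 1)"
proof -
  have "(real (kMax n) * real n) ^ 3 \<le> (2 * cube_root_3 ^ complexity (n - 1)) ^ 3"
  proof -
    have "real (kMax n ^ 3 * n ^ 3) \<le> real (8 * 3 ^ complexity (n - 1))"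
      using kMax_cube_le[OF assms] by (rule of_nat_mono)
    also have "\<dots> = (2 * cube_root_3 ^ complexity (n - 1)) ^ 3"
      by (simp add: power_mult_distrib power_commutes flip: power_mult)
         (metis cube_root_3_pow(1) mult.commute power_mult)
    finally show ?thesis by (simp add: power_mult_distrib)
  qed
  then have "real (kMax n) * real n \<le> 2 * cube_root_3 ^ complexity (n - 1)"
    by (rule power_mono_iff[THEN iffD1, rotated -1]) (use cube_root_3_pow in auto)
  then have "real (kMax n) \<le> 2 * cube_root_3 ^ complexity (n - 1) / real n"
    using assms by (simp add: field_simps)
  also have "\<dots> \<le> 2 * cube_root_3 ^ complexity (n - 1) / real (n - 1)"
    using assms cube_root_3_pow by (intro divide_left_mono) auto
  finally show ?thesis by (simp add: weight_def)
qed

lemma kMax_sum_le: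
  fixes a :: real
  assumes "a \<ge> 27/22"
  obtains C where "C \<ge> 0" "\<And>N. real (\<Sum>n\<in>{2..N}. kMax n) \<le> C * real N powr a"
proof -
  obtain C where C: "C \<ge> 0" "\<And>N. (\<Sum>n\<in>{1..N}. weight n) \<le> C * real N powr a"
    using weight_sum_le[OF assms] by blast
  show thesis
  proof
    show "2 * C \<ge> 0" using C by simp
    fix N
    have "real (\<Sum>n\<in>{2..N}. kMax n) \<le> (\<Sum>n\<in>{2..N}. 2 * weight (n - 1))"
      unfolding of_nat_sum by (intro sum_mono kMax_le_weight) auto
    also have "\<dots> = 2 * (\<Sum>n\<in>(\<lambda>n. n - 1) ` {2..N}. weight n)"
      by (subst sum.reindex) (auto simp: sum_distrib_left inj_on_def)
    also have "\<dots> \<le> 2 * (\<Sum>n\<in>{1..N}. weight n)"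
      by (intro mult_left_mono sum_mono2) (auto simp: weight_nonneg)
    also have "\<dots> \<le> 2 * (C * real N powr a)" using C(2) by simp
    finally show "real (\<Sum>n\<in>{2..N}. kMax n) \<le> 2 * C * real N powr a" by simp
  qed
qed

lemma kMax_le_powr:
  assumes "n \<ge> 2"
  shows "real (kMax n) \<le> 2 * real n powr (ln 3 / ln 2 - 1)"
proof -
  define T where "T = complexity (n - 1)"
  define L where "L = ln 3 / (ln 2 :: real)"
  have "2 ^ T \<le> n ^ 3"
  proof (cases "n = 2")
    case False
    then have "2 ^ T \<le> (n - 1) ^ 3" unfolding T_def using assms by (intro two_pow_complexity) auto
    also have "\<dots> \<le> n ^ 3" by (intro power_mono) auto
    finally show ?thesis .
  qed (simp add: T_def complexity_1)
  then have "real (2 ^ T) \<le> real (n ^ 3)" by (rule of_nat_mono)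
  then have T: "(2::real) ^ T \<le> real n ^ 3" by simp
  have pow_swap: "(x powr L) ^ k = (x ^ k) powr L" if "x > 0" for x :: real and k
  proof -
    have "(x powr L) ^ k = (x powr L) powr real k" using that by (subst powr_realpow) auto
    also have "\<dots> = (x powr real k) powr L" by (simp add: powr_powr mult.commute)
    also have "x powr real k = x ^ k" using that by (rule powr_realpow)
    finally show ?thesis .
  qed
  have "(3::real) ^ T = (2 powr L) ^ T" by (simp add: L_def powr_def)
  also have "\<dots> = (2 ^ T) powr L" by (rule pow_swap) simp
  also have "\<dots> \<le> (real n ^ 3) powr L" using T by (intro powr_mono2) (auto simp: L_def)
  also have "\<dots> = (real n powr L) ^ 3" using assms by (intro pow_swap[symmetric]) simp
  finally have 3: "(3::real) ^ T \<le> (real n powr L) ^ 3" .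
  have "real (kMax n ^ 3 * n ^ 3) \<le> real (8 * 3 ^ T)"
    unfolding T_def using kMax_cube_le[OF assms] by (rule of_nat_mono)
  then have "(real (kMax n) * real n) ^ 3 \<le> (2 * real n powr L) ^ 3"
    using 3 by (simp add: power_mult_distrib)
  then have "real (kMax n) * real n \<le> 2 * real n powr L"
    by (rule power_mono_iff[THEN iffD1, rotated -1]) auto
  then have "real (kMax n) \<le> 2 * (real n powr L / real n)" using assms by (simp add: field_simps)
  also have "real n powr L / real n = real n powr (L - 1)" using assms by (simp add: powr_diff)
  finally show ?thesis by (simp add: L_def)
qed


subsection \<open>Frame conditions of executions\<close>

fun assigned_vars :: "com \<Rightarrow> string set" where
  "assigned_vars (x ::= e) = {x}"
| "assigned_vars (c ;; d) = assigned_vars c \<union> assigned_vars d"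
| "assigned_vars (IF e THEN c ELSE d) = assigned_vars c \<union> assigned_vars d"
| "assigned_vars (WHILE e DO c) = assigned_vars c"
| "assigned_vars _ = {}"

fun assigned_arrs :: "com \<Rightarrow> string set" where
  "assigned_arrs (Alloc A n e) = {A}"
| "assigned_arrs (Write A i e) = {A}"
| "assigned_arrs (c ;; d) = assigned_arrs c \<union> assigned_arrs d"
| "assigned_arrs (IF e THEN c ELSE d) = assigned_arrs c \<union> assigned_arrs d"
| "assigned_arrs (WHILE e DO c) = assigned_arrs c"
| "assigned_arrs _ = {}"

fun silent :: "com \<Rightarrow> bool" where
  "silent (Emit e) = False"
| "silent (c ;; d) = (silent c \<and> silent d)"
| "silent (IF e THEN c ELSE d) = (silent c \<and> silent d)"
| "silent (WHILE e DO c) = silent c"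
| "silent _ = True"

definition frame :: "com \<Rightarrow> state \<Rightarrow> state \<Rightarrow> bool" where
  "frame c s s' \<longleftrightarrow> (\<forall>x. x \<notin> assigned_vars c \<longrightarrow> vars s' x = vars s x) \<and>
     (\<forall>A. A \<notin> assigned_arrs c \<longrightarrow> arrs s' A = arrs s A) \<and> (silent c \<longrightarrow> emitted s' = emitted s)"

lemma exec_frame: "exec sz c s t m s' \<Longrightarrow> frame c s s'"
  by (induction rule: exec.induct) (auto simp: frame_def)

lemma frame_var: "frame c s s' \<Longrightarrow> x \<notin> assigned_vars c \<Longrightarrow> vars s' x = vars s x"
  by (simp add: frame_def)

lemma frame_arr: "frame c s s' \<Longrightarrow> A \<notin> assigned_arrs c \<Longrightarrow> arrs s' A = arrs s A"
  by (simp add: frame_def)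

lemma frame_emitted: "frame c s s' \<Longrightarrow> silent c \<Longrightarrow> emitted s' = emitted s"
  by (simp add: frame_def)

lemma For_frame [simp]:
  "assigned_vars (FOR x FROM lo TO hi DO c) = insert x (assigned_vars c)"
  "assigned_arrs (FOR x FROM lo TO hi DO c) = assigned_arrs c"
  "silent (FOR x FROM lo TO hi DO c) = silent c"
  by (auto simp: For_def)

subsection \<open>Widths of intermediate results\<close>

lemma bits_mono: "\<bar>x\<bar> \<le> \<bar>y\<bar> \<Longrightarrow> bits x \<le> bits y"
  by (simp add: bits_def floorlog_mono nat_mono)

lemma bits_less_power: "nat \<bar>x\<bar> < 2 ^ (bits x - 1)"
  by (metis One_nat_def add_diff_cancel_left' bits_def floorlog_bounds
      floorlog_eq_zero_iff le_eq_less_or_eq lessI numeral_2_eq_2 power_0 zero_less_iff_neq_zero zero_less_power)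

lemma bits_leI: "nat \<bar>x\<bar> < 2 ^ k \<Longrightarrow> bits x \<le> Suc k"
  by (simp add: bits_def floorlog_leI)

lemma bits_pos: "bits x \<ge> 1"
  by (simp add: bits_def)

lemma bits_add: "bits (x + y) \<le> bits x + bits y"
proof -
  obtain a b where ab: "bits x = Suc a" "bits y = Suc b"
    by (metis One_nat_def Suc_le_D bits_pos)
  have "nat \<bar>x\<bar> < 2 ^ a" "nat \<bar>y\<bar> < 2 ^ b" using bits_less_power[of x] bits_less_power[of y] ab by auto
  moreover have "nat \<bar>x + y\<bar> \<le> nat \<bar>x\<bar> + nat \<bar>y\<bar>" by linarith
  moreover have "(2::nat) ^ a \<le> 2 ^ (a + b)" "(2::nat) ^ b \<le> 2 ^ (a + b)"
    by (intro power_increasing; simp)+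
  ultimately have "nat \<bar>x + y\<bar> < 2 ^ (a + b) + 2 ^ (a + b)" by linarith
  then have "nat \<bar>x + y\<bar> < 2 ^ Suc (a + b)" by simp
  then show ?thesis using bits_leI[of "x + y" "Suc (a + b)"] ab by simp
qed

lemma bits_mult: "bits (x * y) \<le> bits x + bits y"
proof -
  obtain a b where ab: "bits x = Suc a" "bits y = Suc b"
    by (metis One_nat_def Suc_le_D bits_pos)
  have "nat \<bar>x\<bar> < 2 ^ a" "nat \<bar>y\<bar> < 2 ^ b" using bits_less_power[of x] bits_less_power[of y] ab by auto
  then have "nat \<bar>x\<bar> * nat \<bar>y\<bar> < 2 ^ a * 2 ^ b" by (intro mult_strict_mono) auto
  then have "nat \<bar>x * y\<bar> < 2 ^ (a + b)" by (simp add: abs_mult nat_mult_distrib power_add)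
  then show ?thesis using bits_leI[of "x * y" "a + b"] ab by simp
qed

lemma abs_div_le: "\<bar>x div y\<bar> \<le> \<bar>x\<bar>" for x y :: int
proof -
  have "\<bar>x div y\<bar> * \<bar>y\<bar> \<le> \<bar>x\<bar> + \<bar>y\<bar> - 1 \<or> y = 0"
  proof (cases "y = 0")
    case False
    have "x = x div y * y + x mod y" by simp
    moreover have "\<bar>x mod y\<bar> \<le> \<bar>y\<bar> - 1" using abs_mod_less[OF False, of x] by linarith
    ultimately have "\<bar>x div y * y\<bar> \<le> \<bar>x\<bar> + \<bar>y\<bar> - 1" by linarith
    then show ?thesis by (simp add: abs_mult)
  qed simp
  then show ?thesis
  proof
    assume *: "\<bar>x div y\<bar> * \<bar>y\<bar> \<le> \<bar>x\<bar> + \<bar>y\<bar> - 1"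
    show ?thesis
    proof (rule ccontr)
      assume "\<not> ?thesis"
      then have "\<bar>x div y\<bar> \<ge> \<bar>x\<bar> + 1" "y \<noteq> 0" by auto
      then have "(\<bar>x\<bar> + 1) * \<bar>y\<bar> \<le> \<bar>x div y\<bar> * \<bar>y\<bar>" by (intro mult_right_mono) auto
      moreover have "\<bar>x\<bar> * \<bar>y\<bar> \<ge> \<bar>x\<bar> * 1" using \<open>y \<noteq> 0\<close> by (intro mult_left_mono) auto
      ultimately show False using * by (simp add: algebra_simps)
    qed
  qed simp
qed

fun exp_weight :: "exp \<Rightarrow> nat" where
  "exp_weight (Const i) = bits i"
| "exp_weight (Var x) = 1"
| "exp_weight (Bin f a b) = exp_weight a + exp_weight b + 1"
| "exp_weight (Read A i) = exp_weight i + 1"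

lemma bits_apply_op:
  assumes "apply_op f x y = Some v"
  shows "bits v \<le> bits x + bits y"
proof -
  have b: "bits (of_bool b) \<le> bits x + bits y" for b
    using bits_pos[of x] bits_pos[of y] bits_leI[of "of_bool b" 1] by (cases b) auto
  show ?thesis
  proof (cases f)
    case Sub
    then show ?thesis using assms bits_add[of x "-y"] by (simp add: bits_def)
  next
    case Div
    then have "v = x div y" using assms by (auto split: if_splits)
    then show ?thesis using bits_mono[of v x] abs_div_le by (simp add: trans_le_add1)
  qed (use assms bits_add bits_mult b in auto)
qed

subsection \<open>Bounded executions\<close>

text \<open>
  In \<open>executes c s t Q\<close> the bounds \<open>V\<close> on all variables, and \<open>len A\<close> and \<open>ent A\<close> on the length and the
  entries of the array \<open>A\<close>, hold at every moment, so the storage never exceeds \<open>budget\<close>.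
  Intermediate results need no bound of their own, since their widths are at most
  proportional to the size of the expression.
\<close>

locale bounded_machine =
  fixes p :: com and V :: int and len :: "string \<Rightarrow> nat" and ent :: "string \<Rightarrow> int"
  assumes V_ge: "V \<ge> 10" and ent_nonneg: "ent A \<ge> 0" and ent_le: "ent A \<le> V"
begin

definition ok :: "state \<Rightarrow> bool" where
  "ok s \<longleftrightarrow> (\<forall>x. \<bar>vars s x\<bar> \<le> V) \<and>
     (\<forall>A. length (arrs s A) \<le> len A \<and> (\<forall>v\<in>set (arrs s A). \<bar>v\<bar> \<le> ent A))"

definition budget :: nat where
  "budget = card (com_vars p) * bits V + (\<Sum>A\<in>com_arrs p. len A * bits (ent A)) + 20000 * bits V"

definition executes :: "com \<Rightarrow> state \<Rightarrow> nat \<Rightarrow> (state \<Rightarrow> bool) \<Rightarrow> bool" where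
  "executes c s t Q \<longleftrightarrow> (\<exists>t' m s'. exec (state_bits p) c s t' m s' \<and> t' \<le> t \<and> m \<le> budget \<and> ok s' \<and> Q s')"

lemma state_bits_le:
  assumes "ok s"
  shows "state_bits p s + 20000 * bits V \<le> budget"
proof -
  have "array_bits (arrs s A) \<le> len A * bits (ent A)" for A
    unfolding array_bits_def
  proof (intro mult_le_mono)
    show "Max (insert 0 (bits ` set (arrs s A))) \<le> bits (ent A)"
      using assms by (auto intro!: bits_mono simp: ok_def)
        (use ent_nonneg in fastforce)
  qed (use assms in \<open>auto simp: ok_def\<close>)
  moreover have "(\<Sum>x\<in>com_vars p. bits (vars s x)) \<le> (\<Sum>x\<in>com_vars p. bits V)"
    using assms V_ge by (intro sum_mono bits_mono) (fastforce simp: ok_def)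
  ultimately show ?thesis
    unfolding state_bits_def budget_def by (simp add: add_mono sum_mono)
qed

lemma W_ge: "bits V \<ge> 2"
  using V_ge bits_mono[of 2 V] by (simp add: bits_def floorlog_def)

lemma exp_val_bits:
  assumes "ok s" "exp_val e s = Some v"
  shows "bits v \<le> exp_weight e * bits V"
  using assms(2)
proof (induction e arbitrary: v)
  case (Const i)
  then show ?case using W_ge by simp
next
  case (Var x)
  then show ?case using assms(1) V_ge by (auto intro!: bits_mono simp: ok_def)
next
  case (Bin f a b)
  then obtain x y where "exp_val a s = Some x" "exp_val b s = Some y" "apply_op f x y = Some v"
    by (auto split: option.splits)
  then show ?case using Bin.IH bits_apply_op[of f x y v] by (fastforce simp: algebra_simps)
next
  case (Read A i)
  then obtain k where "0 \<le> k" "k < int (length (arrs s A))" "v = arrs s A ! nat k"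
    by (auto split: option.splits if_splits)
  then have "v \<in> set (arrs s A)" by (simp add: nat_less_iff)
  then have "\<bar>v\<bar> \<le> ent A" using assms(1) by (simp add: ok_def)
  then have "\<bar>v\<bar> \<le> V" using ent_le[of A] by linarith
  then have "bits v \<le> bits V" by (intro bits_mono) simp
  then show ?case by simp
qed

lemma exp_bits_le:
  assumes "ok s"
  shows "exp_bits e s \<le> exp_weight e ^ 2 * bits V"
proof (induction e)
  case (Const i)
  have "bits i * 1 \<le> bits i ^ 2 * bits V"
    using W_ge bits_pos[of i] by (intro mult_mono) (auto simp: power2_eq_square)
  then show ?case by simp
next
  case (Var x)
  then show ?case using assms V_ge by (auto intro!: bits_mono simp: ok_def)
next
  case (Bin f a b)
  have "(case exp_val (Bin f a b) s of Some v \<Rightarrow> bits v | None \<Rightarrow> 0) \<le> exp_weight (Bin f a b) * bits V"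
    using exp_val_bits[OF assms, of "Bin f a b"] by (auto split: option.split)
  then have "exp_bits (Bin f a b) s \<le>
      (exp_weight a ^ 2 + exp_weight b ^ 2 + exp_weight (Bin f a b)) * bits V"
    using Bin by (simp add: algebra_simps del: exp_val.simps)
  also have "\<dots> \<le> exp_weight (Bin f a b) ^ 2 * bits V"
    by (intro mult_right_mono) (auto simp: power2_eq_square algebra_simps)
  finally show ?case .
next
  case (Read A i)
  have "(case exp_val (Read A i) s of Some v \<Rightarrow> bits v | None \<Rightarrow> 0) \<le> exp_weight (Read A i) * bits V"
    using exp_val_bits[OF assms, of "Read A i"] by (auto split: option.split)
  then have "exp_bits (Read A i) s \<le> (exp_weight i ^ 2 + exp_weight (Read A i)) * bits V"
    using Read by (simp add: algebra_simps del: exp_val.simps)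
  also have "\<dots> \<le> exp_weight (Read A i) ^ 2 * bits V"
    by (intro mult_right_mono) (auto simp: power2_eq_square algebra_simps)
  finally show ?case .
qed

lemma exp_bits_100:
  assumes "ok s" "exp_weight e \<le> 100"
  shows "exp_bits e s \<le> 10000 * bits V"
proof -
  have "exp_bits e s \<le> exp_weight e ^ 2 * bits V" by (rule exp_bits_le[OF assms(1)])
  also have "\<dots> \<le> 100 ^ 2 * bits V"
    using assms by (intro mult_right_mono power_mono) auto
  finally show ?thesis by simp
qed

lemma storage_le: "ok s \<Longrightarrow> exp_weight e \<le> 100 \<Longrightarrow> state_bits p s + exp_bits e s \<le> budget"
  using state_bits_le[of s] exp_bits_100[of s e] by simp

lemma storage_le2: "ok s \<Longrightarrow> exp_weight e \<le> 100 \<Longrightarrow> exp_weight f \<le> 100 \<Longrightarrow>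
    state_bits p s + exp_bits e s + exp_bits f s \<le> budget"
  using state_bits_le[of s] exp_bits_100[of s e] exp_bits_100[of s f] by simp

lemma storage_le0: "ok s \<Longrightarrow> state_bits p s \<le> budget"
  using state_bits_le[of s] by simp

lemma ok_var: "ok s \<Longrightarrow> \<bar>v\<bar> \<le> V \<Longrightarrow> ok (s\<lparr>vars := (vars s)(x := v)\<rparr>)"
  by (simp add: ok_def)

lemma ok_alloc: "ok s \<Longrightarrow> n \<le> len A \<Longrightarrow> \<bar>v\<bar> \<le> ent A \<Longrightarrow>
    ok (s\<lparr>arrs := (arrs s)(A := replicate n v)\<rparr>)"
  by (auto simp: ok_def)

lemma ok_write: "ok s \<Longrightarrow> \<bar>v\<bar> \<le> ent A \<Longrightarrow> ok (s\<lparr>arrs := (arrs s)(A := (arrs s A)[k := v])\<rparr>)"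
  using set_update_subset_insert[of "arrs s A" k v] by (auto simp: ok_def)

lemma ok_entry: "ok s \<Longrightarrow> k < length (arrs s A) \<Longrightarrow> \<bar>arrs s A ! k\<bar> \<le> ent A"
  by (auto simp: ok_def)

lemma executes_conseq:
  assumes "executes c s t Q" "t \<le> t'" "\<And>s'. ok s' \<Longrightarrow> frame c s s' \<Longrightarrow> Q s' \<Longrightarrow> Q' s'"
  shows "executes c s t' Q'"
  using assms exec_frame unfolding executes_def by (meson le_trans)

lemma executes_le: "executes c s t Q \<Longrightarrow> t \<le> t' \<Longrightarrow> executes c s t' Q"
  by (rule executes_conseq)

lemma executes_Skip: "ok s \<Longrightarrow> Q s \<Longrightarrow> executes Skip s 1 Q"
  unfolding executes_def using exec.Skip[of "state_bits p" s] storage_le0[of s] by blast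

lemma executes_Assign:
  assumes "ok s" "exp_val e s = Some v" "exp_weight e \<le> 100" "\<bar>v\<bar> \<le> V"
    "ok (s\<lparr>vars := (vars s)(x := v)\<rparr>) \<Longrightarrow> Q (s\<lparr>vars := (vars s)(x := v)\<rparr>)"
  shows "executes (x ::= e) s (exp_time e + 1) Q"
proof -
  have "ok (s\<lparr>vars := (vars s)(x := v)\<rparr>)" using assms by (intro ok_var)
  then show ?thesis unfolding executes_def
    using exec.Assign[OF assms(2) refl, of "state_bits p" x] assms storage_le storage_le0
    by (meson le_refl max.boundedI)
qed

lemma executes_Alloc:
  assumes "ok s" "exp_val n s = Some k" "0 \<le> k" "exp_val e s = Some v" "exp_weight n \<le> 100"
    "exp_weight e \<le> 100" "nat k \<le> len A" "\<bar>v\<bar> \<le> ent A"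
    "ok (s\<lparr>arrs := (arrs s)(A := replicate (nat k) v)\<rparr>) \<Longrightarrow> Q (s\<lparr>arrs := (arrs s)(A := replicate (nat k) v)\<rparr>)"
  shows "executes (Alloc A n e) s (exp_time n + exp_time e + nat k + 1) Q"
proof -
  have "ok (s\<lparr>arrs := (arrs s)(A := replicate (nat k) v)\<rparr>)" using assms by (intro ok_alloc)
  then show ?thesis unfolding executes_def
    using exec.Alloc[OF assms(2,3,4) refl, of "state_bits p" A] assms storage_le2 storage_le0
    by (meson le_refl max.boundedI)
qed

lemma executes_Write:
  assumes "ok s" "exp_val i s = Some k" "0 \<le> k" "k < int (length (arrs s A))" "exp_val e s = Some v"
    "exp_weight i \<le> 100" "exp_weight e \<le> 100" "\<bar>v\<bar> \<le> ent A"
    "ok (s\<lparr>arrs := (arrs s)(A := (arrs s A)[nat k := v])\<rparr>) \<Longrightarrow>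
      Q (s\<lparr>arrs := (arrs s)(A := (arrs s A)[nat k := v])\<rparr>)"
  shows "executes (Write A i e) s (exp_time i + exp_time e + 1) Q"
proof -
  have "ok (s\<lparr>arrs := (arrs s)(A := (arrs s A)[nat k := v])\<rparr>)" using assms by (intro ok_write)
  then show ?thesis unfolding executes_def
    using exec.Write[OF assms(2,3,4,5) refl, of "state_bits p"] assms storage_le2 storage_le0
    by (meson le_refl max.boundedI)
qed

lemma executes_Emit:
  assumes "ok s" "exp_val e s = Some v" "exp_weight e \<le> 100"
    "ok (s\<lparr>emitted := emitted s @ [v]\<rparr>) \<Longrightarrow> Q (s\<lparr>emitted := emitted s @ [v]\<rparr>)"
  shows "executes (Emit e) s (exp_time e + 1) Q"
proof -
  have "ok (s\<lparr>emitted := emitted s @ [v]\<rparr>)" using assms by (simp add: ok_def)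
  then show ?thesis unfolding executes_def
    using exec.Emit[OF assms(2), of "state_bits p"] assms storage_le
    by (meson le_refl max.boundedI)
qed

lemma executes_Seq:
  assumes "executes c s t1 (\<lambda>s1. executes d s1 t2 Q)"
  shows "executes (c ;; d) s (t1 + t2) Q"
proof -
  obtain t1' m1 s1 t2' m2 s2 where
    "exec (state_bits p) c s t1' m1 s1" "t1' \<le> t1" "m1 \<le> budget"
    "exec (state_bits p) d s1 t2' m2 s2" "t2' \<le> t2" "m2 \<le> budget" "ok s2" "Q s2"
    using assms unfolding executes_def by blast
  then show ?thesis unfolding executes_def
    using exec.Seq[of "state_bits p" c s t1' m1 s1 d t2' m2 s2] by (meson add_mono max.boundedI)
qed

lemma executes_Seq':
  assumes "executes c s t1 R" "\<And>s1. ok s1 \<Longrightarrow> frame c s s1 \<Longrightarrow> R s1 \<Longrightarrow> executes d s1 t2 Q"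
  shows "executes (c ;; d) s (t1 + t2) Q"
  by (rule executes_Seq, rule executes_conseq[OF assms(1) le_refl assms(2)])

lemma executes_If:
  assumes "ok s" "exp_val e s = Some v" "exp_weight e \<le> 100"
    "v \<noteq> 0 \<Longrightarrow> executes c s t1 Q" "v = 0 \<Longrightarrow> executes d s t2 Q"
  shows "executes (IF e THEN c ELSE d) s (exp_time e + 1 + max t1 t2) Q"
proof (cases "v = 0")
  case True
  then obtain t' m s' where "exec (state_bits p) d s t' m s'" "t' \<le> t2" "m \<le> budget" "ok s'" "Q s'"
    using assms unfolding executes_def by blast
  then show ?thesis unfolding executes_def
    using exec.IfFalse[of e s "state_bits p" d t' m s' c] assms(2) True storage_le[OF assms(1,3)]
    by (metis add_le_cancel_left le_max_iff_disj max.boundedI)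
next
  case False
  then obtain t' m s' where "exec (state_bits p) c s t' m s'" "t' \<le> t1" "m \<le> budget" "ok s'" "Q s'"
    using assms unfolding executes_def by blast
  then show ?thesis unfolding executes_def
    using exec.IfTrue[of e s v "state_bits p" c t' m s' d] assms(2) False storage_le[OF assms(1,3)]
    by (metis add_le_cancel_left le_max_iff_disj max.boundedI)
qed

lemma executes_While:
  assumes "ok s" "I 0 s" "exp_weight e \<le> 100"
    and test: "\<And>i s. i \<le> n \<Longrightarrow> ok s \<Longrightarrow> I i s \<Longrightarrow> exp_val e s = Some (of_bool (i < n))"
    and body: "\<And>i s. i < n \<Longrightarrow> ok s \<Longrightarrow> I i s \<Longrightarrow> executes c s (\<tau> i) (I (Suc i))"
  shows "executes (WHILE e DO c) s ((\<Sum>i<n. \<tau> i + exp_time e + 1) + exp_time e + 1) (I n)"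
proof -
  have "ok s \<Longrightarrow> I k s \<Longrightarrow> k \<le> n \<Longrightarrow>
    executes (WHILE e DO c) s ((\<Sum>i\<in>{k..<n}. \<tau> i + exp_time e + 1) + exp_time e + 1) (I n)" for k s
  proof (induction "n - k" arbitrary: k s)
    case 0
    then have "k = n" by simp
    then have "exp_val e s = Some 0" using test[of n s] 0 by simp
    then show ?case unfolding executes_def
      using exec.WhileFalse[of e s "state_bits p" c] storage_le[of s e] 0 assms(3) \<open>k = n\<close>
      by fastforce
  next
    case (Suc d)
    then have k: "k < n" "d = n - Suc k" by auto
    then have v: "exp_val e s = Some 1" using test[of k s] Suc by simp
    obtain t1 m1 s1 where 1: "exec (state_bits p) c s t1 m1 s1" "t1 \<le> \<tau> k" "m1 \<le> budget" "ok s1" "I (Suc k) s1"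
      using body[OF k(1) Suc.prems(1,2)] unfolding executes_def by blast
    obtain t2 m2 s2 where 2: "exec (state_bits p) (WHILE e DO c) s1 t2 m2 s2"
      "t2 \<le> (\<Sum>i\<in>{Suc k..<n}. \<tau> i + exp_time e + 1) + exp_time e + 1" "m2 \<le> budget" "ok s2" "I n s2"
      using Suc.hyps(1)[OF k(2) 1(4,5)] k unfolding executes_def by auto
    have "exec (state_bits p) (WHILE e DO c) s (exp_time e + 1 + t1 + t2)
      (max (state_bits p s + exp_bits e s) (max m1 m2)) s2"
      using exec.WhileTrue[OF v _ 1(1) 2(1)] by simp
    moreover have "exp_time e + 1 + t1 + t2 \<le> (\<Sum>i\<in>{k..<n}. \<tau> i + exp_time e + 1) + exp_time e + 1"
      using 1 2 k by (simp add: sum.atLeast_Suc_lessThan)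
    moreover have "max (state_bits p s + exp_bits e s) (max m1 m2) \<le> budget"
      using 1 2 storage_le Suc.prems assms(3) by simp
    ultimately show ?case unfolding executes_def using 2 by blast
  qed
  from this[OF assms(1,2)] show ?thesis by (simp add: atLeast0LessThan)
qed

lemma executes_For:
  assumes "ok s" "exp_val lo s = Some a" "\<bar>a\<bar> \<le> V" "\<bar>h\<bar> < V" "exp_weight lo \<le> 100" "exp_weight hi \<le> 90"
    and n: "n = nat (h + 1 - a)" "x \<notin> assigned_vars c"
    and init: "I 0 (s\<lparr>vars := (vars s)(x := a)\<rparr>)"
    and hi: "\<And>i s. I i s \<Longrightarrow> exp_val hi s = Some h"
    and indep: "\<And>i s v. I i s \<Longrightarrow> I i (s\<lparr>vars := (vars s)(x := v)\<rparr>)"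
    and body: "\<And>i s. i < n \<Longrightarrow> ok s \<Longrightarrow> I i s \<Longrightarrow> vars s x = a + int i \<Longrightarrow> executes c s (\<tau> i) (I (Suc i))"
  shows "executes (FOR x FROM lo TO hi DO c) s
    (exp_time lo + (\<Sum>i<n. \<tau> i + exp_time hi + 4) + exp_time hi + 3) (I n)"
proof (cases "a \<le> h + 1")
  case False
  have n0: "n = 0" using False n by simp
  have *: "executes (WHILE Var x \<^bold>\<le> hi DO (c;; x ::= Var x \<^bold>+ Const 1)) s1
      ((\<Sum>i<0::nat. 0 + exp_time (Var x \<^bold>\<le> hi) + 1) + exp_time (Var x \<^bold>\<le> hi) + 1) (\<lambda>s. I 0 s \<and> vars s x = a)"
    if "ok s1" "s1 = s\<lparr>vars := (vars s)(x := a)\<rparr>" for s1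
    by (rule executes_While[where I = "\<lambda>_ s. I 0 s \<and> vars s x = a" and n = 0 and \<tau> = "\<lambda>_. 0"])
       (use that assms False hi[of 0] in auto)
  show ?thesis
    unfolding For_def n0
    apply (rule executes_le)
     apply (rule executes_Seq)
     apply (rule executes_Assign[OF assms(1,2,5,3)])
     apply (rule executes_conseq[OF *])
        apply auto
    done
next
  case True
  have test: "exp_val (Var x \<^bold>\<le> hi) s = Some (of_bool (i < n))"
    if "i \<le> n" "I i s" "vars s x = a + int i" for i s
    using hi[OF that(2)] that n True by auto
  have *: "executes (WHILE Var x \<^bold>\<le> hi DO (c;; x ::= Var x \<^bold>+ Const 1)) s1
      ((\<Sum>i<n. (\<tau> i + 2) + exp_time (Var x \<^bold>\<le> hi) + 1) + exp_time (Var x \<^bold>\<le> hi) + 1)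
      (\<lambda>s. I n s \<and> vars s x = a + int n)"
    if "ok s1" "s1 = s\<lparr>vars := (vars s)(x := a)\<rparr>" for s1
  proof (rule executes_While[where I = "\<lambda>i s. I i s \<and> vars s x = a + int i"])
    show "exp_val (Var x \<^bold>\<le> hi) s = Some (of_bool (i < n))"
      if "i \<le> n" "ok s" "I i s \<and> vars s x = a + int i" for i s
      using that by (intro test) auto
    show "executes (c;; x ::= Var x \<^bold>+ Const 1) s (\<tau> i + 2) (\<lambda>s. I (Suc i) s \<and> vars s x = a + int (Suc i))"
      if i: "i < n" and s: "ok s" "I i s \<and> vars s x = a + int i" for i s
    proof -
      have "executes (c;; x ::= Var x \<^bold>+ Const 1) s (\<tau> i + (exp_time (Var x \<^bold>+ Const 1) + 1))
        (\<lambda>s. I (Suc i) s \<and> vars s x = a + int (Suc i))"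
      proof (rule executes_Seq'[OF body])
        fix s1 assume s1: "ok s1" "frame c s s1" "I (Suc i) s1"
        then have x: "vars s1 x = a + int i" using frame_var[of c s s1 x] n(2) s by simp
        show "executes (x ::= Var x \<^bold>+ Const 1) s1 (exp_time (Var x \<^bold>+ Const 1) + 1)
          (\<lambda>s. I (Suc i) s \<and> vars s x = a + int (Suc i))"
          by (rule executes_Assign) (use s1 x indep n(1) i assms(3,4) True in \<open>auto simp: bits_def floorlog_def\<close>)
      qed (use i s in auto)
      then show ?thesis by simp
    qed
  qed (use that init assms in auto)
  show ?thesis
    unfolding For_def
    apply (rule executes_le)
     apply (rule executes_Seq)
     apply (rule executes_Assign[OF assms(1,2,5,3)])
     apply (rule executes_conseq[OF *])
        apply (auto simp: add.assoc intro!: sum_mono)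
    done
qed

text \<open>The value stored is between 0 and the old entry, so it respects the bound on the entries.\<close>

lemma executes_lower_to:
  assumes "ok s" "exp_val i s = Some k" "0 \<le> k" "k < int (length (arrs s A))"
    "exp_val e s = Some v" "exp_weight i \<le> 49" "exp_weight e \<le> 49" "0 \<le> v"
    "\<And>s'. ok s' \<Longrightarrow> vars s' = vars s \<Longrightarrow> emitted s' = emitted s \<Longrightarrow>
       arrs s' = (arrs s)(A := (arrs s A)[nat k := min v (arrs s A ! nat k)]) \<Longrightarrow> Q s'"
  shows "executes (lower_to A i e) s (2 * exp_time i + 2 * exp_time e + 4) Q"
proof -
  let ?o = "arrs s A ! nat k"
  have o: "\<bar>?o\<bar> \<le> ent A" using assms by (intro ok_entry) auto
  have "executes (lower_to A i e) s
    (exp_time (e \<^bold>< Read A i) + 1 + max (exp_time i + exp_time e + 1) 1) Q"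
    unfolding lower_to_def
  proof (rule executes_If)
    show "exp_val (e \<^bold>< Read A i) s = Some (of_bool (v < ?o))" using assms by simp
    show "executes (Write A i e) s (exp_time i + exp_time e + 1) Q" if "of_bool (v < ?o) \<noteq> (0::int)"
      by (rule executes_Write) (use assms that o in \<open>auto simp: min_def split: if_splits\<close>)
    show "executes Skip s 1 Q" if "of_bool (v < ?o) = (0::int)"
    proof (rule executes_Skip)
      have "(arrs s)(A := (arrs s A)[nat k := min v ?o]) = arrs s"
        using that by (simp add: min_def)
      then show "Q s" using assms(1,9) by metis
    qed (use assms in simp)
  qed (use assms in auto)
  then show ?thesis by (rule executes_le) auto
qed

end


lemma bits_small [simp]:
  "bits 0 = 1" "bits 1 = 2" "bits 2 = 3" "bits 3 = 3" "bits 4 = 4" "bits 6 = 4"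
  by (simp_all add: bits_def compute_floorlog)

lemma (in bounded_machine) executes_Seq_assoc:
  assumes "executes (a;; (b;; c)) s t Q"
  shows "executes (a;; b;; c) s t Q"
proof -
  obtain t' m s' where e: "exec (state_bits p) (a;; (b;; c)) s t' m s'" "t' \<le> t" "m \<le> budget" "ok s'" "Q s'"
    using assms unfolding executes_def by blast
  from e(1) obtain t1 m1 s1 t2 m2 where 1: "exec (state_bits p) a s t1 m1 s1"
    "exec (state_bits p) (b;; c) s1 t2 m2 s'" "t' = t1 + t2" "m = max m1 m2"
    by (cases rule: exec.cases) auto
  from 1(2) obtain t3 m3 s3 t4 m4 where 2: "exec (state_bits p) b s1 t3 m3 s3"
    "exec (state_bits p) c s3 t4 m4 s'" "t2 = t3 + t4" "m2 = max m3 m4"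
    by (cases rule: exec.cases) auto
  show ?thesis unfolding executes_def
    using exec.Seq[OF exec.Seq[OF 1(1) 2(1)] 2(2)] e 1 2 by (metis add.assoc max.assoc)
qed

subsection \<open>Auxiliary computations\<close>

definition log_bound :: "nat \<Rightarrow> nat" where
  "log_bound m = (LEAST d. 1 \<le> d \<and> m ^ 3 < 2 ^ d)"

lemma log_bound: "1 \<le> log_bound m" "m ^ 3 < 2 ^ log_bound m"
proof -
  have "\<exists>d. 1 \<le> d \<and> m ^ 3 < (2::nat) ^ d"
    by (rule exI[of _ "Suc (m ^ 3)"]) (use less_exp[of "Suc (m ^ 3)"] in simp)
  from LeastI_ex[OF this] show "1 \<le> log_bound m" "m ^ 3 < 2 ^ log_bound m"
    unfolding log_bound_def by auto
qed

lemma log_bound_least: "1 \<le> i \<Longrightarrow> i < log_bound m \<Longrightarrow> 2 ^ i \<le> m ^ 3"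
  using not_less_Least[of i "\<lambda>d. 1 \<le> d \<and> m ^ 3 < (2::nat) ^ d"] by (auto simp: log_bound_def)

lemma log_bound_upper:
  assumes "m \<ge> 1"
  shows "2 ^ log_bound m \<le> 2 * m ^ 3"
proof (cases "log_bound m = 1")
  case False
  then obtain i where i: "log_bound m = Suc i" "1 \<le> i" using log_bound(1)[of m]
    by (metis One_nat_def Suc_le_D le_SucE not_less_eq_eq zero_le)
  then show ?thesis using log_bound_least[of i m] by simp
qed (use assms in simp)

lemma log_bound_le: "m \<ge> 1 \<Longrightarrow> log_bound m \<le> 2 * m ^ 3"
  using log_bound_upper[of m] less_exp[of "log_bound m"] by linarith

lemma complexity_le_log_bound:
  assumes "1 \<le> n" "n \<le> m"
  shows "complexity n \<le> log_bound m"
proof (cases "n = 1")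
  case True
  then show ?thesis using log_bound(1) complexity_1 by simp
next
  case False
  then have "2 ^ complexity n \<le> n ^ 3" using assms by (intro two_pow_complexity) auto
  also have "\<dots> \<le> m ^ 3" using assms by (intro power_mono) auto
  also have "\<dots> < 2 ^ log_bound m" by (rule log_bound(2))
  finally show ?thesis by simp
qed

lemma E_complexity_le:
  assumes "n \<ge> 1"
  shows "E (complexity n) \<le> n ^ 2"
proof (cases "n = 1")
  case True
  then show ?thesis by (simp add: complexity_1 E_small)
next
  case False
  have "E (complexity n) ^ 3 \<le> 3 ^ complexity n" by (rule E_cube)
  also have "\<dots> \<le> 4 ^ complexity n" by (intro power_mono) auto
  also have "\<dots> = (2 ^ complexity n) ^ 2" by (metis mult.commute num_double numeral_One numeral_times_numeral power2_eq_square power_mult power_mult_distrib)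
  also have "\<dots> \<le> (n ^ 3) ^ 2" using False assms by (intro power_mono two_pow_complexity) auto
  also have "\<dots> = (n ^ 2) ^ 3" by (simp flip: power_mult)
  finally show ?thesis by (rule power_mono_iff[THEN iffD1, rotated -1]) auto
qed

lemma E_closed: "E k = 3 ^ ((k - 2) div 3) * max 1 (k - 3 * ((k - 2) div 3))"
proof (induction k rule: E_induct)
  case (step j)
  then obtain i where "j = i + 2" by (metis add.commute le_Suc_ex)
  then show ?case using step E_step[of j] by simp
qed (auto simp: less_5_cases E_small)

definition kMax_time :: "nat \<Rightarrow> nat" where
  "kMax_time T = (T + 1) * (4 * T + 40)"

lemma kMax_time_mono: "T \<le> T' \<Longrightarrow> kMax_time T \<le> kMax_time T'"
  unfolding kMax_time_def by (intro mult_mono) auto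

context bounded_machine
begin

lemma compute_bound:
  assumes s: "ok s" "vars s y = int m" "m \<ge> 1" "x \<noteq> ''p''" "y \<noteq> ''p''" "y \<noteq> x"
    and V: "int (2 * m ^ 3) \<le> V"
  shows "executes (compute_bound x (Var y)) s (10 * log_bound m + 10) (\<lambda>s'. vars s' x = int (log_bound m))"
proof -
  let ?body = "x ::= Var x \<^bold>+ Const 1;; ''p'' ::= Const 2 \<^bold>* Var ''p''"
  let ?test = "Var ''p'' \<^bold>\<le> Var y \<^bold>* Var y \<^bold>* Var y"
  let ?I = "\<lambda>i s. vars s x = int (Suc i) \<and> vars s ''p'' = int (2 ^ Suc i) \<and> vars s y = int m"
  define n where "n = log_bound m - 1"
  have n: "log_bound m = Suc n" using log_bound(1)[of m] by (simp add: n_def)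
  have loop: "executes (WHILE ?test DO ?body) s1 ((\<Sum>i<n. 4 + exp_time ?test + 1) + exp_time ?test + 1) (?I n)"
    if "ok s1" "?I 0 s1" for s1
  proof (rule executes_While)
    show "exp_val ?test s = Some (of_bool (i < n))" if "i \<le> n" "ok s" "?I i s" for i s
    proof -
      have "2 ^ Suc i \<le> m ^ 3 \<longleftrightarrow> i < n"
        using log_bound_least[of "Suc i" m] log_bound(2)[of m] n that(1)
        by (cases "i = n") auto
      then have "int (2 ^ Suc i) \<le> int m * int m * int m \<longleftrightarrow> i < n"
        by (metis of_nat_le_iff of_nat_mult power3_eq_cube)
      then show ?thesis using that by simp
    qed
    show "executes ?body s 4 (?I (Suc i))" if i: "i < n" "ok s" "?I i s" for i s
    proof -
      have "2 ^ Suc i \<le> m ^ 3" using log_bound_least[of "Suc i" m] n i by simp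
      then have "int (2 ^ Suc i) \<le> int (m ^ 3)" by (rule of_nat_mono)
      then have p: "2 * int (2 ^ Suc i) \<le> V" using V by simp
      have "Suc (Suc i) < 2 ^ Suc (Suc i)" by (rule less_exp)
      then have "int (Suc (Suc i)) \<le> int (2 ^ Suc (Suc i))" by (simp only: of_nat_le_iff less_imp_le)
      then have q: "int i + 2 \<le> V" using p by simp
      have "executes ?body s ((exp_time (Var x \<^bold>+ Const 1) + 1) + (exp_time (Const 2 \<^bold>* Var ''p'') + 1)) (?I (Suc i))"
        apply (rule executes_Seq, rule executes_Assign[OF i(2)])
           apply (use i in simp)
          apply simp
        subgoal using i p q by (simp add: algebra_simps)
        apply (rule executes_Assign, assumption)
           apply (use i assms in simp)
          apply simp
        subgoal using i p q by (simp add: algebra_simps)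
        subgoal using i assms by simp
        done
      then show ?thesis by (rule executes_le) simp
    qed
  qed (use that in auto)
  show ?thesis
    unfolding compute_bound_def
    apply (rule executes_le)
     apply (rule executes_Seq, rule executes_Seq, rule executes_Assign[OF s(1)])
        apply simp
       apply simp
      apply (use V_ge in simp)
     apply (rule executes_Assign, assumption)
        apply simp
       apply simp
      apply (use V_ge in simp)
     apply (rule executes_conseq[OF loop], assumption)
    using assms n by auto
qed

lemma compute_E:
  assumes s: "ok s" "x \<noteq> ''r''" and j: "\<And>v. exp_val j (s\<lparr>vars := (vars s)(x := v)\<rparr>) = Some (int k)"
    "exp_weight j \<le> 100" and V: "int (E k) \<le> V"
  shows "executes (compute_E x j) s (exp_time j + 2 * k + 10) (\<lambda>s'. vars s' x = int (E k))"
proof -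
  let ?body = "x ::= Const 3 \<^bold>* Var x;; ''r'' ::= Var ''r'' \<^bold>- Const 3"
  let ?test = "Const 4 \<^bold>< Var ''r''"
  let ?I = "\<lambda>i s. vars s x = 3 ^ i \<and> vars s ''r'' = int k - 3 * int i"
  define n where "n = (k - 2) div 3"
  define r where "r = k - 3 * n"
  have r: "int r = int k - 3 * int n" "r \<le> 4" unfolding r_def n_def by linarith+
  have E: "E k = 3 ^ n * max 1 r" unfolding r_def n_def by (rule E_closed)
  have kV: "int k \<le> V" using E_ge_self[of k] V by linarith
  have pow: "(3::int) ^ i \<le> V" if "i \<le> n" for i
  proof -
    have "(3::int) ^ i \<le> 3 ^ n" using that by (intro power_increasing) auto
    also have "\<dots> = 3 ^ n * 1" by simp
    also have "\<dots> \<le> 3 ^ n * int (max 1 r)" by (intro mult_left_mono) auto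
    finally show ?thesis using V E by simp
  qed
  have loop: "executes (WHILE ?test DO ?body) s1 ((\<Sum>i<n. 4 + exp_time ?test + 1) + exp_time ?test + 1) (?I n)"
    if "ok s1" "?I 0 s1" for s1
  proof (rule executes_While)
    show "exp_val ?test s = Some (of_bool (i < n))" if "i \<le> n" "ok s" "?I i s" for i s
    proof -
      have "4 < int k - 3 * int i \<longleftrightarrow> i < n" using that(1) unfolding n_def by linarith
      then show ?thesis using that by simp
    qed
    show "executes ?body s 4 (?I (Suc i))" if i: "i < n" "ok s" "?I i s" for i s
    proof -
      have p: "3 * 3 ^ i \<le> V" using pow[of "Suc i"] i by simp
      have q: "\<bar>int k - 3 * int i - 3\<bar> \<le> V" using kV i r by linarith
      have "executes ?body s ((exp_time (Const 3 \<^bold>* Var x) + 1) + (exp_time (Var ''r'' \<^bold>- Const 3) + 1)) (?I (Suc i))"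
        apply (rule executes_Seq, rule executes_Assign[OF i(2)])
           apply (use i in simp)
          apply simp
        subgoal using i p by simp
        apply (rule executes_Assign, assumption)
           apply (use i s in simp)
          apply simp
        subgoal using q by simp
        subgoal using i assms by simp
        done
      then show ?thesis by (rule executes_le) simp
    qed
  qed (use that in auto)
  have last: "executes (IF Const 1 \<^bold>< Var ''r'' THEN x ::= Var x \<^bold>* Var ''r'' ELSE Skip) s1
      (exp_time (Const 1 \<^bold>< Var ''r'') + 1 + max (exp_time (Var x \<^bold>* Var ''r'') + 1) 1)
      (\<lambda>s'. vars s' x = int (E k))" if s1: "ok s1" "?I n s1" for s1
  proof (rule executes_If[OF s1(1)])
    show "exp_val (Const 1 \<^bold>< Var ''r'') s1 = Some (of_bool (1 < r))" using s1 r by simp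
    show "executes (x ::= Var x \<^bold>* Var ''r'') s1 (exp_time (Var x \<^bold>* Var ''r'') + 1)
      (\<lambda>s'. vars s' x = int (E k))" if "of_bool (1 < r) \<noteq> (0::int)"
    proof -
      have "3 ^ n * (int k - 3 * int n) = int (E k)" using that E r(1) by (simp flip: r(1))
      then show ?thesis
        by (intro executes_Assign[where v = "int (E k)"]) (use s1 V in auto)
    qed
    show "executes Skip s1 1 (\<lambda>s'. vars s' x = int (E k))" if "of_bool (1 < r) = (0::int)"
      by (rule executes_Skip) (use s1 that E in auto)
  qed simp
  have time: "1 + (exp_time j + 1) + ((\<Sum>i<n. 4 + exp_time ?test + 1) + exp_time ?test + 1) +
     (exp_time (Const 1 \<^bold>< Var ''r'') + 1 + max (exp_time (Var x \<^bold>* Var ''r'') + 1) 1)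
     \<le> exp_time j + 2 * k + 10"
  proof -
    have "3 * n \<le> k" unfolding n_def by linarith
    then show ?thesis by simp
  qed
  show ?thesis
    unfolding compute_E_def
    apply (rule executes_le)
     apply (rule executes_Seq, rule executes_Seq, rule executes_Seq, rule executes_Assign[OF s(1)])
        apply simp
       apply simp
      apply (use V_ge in simp)
     apply (rule executes_Assign, assumption)
        apply (rule j)
       apply (rule j)
      apply (use kV in simp)
     apply (rule executes_conseq[OF loop], assumption)
       apply (use s in simp)
      apply (rule le_refl)
     apply (rule last, assumption, assumption)
    using time by simp
qed

lemma compute_kMax:
  assumes s: "ok s" "n \<ge> 2" "vars s ''n'' = int n" "exp_val Te s = Some (int (complexity (n - 1)))"
    "exp_weight Te \<le> 100" and V: "int (n ^ 2) \<le> V"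
  shows "executes (compute_kMax Te) s (exp_time Te + kMax_time (complexity (n - 1)))
    (\<lambda>s'. vars s' ''kMax'' = int (kMax n))"
proof -
  define T where "T = complexity (n - 1)"
  define n0 where "n0 = T div 2 - kmax_index n"
  have k0: "kmax_index n \<le> T div 2" using kmax_index_le by (simp add: T_def)
  have ET: "int (E t) \<le> V" if "t \<le> T" for t
  proof -
    have "E t \<le> E T" using that by (rule E_mono)
    also have "\<dots> \<le> (n - 1) ^ 2" unfolding T_def using s by (intro E_complexity_le) auto
    also have "\<dots> \<le> n ^ 2" by (intro power_mono) auto
    finally show ?thesis using V by linarith
  qed
  have TV: "int T \<le> V" using ET[of T] E_ge_self[of T] by linarith
  have TV2: "\<bar>int T div 2\<bar> \<le> V" using TV by linarith
  let ?C1 = "compute_E ''E1'' (Var ''t'')" and ?C2 = "compute_E ''E2'' (Var ''T'' \<^bold>- Var ''t'')"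
  let ?body = "''t'' ::= Var ''t'' \<^bold>- Const 1;; ?C1;; ?C2"
  let ?test = "Var ''E1'' \<^bold>+ Var ''E2'' \<^bold>< Var ''n''"
  let ?J = "\<lambda>t s. vars s ''t'' = int t \<and> vars s ''T'' = int T \<and> vars s ''n'' = int n"
  let ?I = "\<lambda>t s. ?J t s \<and> vars s ''E1'' = int (E t) \<and> vars s ''E2'' = int (E (T - t))"
  have fr: "''T'' \<notin> assigned_vars (compute_E x j)" "''n'' \<notin> assigned_vars (compute_E x j)"
    "''t'' \<notin> assigned_vars (compute_E x j)"
    if "x = ''E1'' \<or> x = ''E2''" for x j
    using that by (auto simp: compute_E_def)
  have fr2: "''E1'' \<notin> assigned_vars ?C2" by (auto simp: compute_E_def)
  have EE: "executes (?C1;; ?C2) s1 (4 * T + 21) (?I t)" if s1: "ok s1" "?J t s1" "t \<le> T" for t s1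
  proof (rule executes_le, rule executes_Seq')
    show "executes ?C1 s1 (exp_time (Var ''t'') + 2 * t + 10) (\<lambda>s'. vars s' ''E1'' = int (E t))"
      by (rule compute_E) (use s1 ET in auto)
    show "executes ?C2 s2 (exp_time (Var ''T'' \<^bold>- Var ''t'') + 2 * (T - t) + 10) (?I t)"
      if s2: "ok s2" "frame ?C1 s1 s2" "vars s2 ''E1'' = int (E t)" for s2
    proof (rule executes_conseq[OF compute_E])
      have J: "?J t s2" using frame_var[OF s2(2)] fr s1 by simp
      show "exp_val (Var ''T'' \<^bold>- Var ''t'') (s2\<lparr>vars := (vars s2)(''E2'' := v)\<rparr>) = Some (int (T - t))" for v
        using J s1 by simp
      show "?I t s3" if "frame ?C2 s2 s3" "vars s3 ''E2'' = int (E (T - t))" for s3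
        using frame_var[OF that(1)] fr fr2 J s2(3) that(2) by simp
    qed (use s2 ET in auto)
  qed (use s1 in simp)
  have loop: "executes (WHILE ?test DO ?body) s1 ((\<Sum>i<n0. (4 * T + 23) + exp_time ?test + 1) + exp_time ?test + 1)
    (?I (T div 2 - n0))" if "ok s1" "?I (T div 2 - 0) s1" for s1
  proof (rule executes_While[where I = "\<lambda>i. ?I (T div 2 - i)"])
    show "exp_val ?test s = Some (of_bool (i < n0))" if "i \<le> n0" "ok s" "?I (T div 2 - i) s" for i s
    proof -
      define t where "t = T div 2 - i"
      have "E t + E (T - t) < n \<longleftrightarrow> i < n0"
      proof (cases "i = n0")
        case True
        then have "t = kmax_index n" using k0 by (simp add: t_def n0_def)
        then show ?thesis using kmax_index_cond[OF s(2)] True by (simp add: T_def)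
      next
        case False
        then have "kmax_index n < t" "i < n0" using that k0 by (auto simp: t_def n0_def)
        then show ?thesis unfolding T_def
          using kmax_loop_above[of n T "T div 2" t] by (simp add: kmax_index_def T_def t_def del: diff_diff_right)
      qed
      then have "int (E t) + int (E (T - t)) < int n \<longleftrightarrow> i < n0" by linarith
      then show ?thesis using that(3) unfolding t_def[symmetric] by simp
    qed
    show "executes ?body s (4 * T + 23) (?I (T div 2 - Suc i))"
      if i: "i < n0" "ok s" "?I (T div 2 - i) s" for i s
    proof -
      define t where "t = T div 2 - Suc i"
      have t: "int (T div 2 - i) - 1 = int t" "t \<le> T" using i by (auto simp: t_def n0_def)
      have "executes (''t'' ::= Var ''t'' \<^bold>- Const 1;; (?C1;; ?C2)) s ((exp_time (Var ''t'' \<^bold>- Const 1) + 1) + (4 * T + 21)) (?I t)"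
        apply (rule executes_Seq, rule executes_Assign[OF i(2)])
           apply (use i t in simp)
          apply simp
         apply (use t TV in simp)
        apply (rule EE, assumption)
        using i t by auto
      then have "executes ?body s ((exp_time (Var ''t'' \<^bold>- Const 1) + 1) + (4 * T + 21)) (?I t)"
        by (rule executes_Seq_assoc)
      then show ?thesis unfolding t_def[symmetric] by (rule executes_le) simp
    qed
  qed (use that in auto)
  have time: "(exp_time Te + 1) + (2 + (4 * T + 21)) + ((\<Sum>i<n0. (4 * T + 23) + exp_time ?test + 1) + exp_time ?test + 1) + 1
    \<le> exp_time Te + kMax_time T"
  proof -
    have "n0 * (4 * T + 26) \<le> T * (4 * T + 26)" unfolding n0_def by (intro mult_right_mono) auto
    then show ?thesis unfolding kMax_time_def by (simp add: algebra_simps)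
  qed
  have init: "executes (''T'' ::= Te;; ''t'' ::= Var ''T'' \<^bold>/ Const 2;; (?C1;; ?C2)) s
     ((exp_time Te + 1) + (exp_time (Var ''T'' \<^bold>/ Const 2) + 1) + (4 * T + 21)) (?I (T div 2))"
    apply (rule executes_Seq, rule executes_Seq, rule executes_Assign[OF s(1)])
       apply (rule s)
      apply (rule s)
     apply (use TV in \<open>simp add: T_def\<close>)
    apply (rule executes_Assign, assumption)
       apply simp
      apply simp
    subgoal using TV2 by (simp add: T_def)
    apply (rule EE, assumption)
    subgoal using s by (simp add: T_def zdiv_int)
    subgoal by simp
    done
  show ?thesis
    unfolding compute_kMax_def T_def[symmetric]
    apply (rule executes_le)
     apply (rule executes_Seq, rule executes_Seq, rule executes_Seq_assoc, rule executes_conseq[OF init le_refl])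
     apply (rule executes_conseq[OF loop le_refl], assumption, simp)
     apply (rule executes_Assign, assumption)
        apply simp
       apply simp
    subgoal using ET[of "kmax_index n"] k0 by (simp add: n0_def)
    subgoal using k0 by (simp add: n0_def kMax_eq)
    using time by simp
qed

end

subsection \<open>The time-improved algorithm\<close>

lemma list_lower_le: "m < length xs \<Longrightarrow> xs[i := min v (xs ! i)] ! m \<le> xs ! m"
  for xs :: "int list"
  by (cases "m = i") auto

definition sieve_inv :: "nat \<Rightarrow> nat \<Rightarrow> int list \<Rightarrow> bool" where
  "sieve_inv M n xs \<longleftrightarrow> length xs = M + 1 \<and> (\<forall>m\<in>{1..M}. int (complexity m) \<le> xs ! m) \<and>
     (\<forall>m. 1 \<le> m \<and> m < n \<longrightarrow> xs ! m = int (complexity m)) \<and>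
     (\<forall>a b. 2 \<le> a \<and> a \<le> b \<and> b < n \<and> a * b \<le> M \<longrightarrow> xs ! (a * b) \<le> int (complexity a + complexity b))"

definition sum_inv :: "nat \<Rightarrow> nat \<Rightarrow> nat \<Rightarrow> int list \<Rightarrow> bool" where
  "sum_inv M n k xs \<longleftrightarrow> sieve_inv M n xs \<and> xs ! n \<le> int (complexity (n - 1) + 1) \<and>
     (\<forall>m. 6 \<le> m \<and> m < k \<longrightarrow> xs ! n \<le> int (complexity m + complexity (n - m)))"

definition prod_inv :: "nat \<Rightarrow> nat \<Rightarrow> nat \<Rightarrow> int list \<Rightarrow> bool" where
  "prod_inv M n k xs \<longleftrightarrow> sieve_inv M n xs \<and> xs ! n = int (complexity n) \<and>
     (\<forall>m. 2 \<le> m \<and> m < k \<longrightarrow> xs ! (m * n) \<le> int (complexity m + complexity n))"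

lemma sieve_inv_lower:
  assumes "sieve_inv M n xs" "n \<le> i" "1 \<le> i" "i \<le> M" "int (complexity i) \<le> v"
  shows "sieve_inv M n (xs[i := min v (xs ! i)])"
proof -
  have *: "xs[i := min v (xs ! i)] ! m \<le> xs ! m" if "m \<le> M" for m
    by (rule list_lower_le) (use assms that in \<open>simp add: sieve_inv_def\<close>)
  show ?thesis
    using assms unfolding sieve_inv_def
    by (auto simp: nth_list_update intro!: order_trans[OF *] min.coboundedI2)
qed

lemma sum_inv_start:
  assumes "sieve_inv M n xs" "2 \<le> n" "n \<le> M"
  shows "sum_inv M n 6 (xs[n := min (xs ! (n - 1) + 1) (xs ! n)])"
proof -
  have x: "xs ! (n - 1) = int (complexity (n - 1))" using assms by (simp add: sieve_inv_def)
  have "complexity n \<le> complexity (n - 1) + 1" using complexity_Suc[of "n - 1"] assms by simp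
  then show ?thesis unfolding sum_inv_def
    using sieve_inv_lower[OF assms(1), of n "xs ! (n - 1) + 1"] assms x by (auto simp: sieve_inv_def)
qed

lemma sum_inv_step:
  assumes "sum_inv M n k xs" "6 \<le> k" "k < n" "n \<le> M"
  shows "sum_inv M n (Suc k) (xs[n := min (xs ! k + xs ! (n - k)) (xs ! n)])"
proof -
  have x: "xs ! k = int (complexity k)" "xs ! (n - k) = int (complexity (n - k))"
    and l: "n < length xs" using assms by (auto simp: sum_inv_def sieve_inv_def)
  have "complexity n \<le> complexity k + complexity (n - k)" using complexity_add[of k "n - k"] assms by simp
  then show ?thesis
    using assms x l sieve_inv_lower[of M n xs n "xs ! k + xs ! (n - k)"]
    unfolding sum_inv_def by (auto simp: less_Suc_eq min.coboundedI2)
qed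

lemma sum_inv_final:
  assumes "sum_inv M n (Suc (kMax n)) xs" "2 \<le> n" "n \<le> M"
  shows "prod_inv M n 2 xs"
proof -
  have i: "sieve_inv M n xs" using assms by (simp add: sum_inv_def)
  then have l: "int (complexity n) \<le> xs ! n" using assms by (auto simp: sieve_inv_def)
  have "nat (xs ! n) = complexity n"
  proof (rule complexity_eq_if_candidates[OF assms(2)])
    fix a b assume ab: "2 \<le> a" "a \<le> b" "a * b = n"
    have "1 * b < a * b" using ab assms(2) by (intro mult_strict_right_mono) auto
    then have "b < n" using ab by simp
    then show "nat (xs ! n) \<le> complexity a + complexity b"
      using i ab assms unfolding sieve_inv_def by (metis nat_le_iff)
  qed (use assms l in \<open>auto simp: sum_inv_def\<close>)
  then show ?thesis using i l by (auto simp: prod_inv_def)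
qed

lemma prod_inv_step:
  assumes "prod_inv M n k xs" "2 \<le> k" "k \<le> n" "k * n \<le> M"
  shows "prod_inv M n (Suc k) (xs[k * n := min (xs ! k + xs ! n) (xs ! (k * n))])"
proof -
  have n: "n < k * n" "n \<ge> 2" using assms by auto
  have x: "xs ! n = int (complexity n)" using assms by (simp add: prod_inv_def)
  then have y: "xs ! k = int (complexity k)"
    using assms by (cases "k = n") (auto simp: prod_inv_def sieve_inv_def)
  have l: "k * n < length xs" using assms by (auto simp: prod_inv_def sieve_inv_def)
  have "complexity (k * n) \<le> complexity k + complexity n" using complexity_mult[of k n] assms n by simp
  then have i: "sieve_inv M n (xs[k * n := min (xs ! k + xs ! n) (xs ! (k * n))])"
    using assms x y n by (intro sieve_inv_lower) (auto simp: prod_inv_def)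
  show ?thesis unfolding prod_inv_def
  proof (intro conjI allI impI i)
    show "xs[k * n := min (xs ! k + xs ! n) (xs ! (k * n))] ! n = int (complexity n)" using n x by simp
    fix m assume m: "2 \<le> m \<and> m < Suc k"
    show "xs[k * n := min (xs ! k + xs ! n) (xs ! (k * n))] ! (m * n) \<le> int (complexity m + complexity n)"
    proof (cases "m = k")
      case True
      then show ?thesis using l x y by simp
    next
      case False
      then have "xs ! (m * n) \<le> int (complexity m + complexity n)" using m assms by (simp add: prod_inv_def)
      moreover have "m * n < k * n" using m False n by simp
      ultimately show ?thesis using l list_lower_le[of "m * n" xs] order_trans by (meson order_less_trans)
    qed
  qed
qed

lemma prod_inv_final:
  assumes "prod_inv M n (Suc u) xs" "u = min n (M div n)" "2 \<le> n"
  shows "sieve_inv M (Suc n) xs"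
  unfolding sieve_inv_def
proof (intro conjI allI impI)
  fix a b assume ab: "2 \<le> a \<and> a \<le> b \<and> b < Suc n \<and> a * b \<le> M"
  show "xs ! (a * b) \<le> int (complexity a + complexity b)"
  proof (cases "b = n")
    case True
    have "a \<le> M div n" using ab assms True by (simp add: less_eq_div_iff_mult_less_eq)
    then have "a < Suc u" using ab assms(2) True by (simp add: less_Suc_eq_le)
    then show ?thesis using ab assms(1) True by (simp add: prod_inv_def)
  next
    case False
    then show ?thesis using ab assms by (auto simp: prod_inv_def sieve_inv_def)
  qed
qed (use assms in \<open>auto simp: prod_inv_def sieve_inv_def less_Suc_eq\<close>)

context bounded_machine
begin

lemma sieve_body:
  assumes s: "ok s" "vars s ''n'' = int n" "vars s ''H'' = int M" "2 \<le> n" "n \<le> M"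
    "sieve_inv M n (arrs s ''B0'')"
    and V: "int (M ^ 2) < V" and r: "\<And>u. u * u \<le> M \<Longrightarrow> u \<le> r"
  shows "executes
      (lower_to ''B0'' (Var ''n'') (Read ''B0'' (Var ''n'' \<^bold>- Const 1) \<^bold>+ Const 1);;
        compute_kMax (Read ''B0'' (Var ''n'' \<^bold>- Const 1));;
        FOR ''m'' FROM Const 6 TO Var ''kMax'' DO
          lower_to ''B0'' (Var ''n'')
            (Read ''B0'' (Var ''m'') \<^bold>+ Read ''B0'' (Var ''n'' \<^bold>- Var ''m''));;
        ''u'' ::= Var ''H'' \<^bold>/ Var ''n'';;
        (IF Var ''n'' \<^bold>< Var ''u'' THEN ''u'' ::= Var ''n'' ELSE Skip);;
        FOR ''k'' FROM Const 2 TO Var ''u'' DO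
          lower_to ''B0'' (Var ''k'' \<^bold>* Var ''n'')
            (Read ''B0'' (Var ''k'') \<^bold>+ Read ''B0'' (Var ''n''))) s
      (kMax_time (log_bound M) + 40 + 16 * kMax n + 20 * r)
      (\<lambda>s'. sieve_inv M (Suc n) (arrs s' ''B0''))"
    (is "executes (?A;; ?B;; ?C;; ?D;; ?F;; ?G) s _ _")
proof -
  have MV: "int M < V"
  proof -
    have "M \<le> M ^ 2" by (simp add: power2_eq_square)
    then have "int M \<le> int (M ^ 2)" by (rule of_nat_mono)
    then show ?thesis using V by linarith
  qed
  let ?P = "\<lambda>s. vars s ''n'' = int n \<and> vars s ''H'' = int M"
  have nonneg: "0 \<le> arrs s' ''B0'' ! m" if "sieve_inv M n (arrs s' ''B0'')" "1 \<le> m" "m \<le> M" for m s'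
    using that unfolding sieve_inv_def by (meson atLeastAtMost_iff of_nat_0_le_iff order_trans)
  have A: "executes ?A s 10 (\<lambda>s. sum_inv M n 6 (arrs s ''B0''))"
  proof (rule executes_le, rule executes_lower_to[OF s(1)])
    show "exp_val (Var ''n'') s = Some (int n)" using s by simp
    have i: "nat (int n - 1) = n - 1" by linarith
    show "exp_val (Read ''B0'' (Var ''n'' \<^bold>- Const 1) \<^bold>+ Const 1) s = Some (arrs s ''B0'' ! (n - 1) + 1)"
      using s i by (simp add: sieve_inv_def)
    show "0 \<le> arrs s ''B0'' ! (n - 1) + 1" using nonneg[of s "n - 1"] s by simp
  qed (use s sum_inv_start[OF s(6,4,5)] in \<open>auto simp: sieve_inv_def\<close>)
  have B: "executes ?B s1 (kMax_time (log_bound M) + 2) (\<lambda>s. vars s ''kMax'' = int (kMax n))"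
    if s1: "ok s1" "?P s1" "sum_inv M n 6 (arrs s1 ''B0'')" for s1
  proof (rule executes_le, rule compute_kMax)
    have i: "nat (int n - 1) = n - 1" by linarith
    show "exp_val (Read ''B0'' (Var ''n'' \<^bold>- Const 1)) s1 = Some (int (complexity (n - 1)))"
      using s1 s i by (simp add: sum_inv_def sieve_inv_def)
    have "n ^ 2 \<le> M ^ 2" using s by (intro power_mono) auto
    then have "int (n ^ 2) \<le> int (M ^ 2)" by (rule of_nat_mono)
    then show "int (n ^ 2) \<le> V" using V by linarith
    show "exp_time (Read ''B0'' (Var ''n'' \<^bold>- Const 1)) + kMax_time (complexity (n - 1)) \<le> kMax_time (log_bound M) + 2"
      using kMax_time_mono[OF complexity_le_log_bound[of "n - 1" M]] s by simp
  qed (use s1 s in auto)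
  have C: "executes ?C s1 (16 * kMax n + 3) (\<lambda>s. prod_inv M n 2 (arrs s ''B0''))"
    if s1: "ok s1" "?P s1" "vars s1 ''kMax'' = int (kMax n)" "sum_inv M n 6 (arrs s1 ''B0'')" for s1
  proof (rule executes_conseq, rule executes_For[OF s1(1), where n = "kMax n - 5" and
        a = 6 and h = "int (kMax n)" and \<tau> = "\<lambda>_. 12" and
        I = "\<lambda>i s. ?P s \<and> vars s ''kMax'' = int (kMax n) \<and> sum_inv M n (6 + i) (arrs s ''B0'')"])
    show "\<bar>int (kMax n)\<bar> < V" using kMax_less[OF s(4)] s(5) MV by linarith
    show "executes (lower_to ''B0'' (Var ''n'') (Read ''B0'' (Var ''m'') \<^bold>+ Read ''B0'' (Var ''n'' \<^bold>- Var ''m''))) s 12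
       (\<lambda>s. ?P s \<and> vars s ''kMax'' = int (kMax n) \<and> sum_inv M n (6 + Suc i) (arrs s ''B0''))"
      if i: "i < kMax n - 5" "ok s" "?P s \<and> vars s ''kMax'' = int (kMax n) \<and> sum_inv M n (6 + i) (arrs s ''B0'')"
        "vars s ''m'' = 6 + int i" for i s
    proof (rule executes_le, rule executes_lower_to[OF i(2)])
      have k: "6 + i < n" using i(1) kMax_less[OF s(4)] by linarith
      have e: "nat (6 + int i) = 6 + i" "nat (int n - (6 + int i)) = n - (6 + i)" by linarith+
      have inv: "sieve_inv M n (arrs s ''B0'')" using i by (simp add: sum_inv_def)
      then have l: "length (arrs s ''B0'') = M + 1" by (simp add: sieve_inv_def)
      show "exp_val (Var ''n'') s = Some (int n)" using i by simp
      show "exp_val (Read ''B0'' (Var ''m'') \<^bold>+ Read ''B0'' (Var ''n'' \<^bold>- Var ''m'')) s =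
          Some (arrs s ''B0'' ! (6 + i) + arrs s ''B0'' ! (n - (6 + i)))"
        using i e k l \<open>n \<le> M\<close> by simp
      show "0 \<le> arrs s ''B0'' ! (6 + i) + arrs s ''B0'' ! (n - (6 + i))"
        using nonneg[OF inv, of "6 + i"] nonneg[OF inv, of "n - (6 + i)"] k \<open>n \<le> M\<close> by simp
      show "?P s' \<and> vars s' ''kMax'' = int (kMax n) \<and> sum_inv M n (6 + Suc i) (arrs s' ''B0'')"
        if "vars s' = vars s" "arrs s' = (arrs s)(''B0'' := (arrs s ''B0'')[nat (int n) :=
          min (arrs s ''B0'' ! (6 + i) + arrs s ''B0'' ! (n - (6 + i))) (arrs s ''B0'' ! nat (int n))])" for s'
        using that i sum_inv_step[of M n "6 + i" "arrs s ''B0''"] k \<open>n \<le> M\<close> by simp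
    qed (use i \<open>n \<le> M\<close> in \<open>auto simp: sum_inv_def sieve_inv_def\<close>)
    show "prod_inv M n 2 (arrs s' ''B0'')"
      if "?P s' \<and> vars s' ''kMax'' = int (kMax n) \<and> sum_inv M n (6 + (kMax n - 5)) (arrs s' ''B0'')" for s'
    proof (rule sum_inv_final[OF _ s(4,5)])
      have "sum_inv M n (6 + (kMax n - 5)) (arrs s' ''B0'')" using that by simp
      then show "sum_inv M n (Suc (kMax n)) (arrs s' ''B0'')" by (auto simp: sum_inv_def)
    qed
  qed (use s1 V_ge in \<open>auto simp: lower_to_def\<close>)
  define u where "u = min n (M div n)"
  have u: "u \<le> r"
  proof (rule r)
    have "u * u \<le> M div n * n" unfolding u_def by (intro mult_mono) auto
    then show "u * u \<le> M" using div_times_less_eq_dividend[of M n] by linarith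
  qed
  have DF: "executes (?D;; ?F) s1 5 (\<lambda>s. vars s ''u'' = int u)" if s1: "ok s1" "?P s1" for s1
  proof (rule executes_le, rule executes_Seq, rule executes_Assign[OF s1(1)])
    show "exp_val (Var ''H'' \<^bold>/ Var ''n'') s1 = Some (int (M div n))"
      using s1 s by (simp add: zdiv_int)
    have "M div n \<le> M" by simp
    then show "\<bar>int (M div n)\<bar> \<le> V" using MV by linarith
    let ?s = "s1\<lparr>vars := (vars s1)(''u'' := int (M div n))\<rparr>"
    show "executes ?F ?s (1 + 1 + max 1 1) (\<lambda>s. vars s ''u'' = int u)" if ok: "ok ?s"
    proof (rule executes_le, rule executes_If[OF ok])
      show "exp_val (Var ''n'' \<^bold>< Var ''u'') ?s = Some (of_bool (n < M div n))" using s1 by simp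
      show "executes (''u'' ::= Var ''n'') ?s (exp_time (Var ''n'') + 1) (\<lambda>s. vars s ''u'' = int u)"
        if "of_bool (n < M div n) \<noteq> (0::int)"
        by (rule executes_Assign[OF ok]) (use s1 s MV that in \<open>auto simp: u_def\<close>)
      show "executes Skip ?s 1 (\<lambda>s. vars s ''u'' = int u)" if "of_bool (n < M div n) = (0::int)"
        by (rule executes_Skip[OF ok]) (use that in \<open>auto simp: u_def min_def\<close>)
    qed auto
  qed auto
  have G: "executes ?G s1 (20 * r + 3) (\<lambda>s. sieve_inv M (Suc n) (arrs s ''B0''))"
    if s1: "ok s1" "?P s1" "vars s1 ''u'' = int u" "prod_inv M n 2 (arrs s1 ''B0'')" for s1
  proof (rule executes_conseq, rule executes_For[OF s1(1), where n = "u - 1" and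
        a = 2 and h = "int u" and \<tau> = "\<lambda>_. 12" and
        I = "\<lambda>i s. ?P s \<and> vars s ''u'' = int u \<and> prod_inv M n (2 + i) (arrs s ''B0'')"])
    show "\<bar>int u\<bar> < V" using MV s(5) unfolding u_def by linarith
    show "executes (lower_to ''B0'' (Var ''k'' \<^bold>* Var ''n'') (Read ''B0'' (Var ''k'') \<^bold>+ Read ''B0'' (Var ''n''))) s 12
       (\<lambda>s. ?P s \<and> vars s ''u'' = int u \<and> prod_inv M n (2 + Suc i) (arrs s ''B0''))"
      if i: "i < u - 1" "ok s" "?P s \<and> vars s ''u'' = int u \<and> prod_inv M n (2 + i) (arrs s ''B0'')"
        "vars s ''k'' = 2 + int i" for i s
    proof (rule executes_le, rule executes_lower_to[OF i(2)])
      have k: "2 + i \<le> n" "2 + i \<le> M div n" using i(1) unfolding u_def by linarith+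
      then have kn: "(2 + i) * n \<le> M" using s(4) by (simp add: less_eq_div_iff_mult_less_eq)
      have e: "nat (2 + int i) = 2 + i" "(2 + int i) * int n = int ((2 + i) * n)"
        by (simp_all add: algebra_simps)
      have inv: "sieve_inv M n (arrs s ''B0'')" using i by (simp add: prod_inv_def)
      then have l: "length (arrs s ''B0'') = M + 1" by (simp add: sieve_inv_def)
      show "exp_val (Var ''k'' \<^bold>* Var ''n'') s = Some (int ((2 + i) * n))" using i e(2) by simp
      show "int ((2 + i) * n) < int (length (arrs s ''B0''))" using l kn by linarith
      show "exp_val (Read ''B0'' (Var ''k'') \<^bold>+ Read ''B0'' (Var ''n'')) s =
          Some (arrs s ''B0'' ! (2 + i) + arrs s ''B0'' ! n)"
        using i e k l \<open>n \<le> M\<close> by simp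
      show "0 \<le> arrs s ''B0'' ! (2 + i) + arrs s ''B0'' ! n"
        using nonneg[OF inv, of "2 + i"] nonneg[OF inv, of n] k \<open>n \<le> M\<close> \<open>2 \<le> n\<close> by simp
      show "?P s' \<and> vars s' ''u'' = int u \<and> prod_inv M n (2 + Suc i) (arrs s' ''B0'')"
        if "vars s' = vars s" "arrs s' = (arrs s)(''B0'' := (arrs s ''B0'')[nat (int ((2 + i) * n)) :=
          min (arrs s ''B0'' ! (2 + i) + arrs s ''B0'' ! n) (arrs s ''B0'' ! nat (int ((2 + i) * n)))])" for s'
        using that i prod_inv_step[of M n "2 + i" "arrs s ''B0''"] k kn unfolding nat_int by simp
    qed (use i in auto)
    show "sieve_inv M (Suc n) (arrs s' ''B0'')"
      if "?P s' \<and> vars s' ''u'' = int u \<and> prod_inv M n (2 + (u - 1)) (arrs s' ''B0'')" for s'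
    proof (rule prod_inv_final[OF _ u_def s(4)])
      have "prod_inv M n (2 + (u - 1)) (arrs s' ''B0'')" using that by simp
      then show "prod_inv M n (Suc u) (arrs s' ''B0'')" by (auto simp: prod_inv_def)
    qed
  qed (use s1 V_ge u in \<open>auto simp: lower_to_def\<close>)
  have fr: "''n'' \<notin> assigned_vars ?B" "''H'' \<notin> assigned_vars ?B" "''B0'' \<notin> assigned_arrs ?B"
    "''n'' \<notin> assigned_vars ?A" "''H'' \<notin> assigned_vars ?A"
    "''n'' \<notin> assigned_vars ?C" "''H'' \<notin> assigned_vars ?C"
    "''n'' \<notin> assigned_vars (?D;; ?F)" "''H'' \<notin> assigned_vars (?D;; ?F)" "''B0'' \<notin> assigned_arrs (?D;; ?F)"
    by (auto simp: compute_kMax_def compute_E_def lower_to_def)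
  have AB: "executes (?A;; ?B) s (10 + (kMax_time (log_bound M) + 2))
    (\<lambda>s. ?P s \<and> vars s ''kMax'' = int (kMax n) \<and> sum_inv M n 6 (arrs s ''B0''))"
  proof (rule executes_Seq'[OF A])
    fix s1 assume s1: "ok s1" "frame ?A s s1" "sum_inv M n 6 (arrs s1 ''B0'')"
    have P: "?P s1" using frame_var[OF s1(2)] fr s by simp
    show "executes ?B s1 (kMax_time (log_bound M) + 2)
      (\<lambda>s. ?P s \<and> vars s ''kMax'' = int (kMax n) \<and> sum_inv M n 6 (arrs s ''B0''))"
    proof (rule executes_conseq[OF B[OF s1(1) P s1(3)] le_refl])
      fix s2 assume "frame ?B s1 s2" "vars s2 ''kMax'' = int (kMax n)"
      then show "?P s2 \<and> vars s2 ''kMax'' = int (kMax n) \<and> sum_inv M n 6 (arrs s2 ''B0'')"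
        using frame_var frame_arr fr P s1(3) by simp
    qed
  qed
  have ABC: "executes (?A;; ?B;; ?C) s (10 + (kMax_time (log_bound M) + 2) + (16 * kMax n + 3))
    (\<lambda>s. ?P s \<and> prod_inv M n 2 (arrs s ''B0''))"
  proof (rule executes_Seq'[OF AB])
    fix s1 assume s1: "ok s1" "?P s1 \<and> vars s1 ''kMax'' = int (kMax n) \<and> sum_inv M n 6 (arrs s1 ''B0'')"
    show "executes ?C s1 (16 * kMax n + 3) (\<lambda>s. ?P s \<and> prod_inv M n 2 (arrs s ''B0''))"
    proof (rule executes_conseq[OF C le_refl])
      fix s2 assume "frame ?C s1 s2" "prod_inv M n 2 (arrs s2 ''B0'')"
      then show "?P s2 \<and> prod_inv M n 2 (arrs s2 ''B0'')"
        using frame_var fr s1 by simp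
    qed (use s1 in auto)
  qed
  have ABCDF: "executes (?A;; ?B;; ?C;; ?D;; ?F) s (10 + (kMax_time (log_bound M) + 2) + (16 * kMax n + 3) + 5)
    (\<lambda>s. ?P s \<and> vars s ''u'' = int u \<and> prod_inv M n 2 (arrs s ''B0''))"
  proof (rule executes_Seq_assoc, rule executes_Seq'[OF ABC])
    fix s1 assume s1: "ok s1" "?P s1 \<and> prod_inv M n 2 (arrs s1 ''B0'')"
    show "executes (?D;; ?F) s1 5 (\<lambda>s. ?P s \<and> vars s ''u'' = int u \<and> prod_inv M n 2 (arrs s ''B0''))"
    proof (rule executes_conseq[OF DF le_refl])
      fix s2 assume f: "frame (?D;; ?F) s1 s2" and "vars s2 ''u'' = int u"
      then show "?P s2 \<and> vars s2 ''u'' = int u \<and> prod_inv M n 2 (arrs s2 ''B0'')"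
        using frame_var[OF f fr(8)] frame_var[OF f fr(9)] frame_arr[OF f fr(10)] s1 by simp
    qed (use s1 in auto)
  qed
  show ?thesis
    by (rule executes_le, rule executes_Seq'[OF ABCDF], rule G) auto
qed

lemma time_improved:
  assumes s: "ok s" "vars s ''H'' = int M" "1 \<le> M"
    and V: "int (2 * M ^ 3) < V" and B0: "M + 1 \<le> len ''B0''" "int (log_bound M) \<le> ent ''B0''"
    and r: "\<And>u. u * u \<le> M \<Longrightarrow> u \<le> r"
  shows "executes (time_improved ''B0'' (Var ''H'')) s
     (20 * log_bound M + 30 + M + (\<Sum>n\<in>{2..M}. kMax_time (log_bound M) + 50 + 16 * kMax n + 20 * r))
     (\<lambda>s'. length (arrs s' ''B0'') = M + 1 \<and> (\<forall>n\<in>{1..M}. arrs s' ''B0'' ! n = int (complexity n)))"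
proof -
  define d where "d = log_bound M"
  have "M * 1 \<le> M * (2 * M ^ 2)" using s(3) by (intro mult_left_mono) auto
  then have "int M \<le> int (2 * M ^ 3)" by (simp add: power3_eq_cube power2_eq_square del: of_nat_mult of_nat_power)
  then have MV: "int M < V" using V by linarith
  have "1 * M ^ 2 \<le> 2 * M * M ^ 2" using s(3) by (intro mult_right_mono) auto
  then have "int (M ^ 2) \<le> int (2 * M ^ 3)" by (simp add: power3_eq_cube power2_eq_square ac_simps del: of_nat_mult of_nat_power)
  then have M2: "int (M ^ 2) < V" using V by linarith
  define body where "body = (lower_to ''B0'' (Var ''n'') (Read ''B0'' (Var ''n'' \<^bold>- Const 1) \<^bold>+ Const 1);;
        compute_kMax (Read ''B0'' (Var ''n'' \<^bold>- Const 1));;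
        FOR ''m'' FROM Const 6 TO Var ''kMax'' DO
          lower_to ''B0'' (Var ''n'')
            (Read ''B0'' (Var ''m'') \<^bold>+ Read ''B0'' (Var ''n'' \<^bold>- Var ''m''));;
        ''u'' ::= Var ''H'' \<^bold>/ Var ''n'';;
        (IF Var ''n'' \<^bold>< Var ''u'' THEN ''u'' ::= Var ''n'' ELSE Skip);;
        FOR ''k'' FROM Const 2 TO Var ''u'' DO
          lower_to ''B0'' (Var ''k'' \<^bold>* Var ''n'')
            (Read ''B0'' (Var ''k'') \<^bold>+ Read ''B0'' (Var ''n'')))"
  let ?\<tau> = "\<lambda>n. kMax_time (log_bound M) + 40 + 16 * kMax n + 20 * r"
  have nH: "''n'' \<notin> assigned_vars body" "''H'' \<notin> assigned_vars body"
    by (auto simp: body_def compute_kMax_def compute_E_def lower_to_def)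
  have loop: "executes (FOR ''n'' FROM Const 2 TO Var ''H'' DO body) s1
     ((\<Sum>i<M - 1. ?\<tau> (2 + i) + 4) + 3)
     (\<lambda>s'. length (arrs s' ''B0'') = M + 1 \<and> (\<forall>n\<in>{1..M}. arrs s' ''B0'' ! n = int (complexity n)))"
    if s1: "ok s1" "vars s1 ''H'' = int M" "sieve_inv M 2 (arrs s1 ''B0'')" for s1
  proof (rule executes_conseq, rule executes_For[OF s1(1), where n = "M - 1" and a = 2 and h = "int M" and
        \<tau> = "\<lambda>i. ?\<tau> (2 + i)" and I = "\<lambda>i s. vars s ''H'' = int M \<and> sieve_inv M (2 + i) (arrs s ''B0'')"])
    show "executes body s (?\<tau> (2 + i)) (\<lambda>s. vars s ''H'' = int M \<and> sieve_inv M (2 + Suc i) (arrs s ''B0''))"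
      if i: "i < M - 1" "ok s" "vars s ''H'' = int M \<and> sieve_inv M (2 + i) (arrs s ''B0'')"
        "vars s ''n'' = 2 + int i" for i s
    proof (rule executes_conseq)
      show "executes body s (?\<tau> (2 + i)) (\<lambda>s'. sieve_inv M (Suc (2 + i)) (arrs s' ''B0''))"
        unfolding body_def by (rule sieve_body) (use i M2 r in auto)
    qed (use nH i in \<open>auto simp: frame_var\<close>)
  next
    show "length (arrs s' ''B0'') = M + 1 \<and> (\<forall>n\<in>{1..M}. arrs s' ''B0'' ! n = int (complexity n))"
      if "vars s' ''H'' = int M \<and> sieve_inv M (2 + (M - 1)) (arrs s' ''B0'')" for s'
      using that s(3) by (auto simp: sieve_inv_def)
  qed (use s1 MV V_ge s(3) nH in auto)
  have "(\<Sum>i<M - 1. ?\<tau> (2 + i) + 4) = (\<Sum>n\<in>{2..M}. ?\<tau> n + 4)"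
    by (rule sum.reindex_bij_witness[of _ "\<lambda>n. n - 2" "\<lambda>i. 2 + i"]) auto
  also have "\<dots> \<le> (\<Sum>n\<in>{2..M}. kMax_time (log_bound M) + 50 + 16 * kMax n + 20 * r)"
    by (intro sum_mono) simp
  finally have time: "(\<Sum>i<M - 1. ?\<tau> (2 + i) + 4) \<le> \<dots>" .
  have init: "sieve_inv M 2 ((replicate (M + 1) (int d))[1 := 1])"
    unfolding sieve_inv_def
    using complexity_le_log_bound[of _ M] s(3) by (auto simp: nth_list_update d_def complexity_1 less_Suc_eq numeral_2_eq_2)
  have fr: "''H'' \<notin> assigned_vars (compute_bound ''d'' (Var ''H''))" by (simp add: compute_bound_def)
  have dV: "int d \<le> V" "1 \<le> d" using B0(2) ent_le[of "''B0''"] log_bound(1) unfolding d_def by auto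
  show ?thesis
    unfolding time_improved_def body_def[symmetric]
    apply (rule executes_le)
     apply (rule executes_Seq, rule executes_Seq, rule executes_Seq)
     apply (rule executes_conseq[OF compute_bound[OF s(1,2,3)] le_refl])
         apply simp
        apply simp
       apply simp
    subgoal using V by simp
     apply (rule executes_Alloc[where k = "int (M + 1)" and v = "int d"], assumption)
            apply (use s fr in \<open>simp add: frame_var\<close>)
           apply simp
          apply (simp add: d_def)
         apply simp
        apply simp
    subgoal using B0 by simp
    subgoal using B0 by (simp add: d_def)
     apply (rule executes_Write[where k = 1 and v = 1], assumption)
            apply simp
           apply simp
    subgoal using s by simp
         apply simp
        apply simp
       apply simp
    subgoal using B0 log_bound(1)[of M] by simp
     apply (rule loop, assumption)
    subgoal using s fr by (simp add: frame_var)
    subgoal using init by (simp add: nat_add_distrib)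
    using time by simp
qed

end


subsection \<open>Running blocks\<close>

lemma log_bound_mono: "m \<le> n \<Longrightarrow> log_bound m \<le> log_bound n"
proof (rule ccontr)
  assume mn: "m \<le> n" and "\<not> log_bound m \<le> log_bound n"
  then have "2 ^ log_bound n \<le> m ^ 3" using log_bound(1) by (intro log_bound_least) auto
  also have "\<dots> \<le> n ^ 3" using mn by (intro power_mono) auto
  finally show False using log_bound(2)[of n] by simp
qed

definition index_exp :: "exp \<Rightarrow> state \<Rightarrow> nat \<Rightarrow> bool" where
  "index_exp je s j \<longleftrightarrow> je = Const 1 \<and> j = 1 \<or> je = Var ''j'' \<and> vars s ''j'' = int j"

lemma index_expD:
  assumes "index_exp je s j"
  shows "exp_val je s = Some (int j)" "exp_time je = 0" "exp_weight je \<le> 2"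
  using assms by (auto simp: index_exp_def)

locale space_params =
  fixes N H l :: nat
  assumes adm: "admissible N H l"
begin

definition g where "g = H div l"
definition blocks where "blocks = N div l"
definition J where "J = (N + H - 1) div H"
definition R where "R = N + H"
definition V :: int where "V = int (100 * R ^ 3 + 100)"
definition len :: "string \<Rightarrow> nat" where
  "len = (\<lambda>_. 0)(''B0'' := H + 1, ''Hs'' := J + 1, ''init'' := J + 1, ''B'' := J * (2 * l))"
definition ent :: "string \<Rightarrow> int" where
  "ent = (\<lambda>_. 0)(''B0'' := int (log_bound R), ''Hs'' := V, ''init'' := 1, ''B'' := int (log_bound R))"

lemma pos: "N \<ge> 1" "H \<ge> 1" "l \<ge> 1"
  using adm by (auto simp: admissible_def)

lemma H_eq: "H = l * g"
  using adm by (auto simp: admissible_def g_def)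

lemma N_eq: "N = l * blocks"
  using adm by (auto simp: admissible_def blocks_def)

lemma H_square: "2 * l * N \<le> H ^ 2"
proof -
  have "sqrt (real (2 * l) * real N) \<le> real H" using adm by (simp add: admissible_def)
  then have "sqrt (real (2 * l) * real N) ^ 2 \<le> real H ^ 2"
    by (rule power_mono) (rule real_sqrt_ge_zero, simp)
  moreover have "sqrt (real (2 * l) * real N) ^ 2 = real (2 * l * N)"
    by (subst real_sqrt_pow2) simp_all
  ultimately have "real (2 * l * N) \<le> real (H ^ 2)" by (simp only: of_nat_power)
  then show ?thesis by (simp only: of_nat_le_iff)
qed

lemma g_ge: "g \<ge> 2"
proof (rule ccontr)
  assume "\<not> g \<ge> 2"
  then have "l * g \<le> l * 1" by (intro mult_left_mono) auto
  then have "H \<le> l * 1" using H_eq by linarith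
  then have "H * H \<le> l * l" by (intro mult_mono) auto
  moreover have "l * l \<le> l * N" using adm pos by (intro mult_left_mono dvd_imp_le) (auto simp: admissible_def)
  moreover have "1 * 1 \<le> l * N" using pos by (intro mult_mono) auto
  moreover have "2 * (l * N) \<le> H * H" using H_square by (simp add: power2_eq_square mult.assoc)
  ultimately show False by linarith
qed

lemma two_l_le: "2 * l \<le> H"
  using mult_left_mono[OF g_ge, of l] H_eq by linarith

lemma N_le_square: "N \<le> H ^ 2"
proof -
  have "1 * N \<le> 2 * l * N" using pos by (intro mult_right_mono) auto
  then have "N \<le> 2 * l * N" by (simp only: mult_1)
  then show ?thesis using H_square by (rule le_trans)
qed

lemma square_le_H: "a * a \<le> N \<Longrightarrow> a \<le> H"
proof -
  assume "a * a \<le> N"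
  then have "a ^ 2 \<le> H ^ 2" using N_le_square by (simp add: power2_eq_square)
  then show "a \<le> H" by (rule power_mono_iff[THEN iffD1, rotated -1]) (use pos in auto)
qed

lemma kMax_less_l: "2 \<le> n \<Longrightarrow> n \<le> N \<Longrightarrow> kMax n < l"
  using adm by (auto simp: admissible_def)

lemma R_le: "N \<le> R" "H \<le> R" "1 \<le> R" "R \<le> R ^ 2" "R ^ 2 \<le> R ^ 3" "R \<le> R ^ 3"
proof -
  show R: "N \<le> R" "H \<le> R" "1 \<le> R" using pos by (auto simp: R_def)
  show "R \<le> R ^ 2" "R ^ 2 \<le> R ^ 3" "R \<le> R ^ 3"
    by (rule self_le_power[OF R(3)], simp) (rule power_increasing[OF _ R(3)], simp,
      rule self_le_power[OF R(3)], simp)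
qed

lemma le_V: "x \<le> 100 * R ^ 3 + 100 \<Longrightarrow> int x \<le> V"
  unfolding V_def by (rule of_nat_mono)

lemma le_V_linear: "x \<le> 10 * R + 10 \<Longrightarrow> int x < V"
  using le_V[of "x + 1"] R_le by linarith

lemma cubes: "N ^ 3 \<le> R ^ 3" "H ^ 3 \<le> R ^ 3" "N ^ 2 \<le> R ^ 2"
  using R_le by (auto intro: power_mono)

lemma log_bound_R: "int (log_bound R) \<le> V"
  using log_bound_le[of R] R_le by (intro le_V) auto

sublocale bounded_machine space_improved V len ent
proof
  show "10 \<le> V" using le_V[of 10] by simp
  show "0 \<le> ent A" for A using le_V[of 0] by (auto simp: ent_def)
  show "ent A \<le> V" for A using log_bound_R le_V[of 1] by (auto simp: ent_def)
qed

lemma J_ge: "J \<ge> 1"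
  using pos by (simp add: J_def Suc_le_eq div_greater_zero_iff)

lemma J_le: "J \<le> N"
proof -
  have "N + H - 1 < (N + 1) * H"
  proof -
    have "N * 1 \<le> N * H" using pos by (intro mult_left_mono) auto
    moreover have "(N + 1) * H = N * H + H" by simp
    ultimately show ?thesis using pos by linarith
  qed
  then show ?thesis unfolding J_def using less_mult_imp_div_less[of "N + H - 1" "N + 1" H] by simp
qed

definition env :: "state \<Rightarrow> bool" where
  "env s \<longleftrightarrow> vars s ''N'' = int N \<and> vars s ''H'' = int H \<and> vars s ''l'' = int l \<and>
     vars s ''L'' = int (2 * l) \<and> vars s ''U'' = int (log_bound N) \<and>
     length (arrs s ''B0'') = H + 1 \<and> (\<forall>n\<in>{1..H}. arrs s ''B0'' ! n = int (complexity n)) \<and>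
     length (arrs s ''Hs'') = J + 1 \<and> length (arrs s ''init'') = J + 1 \<and>
     length (arrs s ''B'') = J * (2 * l)"

text \<open>Blocks are addressed by \<open>m = H\<^sub>j / l\<close>; the upper half consists of the entries a shift makes new.\<close>

definition window :: "nat \<Rightarrow> nat \<Rightarrow> bool" where
  "window m n \<longleftrightarrow> l * m < n + 2 * l \<and> n \<le> l * m"

definition upper :: "nat \<Rightarrow> nat \<Rightarrow> bool" where
  "upper m n \<longleftrightarrow> l * m < n + l \<and> n \<le> l * m"

definition idx :: "nat \<Rightarrow> nat \<Rightarrow> nat \<Rightarrow> nat" where
  "idx j m n = (j - 1) * (2 * l) + (n + 2 * l - l * m - 1)"

definition holds :: "int list \<Rightarrow> nat \<Rightarrow> nat \<Rightarrow> bool" where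
  "holds xs j m \<longleftrightarrow> (\<forall>n. window m n \<longrightarrow> xs ! idx j m n = int (complexity n))"

lemma upper_window: "upper m n \<Longrightarrow> window m n"
  by (auto simp: upper_def window_def)

lemma window_pos: "window m n \<Longrightarrow> 2 \<le> m \<Longrightarrow> 1 \<le> n"
  using mult_le_mono2[of 2 m l] unfolding window_def by linarith

lemma idx_div: "window m n \<Longrightarrow> idx j m n div (2 * l) = j - 1"
  using pos unfolding idx_def window_def
  by (subst div_mult_self3) (auto intro: div_less)

lemma idx_less:
  assumes "window m n" "1 \<le> j" "j \<le> J"
  shows "idx j m n < J * (2 * l)"
proof -
  have "idx j m n div (2 * l) < J" using idx_div[OF assms(1), of j] assms by simp
  then show ?thesis using pos by (simp add: div_less_iff_less_mult)
qed

lemma idx_inj: "window m n \<Longrightarrow> window m n' \<Longrightarrow> idx j m n = idx j m n' \<longleftrightarrow> n = n'"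
  by (auto simp: idx_def window_def)

lemma slot_val:
  assumes "exp_val je s = Some (int j)" "exp_val ne s = Some (int n)" "vars s ''L'' = int (2 * l)"
    "j < length (arrs s ''Hs'')" "arrs s ''Hs'' ! j = int (l * m)" "1 \<le> j" "window m n"
  shows "exp_val (slot je ne) s = Some (int (idx j m n))"
proof -
  have "int (n + 2 * l - l * m - 1) = int n - (int (l * m) - int (2 * l)) - 1"
    using assms(7) unfolding window_def by linarith
  moreover have "int ((j - 1) * (2 * l)) = (int j - 1) * int (2 * l)"
    using assms(6) by (simp add: of_nat_diff)
  ultimately have "int (idx j m n) = (int j - 1) * int (2 * l) + (int n - (int (l * m) - int (2 * l)) - 1)"
    unfolding idx_def by simp
  then show ?thesis using assms by (simp add: slot_def base_def)
qed

lemma slot_weight: "exp_weight (slot je ne) = 2 * exp_weight je + exp_weight ne + 13"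
  by (simp add: slot_def base_def)

lemma slot_time: "exp_time (slot je ne) = 2 * exp_time je + exp_time ne + 7"
  by (simp add: slot_def base_def)

lemma initialize:
  assumes s: "ok s" "env s" "index_exp je s j" "1 \<le> j" "j \<le> J"
  shows "executes (initialize je) s (30 * l + 30) (\<lambda>s'. env s' \<and>
     arrs s' ''Hs'' = (arrs s ''Hs'')[j := int H] \<and> arrs s' ''init'' = (arrs s ''init'')[j := 1] \<and>
     (\<forall>k. k div (2 * l) \<noteq> j - 1 \<longrightarrow> arrs s' ''B'' ! k = arrs s ''B'' ! k) \<and> holds (arrs s' ''B'') j g)"
proof -
  let ?w = "Write ''B'' (slot je (Var ''i'')) (Read ''B0'' (Var ''i''))"
  let ?I = "\<lambda>i s'. env s' \<and> index_exp je s' j \<and> arrs s' ''Hs'' = (arrs s ''Hs'')[j := int H] \<and>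
     arrs s' ''init'' = arrs s ''init'' \<and>
     (\<forall>k. k div (2 * l) \<noteq> j - 1 \<longrightarrow> arrs s' ''B'' ! k = arrs s ''B'' ! k) \<and>
     (\<forall>n. window g n \<and> n + 2 * l < H + 1 + i \<longrightarrow> arrs s' ''B'' ! idx j g n = int (complexity n))"
  have lH: "2 * l \<le> H" by (rule two_l_le)
  have loop: "executes (FOR ''i'' FROM Var ''H'' \<^bold>- Var ''L'' \<^bold>+ Const 1 TO Var ''H'' DO ?w) s1
    (2 + (\<Sum>i<2 * l. 9 + 0 + 4) + 0 + 3) (?I (2 * l))" if s1: "ok s1" "?I 0 s1" for s1
  proof (rule executes_le, rule executes_For[OF s1(1), where n = "2 * l" and a = "int (H - 2 * l + 1)" and h = "int H"
        and \<tau> = "\<lambda>_. 9" and I = ?I])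
    show "\<bar>int (H - 2 * l + 1)\<bar> \<le> V" "\<bar>int H\<bar> < V"
      using le_V_linear[of "H - 2 * l + 1"] le_V_linear[of H] R_le by auto
    show "executes ?w s' 9 (?I (Suc i))"
      if i: "i < 2 * l" "ok s'" "?I i s'" "vars s' ''i'' = int (H - 2 * l + 1) + int i" for i s'
    proof -
      define n where "n = H - 2 * l + 1 + i"
      have n: "window g n" "vars s' ''i'' = int n" "1 \<le> n" "n \<le> H" "n + 2 * l = H + 1 + i"
        using i lH by (auto simp: n_def window_def H_eq[symmetric])
      have b: "idx j g n < length (arrs s' ''B'')"
        using idx_less[OF n(1) s(4,5)] i(3) by (simp add: env_def)
      have r: "arrs s' ''B0'' ! n = int (complexity n)" using i(3) n by (simp add: env_def)
      have e: "complexity n \<le> log_bound R"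
        using complexity_le_log_bound[of n R] n R_le by simp
      have "executes ?w s' (exp_time (slot je (Var ''i'')) + exp_time (Read ''B0'' (Var ''i'')) + 1) (?I (Suc i))"
      proof (rule executes_Write[OF i(2)])
        show "exp_val (slot je (Var ''i'')) s' = Some (int (idx j g n))"
          by (rule slot_val) (use i n s index_expD[of je s' j] in \<open>auto simp: env_def H_eq[symmetric]\<close>)
        show "exp_val (Read ''B0'' (Var ''i'')) s' = Some (int (complexity n))"
          using i(3) n r by (simp add: env_def)
        show "\<bar>int (complexity n)\<bar> \<le> ent ''B''" using e by (simp add: ent_def)
        let ?s = "s'\<lparr>arrs := (arrs s')(''B'' := (arrs s' ''B'')[nat (int (idx j g n)) := int (complexity n)])\<rparr>"
        have "arrs ?s ''B'' ! k = arrs s' ''B'' ! k" if "k div (2 * l) \<noteq> j - 1" for k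
          using that idx_div[OF n(1), of j] by (cases "k = idx j g n") auto
        moreover have "arrs ?s ''B'' ! idx j g n' = int (complexity n')"
          if "window g n'" "n' + 2 * l < H + 1 + Suc i" for n'
        proof (cases "n' = n")
          case True
          then show ?thesis using b by simp
        next
          case False
          then have "n' + 2 * l < H + 1 + i" using that(2) n(5) by linarith
          then show ?thesis using that(1) False n(1) i(3) by (simp add: idx_inj)
        qed
        ultimately show "?I (Suc i) ?s" using i(3) s(2) by (simp add: env_def index_exp_def)
      qed (use b index_expD[of je s' j] i(3) in \<open>auto simp: slot_weight\<close>)
      then show ?thesis
        by (rule executes_le) (use index_expD[of je s' j] i(3) in \<open>simp add: slot_time\<close>)
    qed
  qed (use s1 lH in \<open>auto simp: env_def index_exp_def\<close>)
  have jl: "j < J + 1" using s by simp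
  show ?thesis
    unfolding initialize_def
    apply (rule executes_le)
     apply (rule executes_Seq, rule executes_Seq, rule executes_Write[OF s(1), where k = "int j" and v = "int H"])
            apply (rule index_expD(1)[OF s(3)])
           apply simp
    subgoal using s jl by (simp add: env_def)
         apply (use s in \<open>simp add: env_def\<close>)
        apply (use index_expD(3)[OF s(3)] in simp)
       apply simp
    subgoal using le_V_linear[of H] R_le by (simp add: ent_def)
     apply (rule executes_conseq[OF loop le_refl], assumption)
    subgoal using s lH by (auto simp: env_def index_exp_def window_def H_eq[symmetric])
     apply (rule executes_Write[where k = "int j" and v = 1], assumption)
            apply (rule index_expD(1), blast)
           apply simp
    subgoal using jl s(2) by (simp add: env_def)
         apply simp
        apply (use index_expD(3)[OF s(3)] in simp)
       apply simp
      apply (simp add: ent_def)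
    subgoal by (auto simp: env_def holds_def window_def H_eq[symmetric])
    using index_expD(2)[OF s(3)] by simp
qed

lemma shift:
  assumes s: "ok s" "env s" "vars s ''j'' = int j" "1 \<le> j" "j \<le> J"
    and m: "arrs s ''Hs'' ! j = int (l * m)" "l * Suc m \<le> N" "holds (arrs s ''B'') j m" "2 \<le> m"
  shows "executes (shift (Var ''j'')) s (40 * l + 30) (\<lambda>s'. env s' \<and>
     arrs s' ''Hs'' = (arrs s ''Hs'')[j := int (l * Suc m)] \<and>
     (\<forall>k. k div (2 * l) \<noteq> j - 1 \<longrightarrow> arrs s' ''B'' ! k = arrs s ''B'' ! k) \<and>
     (\<forall>n. window (Suc m) n \<and> \<not> upper (Suc m) n \<longrightarrow> arrs s' ''B'' ! idx j (Suc m) n = int (complexity n)) \<and>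
     (\<forall>n. upper (Suc m) n \<longrightarrow> arrs s' ''B'' ! idx j (Suc m) n = int (log_bound N)))"
proof -
  define o0 where "o0 = (j - 1) * (2 * l)"
  have lJ: "o0 + 2 * l \<le> J * (2 * l)"
  proof -
    have "o0 + 2 * l = j * (2 * l)" using s by (cases j) (auto simp: o0_def)
    then show ?thesis using s by simp
  qed
  have divo: "(o0 + i) div (2 * l) = j - 1" if "i < 2 * l" for i
    using that pos unfolding o0_def by (subst div_mult_self3) auto
  let ?frame = "\<lambda>s'. env s' \<and> vars s' ''j'' = int j \<and> arrs s' ''Hs'' = (arrs s ''Hs'')[j := int (l * Suc m)] \<and>
     (\<forall>k. k div (2 * l) \<noteq> j - 1 \<longrightarrow> arrs s' ''B'' ! k = arrs s ''B'' ! k)"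
  let ?I1 = "\<lambda>i s'. ?frame s' \<and> (\<forall>k<i. arrs s' ''B'' ! (o0 + k) = arrs s ''B'' ! (o0 + l + k)) \<and>
     (\<forall>k. i \<le> k \<and> k < 2 * l \<longrightarrow> arrs s' ''B'' ! (o0 + k) = arrs s ''B'' ! (o0 + k))"
  let ?I2 = "\<lambda>i s'. ?frame s' \<and> (\<forall>k<l. arrs s' ''B'' ! (o0 + k) = arrs s ''B'' ! (o0 + l + k)) \<and>
     (\<forall>k. l \<le> k \<and> k < l + i \<longrightarrow> arrs s' ''B'' ! (o0 + k) = int (log_bound N))"
  let ?w1 = "Write ''B'' (base (Var ''j'') \<^bold>+ Var ''i'') (Read ''B'' (base (Var ''j'') \<^bold>+ Var ''l'' \<^bold>+ Var ''i''))"
  let ?w2 = "Write ''B'' (base (Var ''j'') \<^bold>+ Var ''i'') (Var ''U'')"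
  have base: "exp_val (base (Var ''j'')) s' = Some (int o0)" if "?frame s'" for s'
    using that s by (simp add: base_def env_def o0_def of_nat_diff)
  have loop1: "executes (FOR ''i'' FROM Const 0 TO Var ''l'' \<^bold>- Const 1 DO ?w1) s1
    (0 + (\<Sum>i<l. 9 + 1 + 4) + 1 + 3) (?I1 l)" if s1: "ok s1" "?I1 0 s1" for s1
  proof (rule executes_le, rule executes_For[OF s1(1), where n = l and a = 0 and h = "int l - 1"
        and \<tau> = "\<lambda>_. 9" and I = ?I1])
    show "\<bar>int l - 1\<bar> < V" using le_V_linear[of l] R_le two_l_le pos by auto
    show "executes ?w1 s' 9 (?I1 (Suc i))"
      if i: "i < l" "ok s'" "?I1 i s'" "vars s' ''i'' = 0 + int i" for i s'
    proof (rule executes_le, rule executes_Write[OF i(2)])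
      have b: "exp_val (base (Var ''j'')) s' = Some (int o0)" using base i by blast
      show "exp_val (base (Var ''j'') \<^bold>+ Var ''i'') s' = Some (int (o0 + i))" using b i by simp
      have e: "nat (int o0 + int l + int i) = o0 + l + i" by linarith
      have "arrs s' ''B'' ! (o0 + (l + i)) = arrs s ''B'' ! (o0 + (l + i))" using i by auto
      then have rd: "arrs s' ''B'' ! (o0 + l + i) = arrs s ''B'' ! (o0 + l + i)" by (simp add: add.assoc)
      have "length (arrs s' ''B'') = J * (2 * l)" using i(3) by (simp add: env_def)
      then have bound: "o0 + l + i < length (arrs s' ''B'')" using i(1) lJ by linarith
      show v: "exp_val (Read ''B'' (base (Var ''j'') \<^bold>+ Var ''l'' \<^bold>+ Var ''i'')) s' = Some (arrs s ''B'' ! (o0 + l + i))"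
      proof -
        have "int o0 + int l + int i < int (length (arrs s' ''B''))" using bound by linarith
        then show ?thesis using b i(3,4) e rd by (simp add: env_def)
      qed
      show "\<bar>arrs s ''B'' ! (o0 + l + i)\<bar> \<le> ent ''B''" using ok_entry[OF i(2)] rd bound by metis
      show "int (o0 + i) < int (length (arrs s' ''B''))" using bound by linarith
      let ?s = "s'\<lparr>arrs := (arrs s')(''B'' := (arrs s' ''B'')[o0 + i := arrs s ''B'' ! (o0 + l + i)])\<rparr>"
      have "arrs ?s ''B'' ! k = arrs s' ''B'' ! k" if "k div (2 * l) \<noteq> j - 1" for k
        using that divo[of i] i(1) by (cases "k = o0 + i") auto
      moreover have "arrs ?s ''B'' ! (o0 + k) = arrs s ''B'' ! (o0 + l + k)" if "k < Suc i" for k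
        using that i lJ by (cases "k = i") (auto simp: env_def)
      moreover have "arrs ?s ''B'' ! (o0 + k) = arrs s ''B'' ! (o0 + k)" if "Suc i \<le> k" "k < 2 * l" for k
        using that i by auto
      ultimately have "?I1 (Suc i) ?s" using i(3) s(2) by (simp add: env_def)
      then show "?I1 (Suc i) (s'\<lparr>arrs := (arrs s')(''B'' := (arrs s' ''B'')[nat (int (o0 + i)) := arrs s ''B'' ! (o0 + l + i)])\<rparr>)"
        unfolding nat_int .
    qed (auto simp: base_def)
  qed (use s1 V_ge in \<open>auto simp: env_def\<close>)
  have loop2: "executes (FOR ''i'' FROM Var ''l'' TO Var ''L'' \<^bold>- Const 1 DO ?w2) s1
    (0 + (\<Sum>i<l. 9 + 1 + 4) + 1 + 3) (?I2 l)" if s1: "ok s1" "?I2 0 s1" for s1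
  proof (rule executes_le, rule executes_For[OF s1(1), where n = l and a = "int l" and h = "2 * int l - 1"
        and \<tau> = "\<lambda>_. 9" and I = ?I2])
    show "\<bar>int l\<bar> \<le> V" "\<bar>2 * int l - 1\<bar> < V" using le_V_linear[of "2 * l"] R_le two_l_le pos by auto
    show "executes ?w2 s' 9 (?I2 (Suc i))"
      if i: "i < l" "ok s'" "?I2 i s'" "vars s' ''i'' = int l + int i" for i s'
    proof (rule executes_le, rule executes_Write[OF i(2)])
      have b: "exp_val (base (Var ''j'')) s' = Some (int o0)" using base i by blast
      show "exp_val (base (Var ''j'') \<^bold>+ Var ''i'') s' = Some (int (o0 + (l + i)))" using b i by simp
      show "exp_val (Var ''U'') s' = Some (int (log_bound N))" using i by (simp add: env_def)
      show "\<bar>int (log_bound N)\<bar> \<le> ent ''B''" using log_bound_mono[of N R] R_le by (simp add: ent_def)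
      have "length (arrs s' ''B'') = J * (2 * l)" using i(3) by (simp add: env_def)
      then show "int (o0 + (l + i)) < int (length (arrs s' ''B''))" using i(1) lJ by linarith
      let ?s = "s'\<lparr>arrs := (arrs s')(''B'' := (arrs s' ''B'')[o0 + (l + i) := int (log_bound N)])\<rparr>"
      have "arrs ?s ''B'' ! k = arrs s' ''B'' ! k" if "k div (2 * l) \<noteq> j - 1" for k
        using that divo[of "l + i"] i(1) by (cases "k = o0 + (l + i)") auto
      moreover have "arrs ?s ''B'' ! (o0 + k) = arrs s ''B'' ! (o0 + l + k)" if "k < l" for k
        using that i by auto
      moreover have "arrs ?s ''B'' ! (o0 + k) = int (log_bound N)" if "l \<le> k" "k < l + Suc i" for k
        using that i lJ by (cases "k = l + i") (auto simp: env_def)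
      ultimately have "?I2 (Suc i) ?s" using i(3) s(2) by (simp add: env_def)
      then show "?I2 (Suc i) (s'\<lparr>arrs := (arrs s')(''B'' := (arrs s' ''B'')[nat (int (o0 + (l + i))) := int (log_bound N)])\<rparr>)"
        unfolding nat_int .
    qed (auto simp: base_def)
  qed (use s1 in \<open>auto simp: env_def\<close>)
  have post: "env s' \<and> arrs s' ''Hs'' = (arrs s ''Hs'')[j := int (l * Suc m)] \<and>
     (\<forall>k. k div (2 * l) \<noteq> j - 1 \<longrightarrow> arrs s' ''B'' ! k = arrs s ''B'' ! k) \<and>
     (\<forall>n. window (Suc m) n \<and> \<not> upper (Suc m) n \<longrightarrow> arrs s' ''B'' ! idx j (Suc m) n = int (complexity n)) \<and>
     (\<forall>n. upper (Suc m) n \<longrightarrow> arrs s' ''B'' ! idx j (Suc m) n = int (log_bound N))" if "?I2 l s'" for s'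
  proof -
    have A: "arrs s' ''B'' ! idx j (Suc m) n = int (complexity n)" if n: "window (Suc m) n" "\<not> upper (Suc m) n" for n
    proof -
      define k where "k = n + 2 * l - l * Suc m - 1"
      have k: "k < l" "idx j (Suc m) n = o0 + k" "idx j m n = o0 + l + k" "window m n"
        using n by (auto simp: k_def idx_def o0_def window_def upper_def)
      have "arrs s ''B'' ! idx j m n = int (complexity n)" using m(3) k(4) by (simp add: holds_def)
      moreover have "arrs s' ''B'' ! (o0 + k) = arrs s ''B'' ! (o0 + l + k)" using \<open>?I2 l s'\<close> k(1) by blast
      ultimately show ?thesis unfolding k(2,3) by simp
    qed
    have B: "arrs s' ''B'' ! idx j (Suc m) n = int (log_bound N)" if n: "upper (Suc m) n" for n
    proof -
      define k where "k = n + 2 * l - l * Suc m - 1"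
      have "l \<le> k" "k < l + l" "idx j (Suc m) n = o0 + k"
        using n by (auto simp: k_def idx_def o0_def upper_def)
      then show ?thesis using \<open>?I2 l s'\<close> by simp
    qed
    show ?thesis
      using that A B by (intro conjI allI impI; elim conjE; assumption?) simp_all
  qed
  have jl: "j < length (arrs s ''Hs'')" using s by (simp add: env_def)
  have SV: "\<bar>int (l * Suc m)\<bar> \<le> V" using le_V_linear[of "l * Suc m"] m R_le by linarith
  show ?thesis
    unfolding shift_def
    apply (rule executes_le)
     apply (rule executes_Seq, rule executes_Seq, rule executes_Write[OF s(1), where k = "int j" and v = "int (l * Suc m)"])
            apply (use s in simp)
           apply simp
    subgoal using jl by simp
    subgoal using s(2,3) jl m(1) by (simp add: env_def algebra_simps)
        apply simp
       apply simp
    subgoal using SV by (simp add: ent_def)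
     apply (rule executes_conseq[OF loop1 le_refl], assumption)
    subgoal using s by (simp add: env_def)
     apply (rule executes_conseq[OF loop2 le_refl], assumption)
    subgoal by simp
    subgoal by (rule post)
    by simp
qed

end


context space_params
begin

text \<open>
  \<open>xs0\<close> is the array before the products are entered; \<open>A\<close> and \<open>B\<close> are the current values of the
  loop variables, and the pairs before them in lexicographic order are done.
\<close>

definition product_inv :: "int list \<Rightarrow> nat \<Rightarrow> nat \<Rightarrow> nat \<Rightarrow> nat \<Rightarrow> int list \<Rightarrow> bool" where
  "product_inv xs0 j m A B xs \<longleftrightarrow> length xs = length xs0 \<and>
     (\<forall>k. (\<forall>n. upper m n \<longrightarrow> k \<noteq> idx j m n) \<longrightarrow> xs ! k = xs0 ! k) \<and>
     (\<forall>n. upper m n \<longrightarrow> int (complexity n) \<le> xs ! idx j m n) \<and>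
     (\<forall>a b. 2 \<le> a \<and> a \<le> b \<and> upper m (a * b) \<and> (a < A \<or> a = A \<and> b < B) \<longrightarrow>
        xs ! idx j m (a * b) \<le> int (complexity a + complexity b))"

lemma product_inv_step:
  assumes inv: "product_inv xs0 j m a b xs" and ab: "2 \<le> a" "a \<le> b" "upper m (a * b)"
    and j: "1 \<le> j" "j \<le> J" "length xs0 = J * (2 * l)"
  shows "product_inv xs0 j m a (Suc b)
    (xs[idx j m (a * b) := min (int (complexity a) + int (complexity b)) (xs ! idx j m (a * b))])"
    (is "product_inv _ _ _ _ _ ?ys")
proof -
  have w: "window m (a * b)" using ab(3) by (rule upper_window)
  have len: "idx j m (a * b) < length xs" using idx_less[OF w j(1,2)] inv j(3) by (simp add: product_inv_def)
  have le: "?ys ! idx j m n \<le> xs ! idx j m n" if "upper m n" for n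
    using idx_less[OF upper_window[OF that] j(1,2)] inv j(3)
    by (intro list_lower_le) (simp add: product_inv_def)
  have cab: "complexity (a * b) \<le> complexity a + complexity b" using ab by (intro complexity_mult) auto
  show ?thesis
    unfolding product_inv_def
  proof (intro conjI allI impI)
    show "length ?ys = length xs0" using inv by (simp add: product_inv_def)
    show "?ys ! k = xs0 ! k" if "\<forall>n. upper m n \<longrightarrow> k \<noteq> idx j m n" for k
    proof -
      have "k \<noteq> idx j m (a * b)" using that ab(3) by blast
      then have "?ys ! k = xs ! k" by simp
      also have "\<dots> = xs0 ! k" using inv that unfolding product_inv_def by blast
      finally show ?thesis .
    qed
    show "int (complexity n) \<le> ?ys ! idx j m n" if "upper m n" for n
    proof (cases "n = a * b")
      case True
      then show ?thesis using len cab inv that by (simp add: product_inv_def)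
    next
      case False
      then show ?thesis using inv that idx_inj[OF w upper_window[OF that]] by (simp add: product_inv_def)
    qed
    show "?ys ! idx j m (a' * b') \<le> int (complexity a' + complexity b')"
      if *: "2 \<le> a' \<and> a' \<le> b' \<and> upper m (a' * b') \<and> (a' < a \<or> a' = a \<and> b' < Suc b)" for a' b'
    proof (cases "a' = a \<and> b' = b")
      case True
      then show ?thesis using len by simp
    next
      case False
      then have "a' < a \<or> a' = a \<and> b' < b" using * by auto
      then have "xs ! idx j m (a' * b') \<le> int (complexity a' + complexity b')"
        using inv * by (simp add: product_inv_def)
      then show ?thesis using le[of "a' * b'"] * by (meson order_trans)
    qed
  qed
qed

lemma product_inv_next:
  assumes "product_inv xs0 j m a b xs" "l * m < a * b"
  shows "product_inv xs0 j m (Suc a) 0 xs"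
proof -
  have "b' < b" if "upper m (a * b')" for b'
  proof -
    have "a * b' < a * b" using that assms(2) unfolding upper_def by linarith
    then show ?thesis by simp
  qed
  then show ?thesis using assms(1) unfolding product_inv_def by (auto simp: less_Suc_eq)
qed

lemma product_inv_skip:
  assumes "product_inv xs0 j m a 0 xs" "\<And>b'. a \<le> b' \<Longrightarrow> b' < b \<Longrightarrow> \<not> upper m (a * b')"
  shows "product_inv xs0 j m a b xs"
  using assms unfolding product_inv_def by blast

definition pairs_readable :: "int list \<Rightarrow> int list \<Rightarrow> nat \<Rightarrow> nat \<Rightarrow> bool" where
  "pairs_readable hs xs j m \<longleftrightarrow> (\<forall>a b. 2 \<le> a \<and> upper m (a * b) \<and> H < l * m div a \<longrightarrow>
     a * j \<le> J \<and> (\<exists>m'. hs ! (a * j) = int (l * m') \<and> window m' b \<and>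
       xs ! idx (a * j) m' b = int (complexity b)))"

lemma product_row:
  assumes s: "ok s" "env s" "vars s ''j'' = int j" "arrs s ''Hs'' = hs" "1 \<le> j" "j \<le> J"
    and m: "hs ! j = int (l * m)" "l * m \<le> N" "2 \<le> m"
    and xs0: "length xs0 = J * (2 * l)" "pairs_readable hs xs0 j m"
    and a: "vars s ''a'' = int a" "2 \<le> a" "a * a \<le> l * m"
    and inv: "product_inv xs0 j m a 0 (arrs s ''B'')"
  shows "executes
      (''b'' ::= (Read ''Hs'' (Var ''j'') \<^bold>- Var ''l'') \<^bold>/ Var ''a'' \<^bold>+ Const 1;;
        (IF Var ''b'' \<^bold>< Var ''a'' THEN ''b'' ::= Var ''a'' ELSE Skip);;
        WHILE Var ''a'' \<^bold>* Var ''b'' \<^bold>\<le> Read ''Hs'' (Var ''j'') DO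
          ((IF Read ''Hs'' (Var ''j'') \<^bold>/ Var ''a'' \<^bold>\<le> Var ''H''
            THEN ''c'' ::= Read ''B0'' (Var ''b'')
            ELSE ''c'' ::= Read ''B'' (slot (Var ''a'' \<^bold>* Var ''j'') (Var ''b'')));;
           lower_to ''B'' (slot (Var ''j'') (Var ''a'' \<^bold>* Var ''b''))
             (Read ''B0'' (Var ''a'') \<^bold>+ Var ''c'');;
           ''b'' ::= Var ''b'' \<^bold>+ Const 1)) s (45 * (l div a + 1) + 12)
      (\<lambda>s'. env s' \<and> vars s' ''j'' = int j \<and> arrs s' ''Hs'' = hs \<and> vars s' ''a'' = int a \<and>
         product_inv xs0 j m (Suc a) 0 (arrs s' ''B''))"
    (is "executes (?S1;; ?S2;; WHILE ?test DO (?C;; ?D;; ?F)) _ _ _")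
proof -
  define b0 where "b0 = max a ((l * m - l) div a + 1)"
  define n where "n = l * m div a + 1 - b0"
  have lm: "l \<le> l * m" using m(3) by simp
  have aH: "a \<le> H" using square_le_H[of a] a m by simp
  have divN: "l * m div a \<le> N" using m(2) div_le_dividend le_trans by blast
  have start: "\<not> upper m (a * b')" if "a \<le> b'" "b' < b0" for b'
  proof -
    have "b' \<le> (l * m - l) div a" using that unfolding b0_def by auto
    then have "b' * a \<le> l * m - l" using a by (simp add: less_eq_div_iff_mult_less_eq)
    then have "a * b' \<le> l * m - l" by (simp only: mult.commute)
    then have "a * b' + l \<le> l * m" using lm by linarith
    then show ?thesis by (simp add: upper_def)
  qed
  have n_le: "n \<le> l div a + 1"
  proof -
    have "(l * m - l) div a * a + l div a * a + 2 * a > l * m"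
    proof -
      have "l * m - l < (l * m - l) div a * a + a" using a(2)
        by (metis add.commute dividend_less_times_div mult.commute not_numeral_le_zero zero_less_iff_neq_zero)
      moreover have "l < l div a * a + a" using a(2)
        by (metis add.commute dividend_less_times_div mult.commute not_numeral_le_zero zero_less_iff_neq_zero)
      ultimately show ?thesis using lm by linarith
    qed
    then have "l * m < ((l * m - l) div a + l div a + 2) * a" by (simp add: algebra_simps)
    then have "l * m div a < (l * m - l) div a + l div a + 2" using less_mult_imp_div_less by blast
    then show ?thesis unfolding n_def b0_def by linarith
  qed
  let ?Q = "\<lambda>b s'. env s' \<and> vars s' ''j'' = int j \<and> arrs s' ''Hs'' = hs \<and> vars s' ''a'' = int a \<and>
     product_inv xs0 j m a b (arrs s' ''B'')"
  let ?I = "\<lambda>i s'. ?Q (b0 + i) s' \<and> vars s' ''b'' = int (b0 + i)"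
  have lhs: "length hs = J + 1" using s by (auto simp: env_def)
  have aj: "j < length hs" using s by (simp add: env_def)
  have ltn: "a * (b0 + i) \<le> l * m \<longleftrightarrow> i < n" for i
  proof -
    have "a * (b0 + i) \<le> l * m \<longleftrightarrow> b0 + i \<le> l * m div a"
      using a(2) by (simp add: less_eq_div_iff_mult_less_eq mult.commute)
    then show ?thesis unfolding n_def by linarith
  qed
  have loop: "executes (WHILE ?test DO (?C;; ?D;; ?F)) s1 ((\<Sum>i<n. 41 + exp_time ?test + 1) + exp_time ?test + 1) (?I n)"
    if s1: "ok s1" "?I 0 s1" for s1
  proof (rule executes_While[where I = ?I])
    show "exp_val ?test s' = Some (of_bool (i < n))" if "i \<le> n" "ok s'" "?I i s'" for i s'
    proof -
      have "int a * int (b0 + i) \<le> int (l * m) \<longleftrightarrow> i < n"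
        using ltn[of i] by (simp only: of_nat_mult[symmetric] of_nat_le_iff)
      then show ?thesis using that m(1) aj s(5) by (simp del: of_nat_add of_nat_mult)
    qed
    show "executes (?C;; ?D;; ?F) s' 41 (?I (Suc i))" if i: "i < n" "ok s'" "?I i s'" for i s'
    proof -
      define b where "b = b0 + i"
      have ab: "a \<le> b" "a * b \<le> l * m" using ltn[of i] i(1) by (auto simp: b_def b0_def)
      have "(l * m - l) div a < b" by (auto simp: b_def b0_def)
      then have "l * m - l < b * a" using a(2) by (simp add: div_less_iff_less_mult)
      then have up: "upper m (a * b)" using ab(2) by (simp add: upper_def mult.commute)
      have bdiv: "b \<le> l * m div a" using ab(2) a(2) by (simp add: less_eq_div_iff_mult_less_eq mult.commute)
      then have bN: "b \<le> N" using divN by simp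
      have q: "?Q b s'" "vars s' ''b'' = int b" using i(3) by (simp_all add: b_def)
      have lB: "length (arrs s' ''B'') = J * (2 * l)" using q(1) by (simp add: env_def)
      have cV: "complexity b \<le> log_bound R" using complexity_le_log_bound[of b R] ab a bN R_le by simp
      have C: "executes ?C s' 15 (\<lambda>s. vars s ''c'' = int (complexity b))"
      proof (rule executes_le, rule executes_If[OF i(2)])
        show "exp_val (Read ''Hs'' (Var ''j'') \<^bold>/ Var ''a'' \<^bold>\<le> Var ''H'') s' = Some (of_bool (l * m div a \<le> H))"
          using q(1) m(1) aj a(2) by (simp add: env_def zdiv_int[symmetric] del: of_nat_mult)
        show "executes (''c'' ::= Read ''B0'' (Var ''b'')) s' (exp_time (Read ''B0'' (Var ''b'')) + 1)
           (\<lambda>s. vars s ''c'' = int (complexity b))" if "of_bool (l * m div a \<le> H) \<noteq> (0::int)"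
        proof -
          have "1 \<le> b" "b \<le> H" using that bdiv ab a by auto
          then show ?thesis
            by (intro executes_Assign[OF i(2), where v = "int (complexity b)"])
              (use q cV log_bound_R in \<open>auto simp: env_def\<close>)
        qed
        show "executes (''c'' ::= Read ''B'' (slot (Var ''a'' \<^bold>* Var ''j'') (Var ''b''))) s'
           (exp_time (Read ''B'' (slot (Var ''a'' \<^bold>* Var ''j'') (Var ''b''))) + 1)
           (\<lambda>s. vars s ''c'' = int (complexity b))" if "of_bool (l * m div a \<le> H) = (0::int)"
        proof -
          have "H < l * m div a" using that by (simp split: if_splits)
          then obtain m' where m': "a * j \<le> J" "hs ! (a * j) = int (l * m')" "window m' b"
            "xs0 ! idx (a * j) m' b = int (complexity b)"
            using xs0(2) a(2) up unfolding pairs_readable_def by blast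
          have "1 * j < a * j" using a(2) s(5) by (intro mult_strict_right_mono) auto
          then have aj': "1 \<le> a * j" "a * j - 1 \<noteq> j - 1" using s(5) by linarith+
          have "exp_val (slot (Var ''a'' \<^bold>* Var ''j'') (Var ''b'')) s' = Some (int (idx (a * j) m' b))"
            by (rule slot_val) (use q m' aj' s in \<open>auto simp: env_def\<close>)
          moreover have "idx (a * j) m' b < length (arrs s' ''B'')"
            using idx_less[OF m'(3) aj'(1) m'(1)] lB by simp
          moreover have "arrs s' ''B'' ! idx (a * j) m' b = xs0 ! idx (a * j) m' b"
          proof -
            have "idx (a * j) m' b \<noteq> idx j m n" if "upper m n" for n
              using idx_div[OF m'(3), of "a * j"] idx_div[OF upper_window[OF that], of j] aj'(2) by metis
            then show ?thesis using q(1) by (simp add: product_inv_def)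
          qed
          ultimately show ?thesis
            by (intro executes_Assign[OF i(2), where v = "int (complexity b)"])
              (use m' cV log_bound_R in \<open>auto simp: slot_weight\<close>)
        qed
      qed (auto simp: slot_time)
      have D: "executes ?D s1 24 (\<lambda>s. ?Q (Suc b) s \<and> vars s ''b'' = int b)"
        if s1: "ok s1" "?Q b s1" "vars s1 ''b'' = int b" "vars s1 ''c'' = int (complexity b)" for s1
      proof (rule executes_le, rule executes_lower_to[OF s1(1)])
        show "exp_val (slot (Var ''j'') (Var ''a'' \<^bold>* Var ''b'')) s1 = Some (int (idx j m (a * b)))"
          by (rule slot_val) (use s1 m aj s up in \<open>auto simp: env_def upper_window\<close>)
        show "int (idx j m (a * b)) < int (length (arrs s1 ''B''))"
        proof -
          have "length (arrs s1 ''B'') = J * (2 * l)" using s1(2) by (simp add: env_def)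
          then show ?thesis using idx_less[OF upper_window[OF up] s(5,6)] by (simp only: of_nat_less_iff)
        qed
        show "exp_val (Read ''B0'' (Var ''a'') \<^bold>+ Var ''c'') s1 = Some (int (complexity a) + int (complexity b))"
          using s1 aH a(2) by (simp add: env_def)
        show "?Q (Suc b) s2 \<and> vars s2 ''b'' = int b"
          if s2: "vars s2 = vars s1" "arrs s2 = (arrs s1)(''B'' := (arrs s1 ''B'')[nat (int (idx j m (a * b))) :=
            min (int (complexity a) + int (complexity b)) (arrs s1 ''B'' ! nat (int (idx j m (a * b))))])" for s2
          using s1(2,3) s2 product_inv_step[OF _ a(2) ab(1) up s(5,6) xs0(1), of "arrs s1 ''B''"]
          by (simp add: env_def lhs)
      qed (auto simp: slot_weight slot_time)
      have fr: "''j'' \<notin> assigned_vars ?C" "''a'' \<notin> assigned_vars ?C" "''b'' \<notin> assigned_vars ?C"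
        "''N'' \<notin> assigned_vars ?C" "''H'' \<notin> assigned_vars ?C" "''l'' \<notin> assigned_vars ?C"
        "''L'' \<notin> assigned_vars ?C" "''U'' \<notin> assigned_vars ?C" "assigned_arrs ?C = {}" by auto
      have CD: "executes (?C;; ?D) s' (15 + 24) (\<lambda>s. ?Q (Suc b) s \<and> vars s ''b'' = int b)"
      proof (rule executes_Seq'[OF C])
        fix s1 assume s1: "ok s1" "frame ?C s' s1" "vars s1 ''c'' = int (complexity b)"
        have "?Q b s1" "vars s1 ''b'' = int b"
          using q frame_var[OF s1(2)] frame_arr[OF s1(2)] fr by (simp_all add: env_def lhs)
        then show "executes ?D s1 24 (\<lambda>s. ?Q (Suc b) s \<and> vars s ''b'' = int b)"
          using D s1 by blast
      qed
      have "executes (?C;; ?D;; ?F) s' (15 + 24 + (exp_time (Var ''b'' \<^bold>+ Const 1) + 1)) (?I (Suc i))"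
      proof (rule executes_Seq'[OF CD])
        fix s1 assume s1: "ok s1" "?Q (Suc b) s1 \<and> vars s1 ''b'' = int b"
        have "\<bar>int b + 1\<bar> \<le> V" using le_V_linear[of "b + 1"] bN R_le by linarith
        then show "executes ?F s1 (exp_time (Var ''b'' \<^bold>+ Const 1) + 1) (?I (Suc i))"
          by (intro executes_Assign[OF s1(1)]) (use s1 in \<open>auto simp: env_def lhs b_def\<close>)
      qed
      then show ?thesis by (rule executes_le) simp
    qed
  qed (use s1 in auto)
  have S2: "executes ?S2 s1 3 (?I 0)"
    if s1: "ok s1" "?Q 0 s1" "vars s1 ''b'' = int ((l * m - l) div a + 1)" for s1
  proof (rule executes_le, rule executes_If[OF s1(1)])
    have Q: "?Q b0 s1" using s1(2) product_inv_skip[OF _ start] by blast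
    show "exp_val (Var ''b'' \<^bold>< Var ''a'') s1 = Some (of_bool ((l * m - l) div a + 1 < a))"
      using s1 by (simp del: of_nat_add add: of_nat_less_iff[symmetric])
    have "\<bar>int a\<bar> \<le> V" using le_V_linear[of a] aH R_le by linarith
    then show "executes (''b'' ::= Var ''a'') s1 (exp_time (Var ''a'') + 1) (?I 0)"
      if "of_bool ((l * m - l) div a + 1 < a) \<noteq> (0::int)"
      by (intro executes_Assign[OF s1(1)]) (use Q that in \<open>auto simp: env_def b0_def\<close>)
    show "executes Skip s1 1 (?I 0)" if "of_bool ((l * m - l) div a + 1 < a) = (0::int)"
      by (intro executes_Skip[OF s1(1)]) (use Q s1(3) that in \<open>auto simp: b0_def\<close>)
  qed auto
  have S1: "executes ?S1 s 5 (\<lambda>s1. ?Q 0 s1 \<and> vars s1 ''b'' = int ((l * m - l) div a + 1))"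
  proof (rule executes_le, rule executes_Assign[OF s(1)])
    have "int (l * m) - int l = int (l * m - l)" using lm by simp
    then show "exp_val ((Read ''Hs'' (Var ''j'') \<^bold>- Var ''l'') \<^bold>/ Var ''a'' \<^bold>+ Const 1) s
      = Some (int ((l * m - l) div a + 1))"
      using s a m(1) aj by (simp add: env_def zdiv_int del: of_nat_mult of_nat_diff)
    have "(l * m - l) div a \<le> N" using m(2) div_le_dividend[of "l * m - l" a] by linarith
    then show "\<bar>int ((l * m - l) div a + 1)\<bar> \<le> V"
      using le_V_linear[of "(l * m - l) div a + 1"] R_le by linarith
    let ?s = "s\<lparr>vars := (vars s)(''b'' := int ((l * m - l) div a + 1))\<rparr>"
    show "?Q 0 ?s \<and> vars ?s ''b'' = int ((l * m - l) div a + 1)"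
      using s a inv by (simp add: env_def lhs)
  qed auto
  have S12: "executes (?S1;; ?S2) s (5 + 3) (?I 0)"
    by (rule executes_Seq'[OF S1], rule S2) auto
  show ?thesis
  proof (rule executes_le, rule executes_Seq'[OF S12], rule executes_conseq[OF loop le_refl])
    fix s' assume I: "?I n s'"
    have "l * m < a * (b0 + n)" using ltn[of n] by linarith
    then show "env s' \<and> vars s' ''j'' = int j \<and> arrs s' ''Hs'' = hs \<and> vars s' ''a'' = int a \<and>
         product_inv xs0 j m (Suc a) 0 (arrs s' ''B'')"
      using I product_inv_next by blast
  qed (use n_le in auto)
qed

lemma product_step:
  assumes s: "ok s" "env s" "vars s ''j'' = int j" "arrs s ''Hs'' = hs" "1 \<le> j" "j \<le> J"
    and m: "hs ! j = int (l * m)" "l * m \<le> N" "2 \<le> m"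
    and rd: "pairs_readable hs (arrs s ''B'') j m"
    and up: "\<And>n. upper m n \<Longrightarrow> int (complexity n) \<le> arrs s ''B'' ! idx j m n"
  shows "executes (product_step (Var ''j'')) s
      ((\<Sum>a\<in>{2..floor_sqrt (l * m)}. 45 * (l div a + 1) + 20) + 10)
      (\<lambda>s'. env s' \<and> vars s' ''j'' = int j \<and> arrs s' ''Hs'' = hs \<and>
         product_inv (arrs s ''B'') j m (Suc (floor_sqrt (l * m))) 0 (arrs s' ''B''))"
proof -
  define r where "r = floor_sqrt (l * m)"
  have lm: "1 * 1 \<le> l * m" using pos m by (intro mult_mono) auto
  then have r: "1 \<le> r" unfolding r_def by (intro le_floor_sqrtI) simp
  have rH: "r \<le> H"
    using floor_sqrt_power2_le[of "l * m"] m(2) by (intro square_le_H) (simp add: r_def power2_eq_square)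
  let ?row = "\<lambda>a. 45 * (l div a + 1) + 12"
  let ?test = "Var ''a'' \<^bold>* Var ''a'' \<^bold>\<le> Read ''Hs'' (Var ''j'')"
  let ?P = "\<lambda>a s'. env s' \<and> vars s' ''j'' = int j \<and> arrs s' ''Hs'' = hs \<and> vars s' ''a'' = int a \<and>
     product_inv (arrs s ''B'') j m a 0 (arrs s' ''B'')"
  have lB: "length (arrs s ''B'') = J * (2 * l)" "length hs = J + 1" using s by (auto simp: env_def)
  show ?thesis
    unfolding product_step_def
  proof (rule executes_le, rule executes_Seq, rule executes_Assign[OF s(1)])
    let ?s = "s\<lparr>vars := (vars s)(''a'' := 2)\<rparr>"
    assume ok: "ok ?s"
    show "executes
     (WHILE ?test DO
       (''b'' ::= (Read ''Hs'' (Var ''j'') \<^bold>- Var ''l'') \<^bold>/ Var ''a'' \<^bold>+ Const 1;;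
        (IF Var ''b'' \<^bold>< Var ''a'' THEN ''b'' ::= Var ''a'' ELSE Skip);;
        WHILE Var ''a'' \<^bold>* Var ''b'' \<^bold>\<le> Read ''Hs'' (Var ''j'') DO
          ((IF Read ''Hs'' (Var ''j'') \<^bold>/ Var ''a'' \<^bold>\<le> Var ''H''
            THEN ''c'' ::= Read ''B0'' (Var ''b'')
            ELSE ''c'' ::= Read ''B'' (slot (Var ''a'' \<^bold>* Var ''j'') (Var ''b'')));;
           lower_to ''B'' (slot (Var ''j'') (Var ''a'' \<^bold>* Var ''b''))
             (Read ''B0'' (Var ''a'') \<^bold>+ Var ''c'');;
           ''b'' ::= Var ''b'' \<^bold>+ Const 1);;
        ''a'' ::= Var ''a'' \<^bold>+ Const 1)) ?s
      ((\<Sum>i<r - 1. (?row (2 + i) + 2) + exp_time ?test + 1) + exp_time ?test + 1)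
      (\<lambda>s'. env s' \<and> vars s' ''j'' = int j \<and> arrs s' ''Hs'' = hs \<and>
         product_inv (arrs s ''B'') j m (Suc (floor_sqrt (l * m))) 0 (arrs s' ''B''))"
      (is "executes (WHILE _ DO (?row_com;; _)) _ _ _")
    proof (rule executes_conseq[OF executes_While[where I = "\<lambda>i. ?P (2 + i)"] le_refl])
      show "?P (2 + 0) ?s"
        using s up by (simp add: env_def product_inv_def)
      show "exp_val ?test s' = Some (of_bool (i < r - 1))" if "i \<le> r - 1" "ok s'" "?P (2 + i) s'" for i s'
      proof -
        have "(2 + i) * (2 + i) \<le> l * m \<longleftrightarrow> 2 + i \<le> r"
          unfolding r_def by (simp only: le_floor_sqrt_iff power2_eq_square)
        then have "int (2 + i) * int (2 + i) \<le> int (l * m) \<longleftrightarrow> i < r - 1"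
          by (simp only: of_nat_mult[symmetric] of_nat_le_iff) linarith
        then show ?thesis using that m(1) lB(2) s(6) by (simp del: of_nat_add of_nat_mult)
      qed
      show "executes (?row_com;; ''a'' ::= Var ''a'' \<^bold>+ Const 1) s' (?row (2 + i) + 2) (?P (2 + Suc i))"
        if i: "i < r - 1" "ok s'" "?P (2 + i) s'" for i s'
      proof (rule executes_le, rule executes_Seq', rule product_row)
        have "2 + i \<le> r" using i(1) by simp
        then show "(2 + i) * (2 + i) \<le> l * m" unfolding r_def by (simp only: le_floor_sqrt_iff power2_eq_square)
        fix s1 assume s1: "ok s1" "env s1 \<and> vars s1 ''j'' = int j \<and> arrs s1 ''Hs'' = hs \<and>
          vars s1 ''a'' = int (2 + i) \<and> product_inv (arrs s ''B'') j m (Suc (2 + i)) 0 (arrs s1 ''B'')"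
        have "\<bar>int (2 + i) + 1\<bar> \<le> V" using le_V_linear[of "2 + i + 1"] i(1) rH R_le by linarith
        then show "executes (''a'' ::= Var ''a'' \<^bold>+ Const 1) s1 (exp_time (Var ''a'' \<^bold>+ Const 1) + 1) (?P (2 + Suc i))"
          by (intro executes_Assign[OF s1(1)]) (use s1 in \<open>auto simp: env_def\<close>)
      qed (use i s m rd lB in auto)
      show "env s' \<and> vars s' ''j'' = int j \<and> arrs s' ''Hs'' = hs \<and>
         product_inv (arrs s ''B'') j m (Suc (floor_sqrt (l * m))) 0 (arrs s' ''B'')"
        if "?P (2 + (r - 1)) s'" for s'
      proof -
        have "2 + (r - 1) = Suc (floor_sqrt (l * m))" using r r_def by simp
        then show ?thesis using that by metis
      qed
    qed (use ok in auto)
  next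
    have "(\<Sum>i<r - 1. (?row (2 + i) + 2) + exp_time ?test + 1) = (\<Sum>a\<in>{2..r}. ?row a + 6)"
      by (rule sum.reindex_bij_witness[of _ "\<lambda>n. n - 2" "\<lambda>i. 2 + i"]) (use r in auto)
    also have "\<dots> \<le> (\<Sum>a\<in>{2..r}. 45 * (l div a + 1) + 20)"
      by (intro sum_mono) simp
    finally show "exp_time (Const 2) + 1 + ((\<Sum>i<r - 1. (?row (2 + i) + 2) + exp_time ?test + 1) + exp_time ?test + 1)
      \<le> (\<Sum>a\<in>{2..floor_sqrt (l * m)}. 45 * (l div a + 1) + 20) + 10"
      by (simp add: r_def)
  qed (use V_ge in auto)
qed

definition block_inv :: "int list \<Rightarrow> nat \<Rightarrow> nat \<Rightarrow> nat \<Rightarrow> int list \<Rightarrow> bool" where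
  "block_inv xs0 j m n xs \<longleftrightarrow> length xs = length xs0 \<and>
     (\<forall>k. k div (2 * l) \<noteq> j - 1 \<longrightarrow> xs ! k = xs0 ! k) \<and>
     (\<forall>n'. window m n' \<and> n' < n \<longrightarrow> xs ! idx j m n' = int (complexity n')) \<and>
     (\<forall>n'. upper m n' \<longrightarrow> int (complexity n') \<le> xs ! idx j m n') \<and>
     (\<forall>a b. 2 \<le> a \<and> a \<le> b \<and> upper m (a * b) \<longrightarrow>
        xs ! idx j m (a * b) \<le> int (complexity a + complexity b))"

definition block_sum_inv :: "int list \<Rightarrow> nat \<Rightarrow> nat \<Rightarrow> nat \<Rightarrow> nat \<Rightarrow> int list \<Rightarrow> bool" where
  "block_sum_inv xs0 j m n k xs \<longleftrightarrow> block_inv xs0 j m n xs \<and>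
     xs ! idx j m n \<le> int (complexity (n - 1) + 1) \<and>
     (\<forall>k'. 6 \<le> k' \<and> k' < k \<longrightarrow> xs ! idx j m n \<le> int (complexity k' + complexity (n - k')))"

lemma block_inv_lower:
  assumes inv: "block_inv xs0 j m n xs" and n: "upper m n" "int (complexity n) \<le> v"
    and j: "1 \<le> j" "j \<le> J" "length xs0 = J * (2 * l)"
  shows "block_inv xs0 j m n (xs[idx j m n := min v (xs ! idx j m n)])" (is "block_inv _ _ _ _ ?ys")
    and "xs[idx j m n := min v (xs ! idx j m n)] ! idx j m n = min v (xs ! idx j m n)"
proof -
  have w: "window m n" using n(1) by (rule upper_window)
  have lx: "length xs = J * (2 * l)" using inv j(3) by (simp add: block_inv_def)
  have len: "idx j m n' < length xs" if "window m n'" for n'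
    using idx_less[OF that j(1,2)] lx by simp
  have le: "?ys ! idx j m n' \<le> xs ! idx j m n'" if "upper m n'" for n'
    by (rule list_lower_le, rule len, rule upper_window, rule that)
  have other: "?ys ! idx j m n' = xs ! idx j m n'" if "window m n'" "n' \<noteq> n" for n'
    using idx_inj[OF w that(1), of j] that(2) by simp
  show same: "?ys ! idx j m n = min v (xs ! idx j m n)" using len[OF w] by simp
  show "block_inv xs0 j m n ?ys"
    unfolding block_inv_def
  proof (intro conjI allI impI)
    show "length ?ys = length xs0" using inv by (simp add: block_inv_def)
    show "?ys ! k = xs0 ! k" if "k div (2 * l) \<noteq> j - 1" for k
    proof -
      have "k \<noteq> idx j m n" using that idx_div[OF w, of j] by metis
      then have "?ys ! k = xs ! k" by simp
      also have "\<dots> = xs0 ! k" using inv that unfolding block_inv_def by blast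
      finally show ?thesis .
    qed
    show "?ys ! idx j m n' = int (complexity n')" if "window m n' \<and> n' < n" for n'
      using other[of n'] inv that unfolding block_inv_def by simp
    show "int (complexity n') \<le> ?ys ! idx j m n'" if "upper m n'" for n'
    proof (cases "n' = n")
      case True
      then show ?thesis using same inv n unfolding block_inv_def by simp
    next
      case False
      then show ?thesis using other[OF upper_window[OF that]] inv that unfolding block_inv_def by simp
    qed
    show "?ys ! idx j m (a * b) \<le> int (complexity a + complexity b)"
      if "2 \<le> a \<and> a \<le> b \<and> upper m (a * b)" for a b
      using le[of "a * b"] inv that unfolding block_inv_def by (meson order_trans)
  qed
qed

lemma block_sum_final:
  assumes "block_sum_inv xs0 j m n (Suc (kMax n)) xs" "upper m n" "2 \<le> n"
  shows "block_inv xs0 j m (Suc n) xs"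
proof -
  have inv: "block_inv xs0 j m n xs" using assms by (simp add: block_sum_inv_def)
  have c: "int (complexity n) \<le> xs ! idx j m n" using inv assms(2) by (simp add: block_inv_def)
  have "nat (xs ! idx j m n) = complexity n"
  proof (rule complexity_eq_if_candidates[OF assms(3)])
    fix a b assume "2 \<le> a" "a \<le> b" "a * b = n"
    then have "xs ! idx j m n \<le> int (complexity a + complexity b)"
      using inv assms(2) unfolding block_inv_def by blast
    then show "nat (xs ! idx j m n) \<le> complexity a + complexity b" by simp
  qed (use assms c in \<open>auto simp: block_sum_inv_def\<close>)
  then have "xs ! idx j m n = int (complexity n)" using c by linarith
  then show ?thesis using inv unfolding block_inv_def by (auto simp: less_Suc_eq)
qed

lemma sum_row:
  assumes s: "ok s" "env s" "vars s ''j'' = int j" "arrs s ''Hs'' = hs" "1 \<le> j" "j \<le> J"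
    and m: "hs ! j = int (l * m)" "l * m \<le> N" "2 \<le> m"
    and xs0: "length xs0 = J * (2 * l)"
    and n: "vars s ''n'' = int n" "upper m n" "2 \<le> n"
    and inv: "block_inv xs0 j m n (arrs s ''B'')"
  shows "executes
      (lower_to ''B'' (slot (Var ''j'') (Var ''n''))
          (Read ''B'' (slot (Var ''j'') (Var ''n'' \<^bold>- Const 1)) \<^bold>+ Const 1);;
        compute_kMax (Read ''B'' (slot (Var ''j'') (Var ''n'' \<^bold>- Const 1)));;
        FOR ''k'' FROM Const 6 TO Var ''kMax'' DO
          lower_to ''B'' (slot (Var ''j'') (Var ''n''))
            (Read ''B0'' (Var ''k'') \<^bold>+ Read ''B'' (slot (Var ''j'') (Var ''n'' \<^bold>- Var ''k'')))) s
      (kMax_time (log_bound R) + 60 + 45 * kMax n)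
      (\<lambda>s'. env s' \<and> vars s' ''j'' = int j \<and> arrs s' ''Hs'' = hs \<and> block_inv xs0 j m (Suc n) (arrs s' ''B''))"
    (is "executes (?A;; ?B;; ?C) _ _ _")
proof -
  let ?Q = "\<lambda>s'. env s' \<and> vars s' ''j'' = int j \<and> arrs s' ''Hs'' = hs \<and> vars s' ''n'' = int n"
  have nN: "n \<le> N" using n(2) m(2) by (simp add: upper_def)
  have lhs: "length hs = J + 1" using s by (auto simp: env_def)
  have jl: "j < length hs" using s by (simp add: env_def)
  have kl: "kMax n < l" using kMax_less_l[OF n(3) nN] .
  have w: "window m (n - k)" if "k \<le> l" "k < n" for k
    using n(2) that unfolding upper_def window_def by linarith
  have w1: "window m (n - 1)" using w[of 1] pos n(3) by simp
  have lB: "length (arrs s' ''B'') = J * (2 * l)" if "?Q s'" for s' using that by (simp add: env_def)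
  have slot: "exp_val (slot (Var ''j'') ne) s' = Some (int (idx j m n'))"
    if "?Q s'" "exp_val ne s' = Some (int n')" "window m n'" for s' ne n'
    by (rule slot_val) (use that s m jl in \<open>auto simp: env_def\<close>)
  have slotR: "exp_val (Read ''B'' (slot (Var ''j'') ne)) s' = Some (int (complexity n'))"
    if "?Q s'" "exp_val ne s' = Some (int n')" "window m n'" "n' < n" "block_inv xs0 j m n (arrs s' ''B'')" for s' ne n'
    using slot[OF that(1-3)] idx_less[OF that(3) s(5,6)] lB[OF that(1)] that(3-5) by (simp add: block_inv_def)
  have n1: "exp_val (Var ''n'' \<^bold>- Const 1) s' = Some (int (n - 1))" if "?Q s'" for s'
    using that n(3) by simp
  have A: "executes ?A s 40 (\<lambda>s. ?Q s \<and> block_sum_inv xs0 j m n 6 (arrs s ''B''))"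
  proof (rule executes_le, rule executes_lower_to[OF s(1)])
    have Q: "?Q s" using s n by simp
    show "exp_val (slot (Var ''j'') (Var ''n'')) s = Some (int (idx j m n))"
      using slot[OF Q _ upper_window[OF n(2)]] n by simp
    show "exp_val (Read ''B'' (slot (Var ''j'') (Var ''n'' \<^bold>- Const 1)) \<^bold>+ Const 1) s = Some (int (complexity (n - 1) + 1))"
      using slotR[OF Q n1[OF Q] w1 _ inv] n(3) by simp
    show "int (idx j m n) < int (length (arrs s ''B''))"
      using idx_less[OF upper_window[OF n(2)] s(5,6)] lB[OF Q] by (simp only: of_nat_less_iff)
    show "?Q s1 \<and> block_sum_inv xs0 j m n 6 (arrs s1 ''B'')"
      if s1: "vars s1 = vars s" "arrs s1 = (arrs s)(''B'' := (arrs s ''B'')[nat (int (idx j m n)) :=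
         min (int (complexity (n - 1) + 1)) (arrs s ''B'' ! nat (int (idx j m n)))])" for s1
    proof -
      have "complexity n \<le> complexity (n - 1) + 1" using complexity_Suc[of "n - 1"] n(3) by simp
      then have "int (complexity n) \<le> int (complexity (n - 1) + 1)" by (rule of_nat_mono)
      note b = block_inv_lower[OF inv n(2) this s(5,6) xs0]
      then have "block_sum_inv xs0 j m n 6 (arrs s1 ''B'')"
        using s1(2) unfolding block_sum_inv_def nat_int by simp
      then show ?thesis using Q s1 by (simp add: env_def lhs)
    qed
  qed (auto simp: slot_weight slot_time)
  have AB: "executes (?A;; ?B) s (40 + (kMax_time (log_bound R) + 10))
    (\<lambda>s. ?Q s \<and> vars s ''kMax'' = int (kMax n) \<and> block_sum_inv xs0 j m n 6 (arrs s ''B''))"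
  proof (rule executes_Seq'[OF A])
    fix s1 assume s1: "ok s1" "?Q s1 \<and> block_sum_inv xs0 j m n 6 (arrs s1 ''B'')"
    show "executes ?B s1 (kMax_time (log_bound R) + 10)
      (\<lambda>s. ?Q s \<and> vars s ''kMax'' = int (kMax n) \<and> block_sum_inv xs0 j m n 6 (arrs s ''B''))"
    proof (rule executes_conseq, rule compute_kMax[OF s1(1) n(3)])
      have Q: "?Q s1" and i: "block_inv xs0 j m n (arrs s1 ''B'')" using s1(2) by (auto simp: block_sum_inv_def)
      show "exp_val (Read ''B'' (slot (Var ''j'') (Var ''n'' \<^bold>- Const 1))) s1 = Some (int (complexity (n - 1)))"
        using slotR[OF Q n1[OF Q] w1 _ i] n(3) by simp
      have "n ^ 2 \<le> R ^ 2" using nN R_le by (intro power_mono) auto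
      then show "int (n ^ 2) \<le> V" using le_V[of "n ^ 2"] R_le by linarith
      have "complexity (n - 1) \<le> log_bound R" using complexity_le_log_bound[of "n - 1" R] nN n(3) R_le by simp
      then show "exp_time (Read ''B'' (slot (Var ''j'') (Var ''n'' \<^bold>- Const 1))) + kMax_time (complexity (n - 1))
        \<le> kMax_time (log_bound R) + 10" using kMax_time_mono[of "complexity (n - 1)" "log_bound R"] by (simp add: slot_time)
      show "?Q s2 \<and> vars s2 ''kMax'' = int (kMax n) \<and> block_sum_inv xs0 j m n 6 (arrs s2 ''B'')"
        if s2: "frame ?B s1 s2" "vars s2 ''kMax'' = int (kMax n)" for s2
        using frame_var[OF s2(1)] frame_arr[OF s2(1)] s1(2) s2(2)
        by (simp add: env_def lhs compute_kMax_def compute_E_def)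
    qed (use s1(2) in \<open>auto simp: slot_weight\<close>)
  qed
  let ?w = "lower_to ''B'' (slot (Var ''j'') (Var ''n''))
            (Read ''B0'' (Var ''k'') \<^bold>+ Read ''B'' (slot (Var ''j'') (Var ''n'' \<^bold>- Var ''k'')))"
  have C: "executes ?C s1 (45 * kMax n + 3) (\<lambda>s. ?Q s \<and> block_inv xs0 j m (Suc n) (arrs s ''B''))"
    if s1: "ok s1" "?Q s1 \<and> vars s1 ''kMax'' = int (kMax n) \<and> block_sum_inv xs0 j m n 6 (arrs s1 ''B'')" for s1
  proof (rule executes_conseq, rule executes_For[OF s1(1), where n = "kMax n - 5" and
        a = 6 and h = "int (kMax n)" and \<tau> = "\<lambda>_. 40" and
        I = "\<lambda>i s. ?Q s \<and> vars s ''kMax'' = int (kMax n) \<and> block_sum_inv xs0 j m n (6 + i) (arrs s ''B'')"])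
    show "\<bar>int (kMax n)\<bar> < V" using le_V_linear[of "kMax n"] kl two_l_le R_le by linarith
    show "executes ?w s' 40 (\<lambda>s. ?Q s \<and> vars s ''kMax'' = int (kMax n) \<and> block_sum_inv xs0 j m n (6 + Suc i) (arrs s ''B''))"
      if i: "i < kMax n - 5" "ok s'" "?Q s' \<and> vars s' ''kMax'' = int (kMax n) \<and> block_sum_inv xs0 j m n (6 + i) (arrs s' ''B'')"
        "vars s' ''k'' = 6 + int i" for i s'
    proof (rule executes_le, rule executes_lower_to[OF i(2)])
      define k where "k = 6 + i"
      have k: "6 \<le> k" "k < n" "k \<le> l" "k \<le> H" "vars s' ''k'' = int k"
        using i(1,4) kMax_less[OF n(3)] kl two_l_le by (auto simp: k_def)
      have Q: "?Q s'" and inv': "block_inv xs0 j m n (arrs s' ''B'')" using i(3) by (auto simp: block_sum_inv_def)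
      show "exp_val (slot (Var ''j'') (Var ''n'')) s' = Some (int (idx j m n))"
        using slot[OF Q _ upper_window[OF n(2)]] Q by simp
      show "int (idx j m n) < int (length (arrs s' ''B''))"
        using idx_less[OF upper_window[OF n(2)] s(5,6)] lB[OF Q] by (simp only: of_nat_less_iff)
      have "exp_val (Var ''n'' \<^bold>- Var ''k'') s' = Some (int (n - k))" using Q k by simp
      from slotR[OF Q this w[OF k(3,2)] _ inv'] k
      have r1: "exp_val (Read ''B'' (slot (Var ''j'') (Var ''n'' \<^bold>- Var ''k''))) s' = Some (int (complexity (n - k)))"
        by simp
      have "exp_val (Read ''B0'' (Var ''k'')) s' = Some (int (complexity k))" using Q k by (simp add: env_def)
      with r1 show "exp_val (Read ''B0'' (Var ''k'') \<^bold>+ Read ''B'' (slot (Var ''j'') (Var ''n'' \<^bold>- Var ''k''))) s'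
          = Some (int (complexity k + complexity (n - k)))"
        by (simp del: exp_val.simps(4))
      show "?Q s2 \<and> vars s2 ''kMax'' = int (kMax n) \<and> block_sum_inv xs0 j m n (6 + Suc i) (arrs s2 ''B'')"
        if s2: "vars s2 = vars s'" "arrs s2 = (arrs s')(''B'' := (arrs s' ''B'')[nat (int (idx j m n)) :=
          min (int (complexity k + complexity (n - k))) (arrs s' ''B'' ! nat (int (idx j m n)))])" for s2
      proof -
        have "complexity n \<le> complexity k + complexity (n - k)" using complexity_add[of k "n - k"] k by simp
        then have "int (complexity n) \<le> int (complexity k + complexity (n - k))" by (rule of_nat_mono)
        note b = block_inv_lower[OF inv' n(2) this s(5,6) xs0]
        have "block_sum_inv xs0 j m n k (arrs s' ''B'')" using i(3) by (simp add: k_def)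
        then have "block_sum_inv xs0 j m n (Suc k) (arrs s2 ''B'')"
          using s2(2) b unfolding block_sum_inv_def nat_int
          by (auto simp: less_Suc_eq min.coboundedI2)
        moreover have "Suc k = 6 + Suc i" by (simp add: k_def)
        ultimately have "block_sum_inv xs0 j m n (6 + Suc i) (arrs s2 ''B'')" by (simp only:)
        then show ?thesis using i(3) s2 by (simp add: env_def lhs)
      qed
    qed (auto simp: slot_weight slot_time)
    show "?Q s2 \<and> block_inv xs0 j m (Suc n) (arrs s2 ''B'')"
      if s2: "?Q s2 \<and> vars s2 ''kMax'' = int (kMax n) \<and> block_sum_inv xs0 j m n (6 + (kMax n - 5)) (arrs s2 ''B'')" for s2
    proof -
      have "block_sum_inv xs0 j m n (6 + (kMax n - 5)) (arrs s2 ''B'')" using s2 by simp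
      then have "block_sum_inv xs0 j m n (Suc (kMax n)) (arrs s2 ''B'')" by (auto simp: block_sum_inv_def)
      then show ?thesis using block_sum_final[OF _ n(2,3)] s2 by simp
    qed
  qed (use s1 V_ge in \<open>auto simp: lower_to_def env_def\<close>)
  show ?thesis
  proof (rule executes_le, rule executes_Seq'[OF AB])
    fix s1 assume "ok s1" "?Q s1 \<and> vars s1 ''kMax'' = int (kMax n) \<and> block_sum_inv xs0 j m n 6 (arrs s1 ''B'')"
    note C1 = C[OF this]
    show "executes ?C s1 (45 * kMax n + 3) (\<lambda>s'. env s' \<and> vars s' ''j'' = int j \<and> arrs s' ''Hs'' = hs \<and>
        block_inv xs0 j m (Suc n) (arrs s' ''B''))"
      by (rule executes_conseq[OF C1 le_refl]) simp
  qed simp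
qed

lemma sum_step:
  assumes s: "ok s" "env s" "vars s ''j'' = int j" "arrs s ''Hs'' = hs" "1 \<le> j" "j \<le> J"
    and m: "hs ! j = int (l * m)" "l * m \<le> N" "2 \<le> m"
    and xs0: "length xs0 = J * (2 * l)"
    and inv: "block_inv xs0 j m (l * m - l + 1) (arrs s ''B'')"
  shows "executes (sum_step (Var ''j'')) s
      ((\<Sum>n\<in>{l * m - l + 1..l * m}. kMax_time (log_bound R) + 70 + 45 * kMax n) + 10)
      (\<lambda>s'. env s' \<and> vars s' ''j'' = int j \<and> arrs s' ''Hs'' = hs \<and>
        (\<forall>k. k div (2 * l) \<noteq> j - 1 \<longrightarrow> arrs s' ''B'' ! k = xs0 ! k) \<and> holds (arrs s' ''B'') j m)"
proof -
  define n0 where "n0 = l * m - l + 1"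
  have lm: "2 * l \<le> l * m" using mult_le_mono2[OF m(3), of l] by linarith
  have n0: "n0 + l = l * m + 1" "2 \<le> n0" using lm pos unfolding n0_def by linarith+
  let ?\<tau> = "\<lambda>n. kMax_time (log_bound R) + 60 + 45 * kMax n"
  have jl: "j < length hs" using s by (simp add: env_def)
  have "(\<Sum>i<l. ?\<tau> (n0 + i) + 5) = (\<Sum>n\<in>{n0..l * m}. ?\<tau> n + 5)"
    by (rule sum.reindex_bij_witness[of _ "\<lambda>n. n - n0" "\<lambda>i. n0 + i"]) (use n0 in auto)
  also have "\<dots> \<le> (\<Sum>n\<in>{l * m - l + 1..l * m}. kMax_time (log_bound R) + 70 + 45 * kMax n)"
    unfolding n0_def by (intro sum_mono) simp
  finally have time: "(\<Sum>i<l. ?\<tau> (n0 + i) + 5) \<le> \<dots>" .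
  show ?thesis
    unfolding sum_step_def
  proof (rule executes_conseq, rule executes_For[OF s(1), where n = l and a = "int n0" and h = "int (l * m)" and
        \<tau> = "\<lambda>i. ?\<tau> (n0 + i)" and I = "\<lambda>i s. env s \<and> vars s ''j'' = int j \<and> arrs s ''Hs'' = hs \<and>
          block_inv xs0 j m (n0 + i) (arrs s ''B'')"])
    have "int (l * m) - int l + 1 = int n0" using n0(1) by linarith
    then show "exp_val (Read ''Hs'' (Var ''j'') \<^bold>- Var ''l'' \<^bold>+ Const 1) s = Some (int n0)"
      using s m(1) jl by (simp add: env_def del: of_nat_mult)
    show "\<bar>int n0\<bar> \<le> V" "\<bar>int (l * m)\<bar> < V"
      using le_V_linear[of n0] le_V_linear[of "l * m"] m(2) R_le n0 pos by linarith+
    show "l = nat (int (l * m) + 1 - int n0)" using n0(1) by linarith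
    show "exp_val (Read ''Hs'' (Var ''j'')) s' = Some (int (l * m))"
      if "env s' \<and> vars s' ''j'' = int j \<and> arrs s' ''Hs'' = hs \<and>
          block_inv xs0 j m (n0 + i) (arrs s' ''B'')" for i s'
      using that m(1) jl by (simp del: of_nat_mult)
    show "executes
      (lower_to ''B'' (slot (Var ''j'') (Var ''n''))
          (Read ''B'' (slot (Var ''j'') (Var ''n'' \<^bold>- Const 1)) \<^bold>+ Const 1);;
        compute_kMax (Read ''B'' (slot (Var ''j'') (Var ''n'' \<^bold>- Const 1)));;
        FOR ''k'' FROM Const 6 TO Var ''kMax'' DO
          lower_to ''B'' (slot (Var ''j'') (Var ''n''))
            (Read ''B0'' (Var ''k'') \<^bold>+ Read ''B'' (slot (Var ''j'') (Var ''n'' \<^bold>- Var ''k'')))) s'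
      (?\<tau> (n0 + i)) (\<lambda>s. env s \<and> vars s ''j'' = int j \<and> arrs s ''Hs'' = hs \<and>
          block_inv xs0 j m (n0 + Suc i) (arrs s ''B''))"
      if i: "i < l" "ok s'" "env s' \<and> vars s' ''j'' = int j \<and> arrs s' ''Hs'' = hs \<and>
          block_inv xs0 j m (n0 + i) (arrs s' ''B'')" "vars s' ''n'' = int n0 + int i" for i s'
    proof -
      have up: "upper m (n0 + i)" using i(1) n0(1) by (simp add: upper_def)
      have "2 \<le> n0 + i" using n0 by simp
      from sum_row[OF i(2) _ _ _ s(5,6) m xs0 _ up this] i show ?thesis by simp
    qed
    show "env s' \<and> vars s' ''j'' = int j \<and> arrs s' ''Hs'' = hs \<and>
        (\<forall>k. k div (2 * l) \<noteq> j - 1 \<longrightarrow> arrs s' ''B'' ! k = xs0 ! k) \<and> holds (arrs s' ''B'') j m"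
      if s': "env s' \<and> vars s' ''j'' = int j \<and> arrs s' ''Hs'' = hs \<and> block_inv xs0 j m (n0 + l) (arrs s' ''B'')" for s'
    proof -
      have "holds (arrs s' ''B'') j m"
        unfolding holds_def
      proof (intro allI impI)
        fix n assume n: "window m n"
        then have "n < n0 + l" using n0(1) by (simp add: window_def)
        then show "arrs s' ''B'' ! idx j m n = int (complexity n)"
          using s' n unfolding block_inv_def by blast
      qed
      then show ?thesis using s' unfolding block_inv_def by blast
    qed
  qed (use s V_ge inv n0_def time in \<open>auto simp: lower_to_def env_def compute_kMax_def compute_E_def\<close>)
qed

end


subsection \<open>The main loop\<close>

definition ceil_div :: "nat \<Rightarrow> nat \<Rightarrow> nat" where
  "ceil_div x j = (x + j - 1) div j"

lemma ceil_div_le_iff: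
  assumes "j \<ge> 1"
  shows "ceil_div x j \<le> y \<longleftrightarrow> x \<le> j * y"
proof -
  have "ceil_div x j \<le> y \<longleftrightarrow> (x + j - 1) div j < Suc y" by (auto simp: ceil_div_def)
  also have "\<dots> \<longleftrightarrow> x + j - 1 < Suc y * j" using assms by (intro div_less_iff_less_mult) simp
  also have "\<dots> \<longleftrightarrow> x \<le> j * y" using assms by (auto simp: mult.commute)
  finally show ?thesis .
qed

lemma less_ceil_div_iff: "j \<ge> 1 \<Longrightarrow> y < ceil_div x j \<longleftrightarrow> j * y < x"
  using ceil_div_le_iff[of j x y] by linarith

lemma le_ceil_div: "j \<ge> 1 \<Longrightarrow> x \<le> j * ceil_div x j"
  using ceil_div_le_iff[of j x "ceil_div x j"] by simp

lemma ceil_div_mono: "j \<ge> 1 \<Longrightarrow> x \<le> y \<Longrightarrow> ceil_div x j \<le> ceil_div y j"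
  using le_ceil_div[of j y] by (simp add: ceil_div_le_iff)

lemma ceil_div_Suc: "j \<ge> 1 \<Longrightarrow> ceil_div (Suc x) j \<le> Suc (ceil_div x j)"
  using le_ceil_div[of j x] by (simp add: ceil_div_le_iff)

lemma ceil_div_ceil_div:
  assumes "j \<ge> 1" "a \<ge> 1"
  shows "ceil_div (ceil_div x j) a = ceil_div x (a * j)"
proof -
  have "ceil_div (ceil_div x j) a \<le> y \<longleftrightarrow> ceil_div x (a * j) \<le> y" for y
    using assms by (simp add: ceil_div_le_iff mult.commute mult.left_commute)
  then show ?thesis by (meson le_antisym le_refl)
qed

lemma ceil_div_1: "ceil_div x 1 = x"
  by (simp add: ceil_div_def)

lemma ceil_div_mult:
  assumes "k \<ge> 1" "j \<ge> 1"
  shows "(k * x + k * j - 1) div (k * j) = ceil_div x j"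
proof -
  have "ceil_div (k * x) (k * j) \<le> y \<longleftrightarrow> ceil_div x j \<le> y" for y
    using assms by (simp add: ceil_div_le_iff mult.assoc)
  then show ?thesis by (metis ceil_div_def le_antisym le_refl)
qed

lemma sum_div_le:
  fixes l k :: nat
  shows "(\<Sum>a\<in>{1..<2 ^ k}. l div a) \<le> l * k"
proof (induction k)
  case (Suc k)
  have "(1::nat) \<le> 2 ^ k" by simp
  then have "{1..<(2::nat) ^ Suc k} = {1..<2 ^ k} \<union> {2 ^ k..<2 ^ Suc k}" by auto
  then have "(\<Sum>a\<in>{1..<2 ^ Suc k}. l div a) = (\<Sum>a\<in>{1..<2 ^ k}. l div a) + (\<Sum>a\<in>{2 ^ k..<2 ^ Suc k}. l div a)"
    by (simp only:) (rule sum.union_disjoint; auto)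
  also have "(\<Sum>a\<in>{2 ^ k..<2 ^ Suc k}. l div a) \<le> (\<Sum>a\<in>{2 ^ k..<(2::nat) ^ Suc k}. l div 2 ^ k)"
    by (intro sum_mono div_le_mono2) auto
  also have "\<dots> = 2 ^ k * (l div 2 ^ k)" by simp
  also have "\<dots> \<le> l" by (rule times_div_less_eq_dividend)
  finally show ?case using Suc by (simp add: algebra_simps)
qed simp

context space_params
begin

definition kMax_total :: "nat \<Rightarrow> nat" where
  "kMax_total n = (\<Sum>k\<in>{2..n}. kMax k)"

definition overhead :: nat where
  "overhead = 300 + 200 * l + 45 * (l * log_bound R) + 65 * floor_sqrt N + l * kMax_time (log_bound R)"

lemma product_time_le:
  assumes "m \<le> N"
  shows "(\<Sum>a\<in>{2..floor_sqrt m}. 45 * (l div a + 1) + 20) \<le> 45 * (l * log_bound R) + 65 * floor_sqrt N"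
proof -
  have sq: "floor_sqrt m \<le> floor_sqrt N" using assms by (rule mono_floor_sqrt')
  have "floor_sqrt m \<le> R" using floor_sqrt_le[of m] assms R_le by linarith
  also have "R \<le> R ^ 3" by (rule R_le)
  also have "\<dots> < 2 ^ log_bound R" by (rule log_bound)
  finally have "(\<Sum>a\<in>{2..floor_sqrt m}. l div a) \<le> (\<Sum>a\<in>{1..<2 ^ log_bound R}. l div a)"
    by (intro sum_mono2) auto
  also have "\<dots> \<le> l * log_bound R" by (rule sum_div_le)
  finally have *: "(\<Sum>a\<in>{2..floor_sqrt m}. l div a) \<le> l * log_bound R" .
  have "(\<Sum>a\<in>{2..floor_sqrt m}. 45 * (l div a + 1) + 20)
      = 45 * (\<Sum>a\<in>{2..floor_sqrt m}. l div a) + 65 * card {2..floor_sqrt m}"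
    by (simp add: sum.distrib sum_distrib_left algebra_simps)
  moreover have "card {2..floor_sqrt m} \<le> floor_sqrt N" using sq by simp
  ultimately show ?thesis using * by linarith
qed

lemma pairs_readable_cong:
  assumes "pairs_readable hs xs j m" "1 \<le> j"
    "\<And>j'. j' \<noteq> j \<Longrightarrow> hs' ! j' = hs ! j'" "\<And>k. k div (2 * l) \<noteq> j - 1 \<Longrightarrow> xs' ! k = xs ! k"
  shows "pairs_readable hs' xs' j m"
  unfolding pairs_readable_def
proof (intro allI impI)
  fix a b assume ab: "2 \<le> a \<and> upper m (a * b) \<and> H < l * m div a"
  then obtain m' where m': "a * j \<le> J" "hs ! (a * j) = int (l * m')" "window m' b"
    "xs ! idx (a * j) m' b = int (complexity b)"
    using assms(1) unfolding pairs_readable_def by blast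
  have "1 * j < a * j" using ab assms(2) by (intro mult_strict_right_mono) auto
  then have "a * j \<noteq> j" "a * j - 1 \<noteq> j - 1" using assms(2) by linarith+
  then have "hs' ! (a * j) = int (l * m')" "xs' ! idx (a * j) m' b = int (complexity b)"
    using assms(3,4) m' idx_div[OF m'(3), of "a * j"] by simp_all
  then show "a * j \<le> J \<and> (\<exists>m'. hs' ! (a * j) = int (l * m') \<and> window m' b \<and>
       xs' ! idx (a * j) m' b = int (complexity b))" using m' by blast
qed

lemma block_inv_start:
  assumes "product_inv xs0 j m (Suc (floor_sqrt (l * m))) 0 xs" "1 \<le> j" "2 \<le> m"
    and old: "\<And>n. window m n \<Longrightarrow> \<not> upper m n \<Longrightarrow> xs0 ! idx j m n = int (complexity n)"
  shows "block_inv xs0 j m (l * m - l + 1) xs"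
  unfolding block_inv_def
proof (intro conjI allI impI)
  show "length xs = length xs0" using assms(1) by (simp add: product_inv_def)
  show "xs ! k = xs0 ! k" if "k div (2 * l) \<noteq> j - 1" for k
  proof -
    have "k \<noteq> idx j m n" if "upper m n" for n
      using \<open>k div (2 * l) \<noteq> j - 1\<close> idx_div[OF upper_window[OF that], of j] by metis
    then show ?thesis using assms(1) unfolding product_inv_def by blast
  qed
  show "xs ! idx j m n' = int (complexity n')" if "window m n' \<and> n' < l * m - l + 1" for n'
  proof -
    have "l \<le> l * m" using assms(3) by simp
    then have nu: "\<not> upper m n'" using that unfolding upper_def by linarith
    then have "idx j m n' \<noteq> idx j m n" if "upper m n" for n
      using idx_inj[of m n' n j] \<open>window m n' \<and> _\<close> upper_window[OF that] that by auto
    then have "xs ! idx j m n' = xs0 ! idx j m n'" using assms(1) unfolding product_inv_def by blast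
    then show ?thesis using old nu that by simp
  qed
  show "int (complexity n') \<le> xs ! idx j m n'" if "upper m n'" for n'
    using assms(1) that unfolding product_inv_def by blast
  show "xs ! idx j m (a * b) \<le> int (complexity a + complexity b)"
    if ab: "2 \<le> a \<and> a \<le> b \<and> upper m (a * b)" for a b
  proof -
    have "a * a \<le> a * b" using ab by simp
    also have "\<dots> \<le> l * m" using ab by (simp add: upper_def)
    finally have "a \<le> floor_sqrt (l * m)" by (intro le_floor_sqrtI) (simp add: power2_eq_square)
    then show ?thesis using assms(1) ab unfolding product_inv_def by (simp add: less_Suc_eq_le)
  qed
qed

definition values_list :: "nat \<Rightarrow> nat \<Rightarrow> int list" where
  "values_list a b = map (\<lambda>n. int (complexity n)) [a..<b]"

lemma values_list_append: "a \<le> b \<Longrightarrow> b \<le> c \<Longrightarrow> values_list a b @ values_list b c = values_list a c"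
  unfolding values_list_def by (metis map_append upt_add_eq_append le_add_diff_inverse)

lemma values_list_Suc: "a \<le> b \<Longrightarrow> values_list a (Suc b) = values_list a b @ [int (complexity b)]"
  by (simp add: values_list_def)

lemma values_list_empty: "values_list a a = []"
  by (simp add: values_list_def)

abbreviation emit_block :: com where
  "emit_block \<equiv> FOR ''i'' FROM Read ''Hs'' (Const 1) \<^bold>- Var ''l'' \<^bold>+ Const 1 TO Read ''Hs'' (Const 1) DO
     Emit (Read ''B'' (slot (Const 1) (Var ''i'')))"

lemma emit_block:
  assumes s: "ok s" "env s" "arrs s ''Hs'' ! 1 = int (l * m)" "2 \<le> m" "l * m \<le> N" "holds (arrs s ''B'') 1 m"
  shows "executes emit_block s (20 * l + 10)
    (\<lambda>s'. emitted s' = emitted s @ values_list (l * m - l + 1) (l * m + 1))"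
proof -
  define n0 where "n0 = l * m - l + 1"
  have lm: "2 * l \<le> l * m" using mult_le_mono2[OF s(4), of l] by linarith
  have n0: "n0 + l = l * m + 1" using lm pos unfolding n0_def by linarith
  have jl: "1 < length (arrs s ''Hs'')" using J_ge s(2) by (simp add: env_def)
  let ?I = "\<lambda>i s'. env s' \<and> arrs s' = arrs s \<and> emitted s' = emitted s @ values_list n0 (n0 + i)"
  show ?thesis
  proof (rule executes_conseq, rule executes_For[OF s(1), where n = l and a = "int n0" and h = "int (l * m)" and
        \<tau> = "\<lambda>_. 9" and I = ?I])
    have "int (l * m) - int l + 1 = int n0" using n0 by linarith
    then show "exp_val (Read ''Hs'' (Const 1) \<^bold>- Var ''l'' \<^bold>+ Const 1) s = Some (int n0)"
      using s(2,3) jl by (simp add: env_def del: of_nat_mult)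
    show "\<bar>int n0\<bar> \<le> V" "\<bar>int (l * m)\<bar> < V"
      using le_V_linear[of n0] le_V_linear[of "l * m"] s(5) R_le n0 pos by linarith+
    show "l = nat (int (l * m) + 1 - int n0)" using n0 by linarith
    show "exp_val (Read ''Hs'' (Const 1)) s' = Some (int (l * m))" if "?I i s'" for i s'
      using that s(3) jl by (simp add: env_def del: of_nat_mult)
    show "executes (Emit (Read ''B'' (slot (Const 1) (Var ''i'')))) s' 9 (?I (Suc i))"
      if i: "i < l" "ok s'" "?I i s'" "vars s' ''i'' = int n0 + int i" for i s'
    proof (rule executes_le, rule executes_Emit[OF i(2)])
      have w: "window m (n0 + i)" using n0 i(1) by (simp add: window_def)
      have "exp_val (slot (Const 1) (Var ''i'')) s' = Some (int (idx 1 m (n0 + i)))"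
        by (rule slot_val) (use i s jl w in \<open>auto simp: env_def\<close>)
      moreover have "idx 1 m (n0 + i) < length (arrs s ''B'')"
        using idx_less[OF w, of 1] J_ge s(2) by (simp add: env_def)
      moreover have "arrs s ''B'' ! idx 1 m (n0 + i) = int (complexity (n0 + i))"
        using s(6) w by (simp add: holds_def)
      ultimately show "exp_val (Read ''B'' (slot (Const 1) (Var ''i''))) s' = Some (int (complexity (n0 + i)))"
        using i(3) by simp
      let ?s = "s'\<lparr>emitted := emitted s' @ [int (complexity (n0 + i))]\<rparr>"
      have "env s'" using i(3) by blast
      then have "env ?s" by (simp add: env_def)
      then show "?I (Suc i) ?s" using i(3) by (simp add: values_list_Suc)
    qed (auto simp: slot_weight slot_time)
    show "emitted s' = emitted s @ values_list (l * m - l + 1) (l * m + 1)" if "?I l s'" for s'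
    proof -
      have "emitted s' = emitted s @ values_list n0 (n0 + l)" using that by blast
      then show ?thesis unfolding n0 by (simp add: n0_def)
    qed
  qed (use s(2) V_ge in \<open>auto simp: env_def values_list_empty\<close>)
qed

lemma update_block:
  assumes s: "ok s" "env s" "vars s ''j'' = int j" "1 \<le> j" "j \<le> J"
    and m: "arrs s ''Hs'' ! j = int (l * m)" "l * Suc m \<le> N" "2 \<le> m" "holds (arrs s ''B'') j m"
    and rd: "pairs_readable (arrs s ''Hs'') (arrs s ''B'') j (Suc m)"
  shows "executes
     (shift (Var ''j'');; product_step (Var ''j'');; sum_step (Var ''j'');;
      (IF Var ''j'' \<^bold>= Const 1 THEN emit_block ELSE Skip)) s
     (100 + 140 * l + 45 * (l * log_bound R) + 65 * floor_sqrt N + l * kMax_time (log_bound R) +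
       45 * (kMax_total (l * Suc m) - kMax_total (l * m)))
     (\<lambda>s'. env s' \<and> vars s' ''j'' = int j \<and> arrs s' ''Hs'' = (arrs s ''Hs'')[j := int (l * Suc m)] \<and>
       (\<forall>k. k div (2 * l) \<noteq> j - 1 \<longrightarrow> arrs s' ''B'' ! k = arrs s ''B'' ! k) \<and>
       holds (arrs s' ''B'') j (Suc m) \<and>
       emitted s' = emitted s @ (if j = 1 then values_list (l * m + 1) (l * Suc m + 1) else []))"
    (is "executes (?S;; ?P;; ?T;; ?F) _ _ _")
proof -
  define hs where "hs = (arrs s ''Hs'')[j := int (l * Suc m)]"
  have jl: "j < length (arrs s ''Hs'')" using s by (simp add: env_def)
  have hsj: "hs ! j = int (l * Suc m)" using jl by (simp add: hs_def)
  have Sm: "2 \<le> Suc m" using m(3) by simp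
  have fr: "''j'' \<notin> assigned_vars ?S" "''j'' \<notin> assigned_vars ?P" "''j'' \<notin> assigned_vars ?T"
    "silent ?S" "silent ?P" "silent ?T"
    by (auto simp: shift_def product_step_def sum_step_def lower_to_def compute_kMax_def compute_E_def)
  let ?out = "\<lambda>s'. \<forall>k. k div (2 * l) \<noteq> j - 1 \<longrightarrow> arrs s' ''B'' ! k = arrs s ''B'' ! k"
  let ?c = "\<lambda>s'. env s' \<and> vars s' ''j'' = int j \<and> arrs s' ''Hs'' = hs \<and> emitted s' = emitted s \<and> ?out s'"
  define tP where "tP = (\<Sum>a\<in>{2..floor_sqrt (l * Suc m)}. 45 * (l div a + 1) + 20) + 10"
  define tT where "tT = (\<Sum>n\<in>{l * Suc m - l + 1..l * Suc m}. kMax_time (log_bound R) + 70 + 45 * kMax n) + 10"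
  have PS: "executes (?S;; ?P) s ((40 * l + 30) + tP)
     (\<lambda>s'. ?c s' \<and> block_inv (arrs s' ''B'') j (Suc m) (l * Suc m - l + 1) (arrs s' ''B''))"
  proof (rule executes_Seq'[OF shift[OF s m(1,2,4,3)]])
    fix s1 assume s1: "ok s1" "frame ?S s s1" and post: "env s1 \<and> arrs s1 ''Hs'' = (arrs s ''Hs'')[j := int (l * Suc m)] \<and>
     (\<forall>k. k div (2 * l) \<noteq> j - 1 \<longrightarrow> arrs s1 ''B'' ! k = arrs s ''B'' ! k) \<and>
     (\<forall>n. window (Suc m) n \<and> \<not> upper (Suc m) n \<longrightarrow> arrs s1 ''B'' ! idx j (Suc m) n = int (complexity n)) \<and>
     (\<forall>n. upper (Suc m) n \<longrightarrow> arrs s1 ''B'' ! idx j (Suc m) n = int (log_bound N))"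
    have j1: "vars s1 ''j'' = int j" using frame_var[OF s1(2) fr(1)] s(3) by simp
    have e1: "emitted s1 = emitted s" using frame_emitted[OF s1(2) fr(4)] .
    have env1: "env s1" and hs1: "arrs s1 ''Hs'' = hs" and out1: "?out s1"
      using post unfolding hs_def by blast+
    have rd1: "pairs_readable hs (arrs s1 ''B'') j (Suc m)"
      by (rule pairs_readable_cong[OF rd s(4)]) (use out1 in \<open>auto simp: hs_def\<close>)
    have up1: "int (complexity n) \<le> arrs s1 ''B'' ! idx j (Suc m) n" if "upper (Suc m) n" for n
    proof -
      have "1 \<le> n" "n \<le> N" using window_pos[OF upper_window[OF that] Sm] that m(2) by (auto simp: upper_def)
      then show ?thesis using post that complexity_le_log_bound by simp
    qed
    show "executes ?P s1 tP
     (\<lambda>s'. ?c s' \<and> block_inv (arrs s' ''B'') j (Suc m) (l * Suc m - l + 1) (arrs s' ''B''))"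
      unfolding tP_def
    proof (rule executes_conseq[OF product_step[OF s1(1) env1 j1 hs1 s(4,5) hsj m(2) Sm rd1 up1] le_refl])
      fix s2 assume f2: "frame ?P s1 s2" and p2: "env s2 \<and> vars s2 ''j'' = int j \<and> arrs s2 ''Hs'' = hs \<and>
         product_inv (arrs s1 ''B'') j (Suc m) (Suc (floor_sqrt (l * Suc m))) 0 (arrs s2 ''B'')"
      have b: "block_inv (arrs s1 ''B'') j (Suc m) (l * Suc m - l + 1) (arrs s2 ''B'')"
        by (rule block_inv_start[OF _ s(4) Sm]) (use p2 post in blast)+
      then have "?out s2" using out1 unfolding block_inv_def by simp
      moreover have "block_inv (arrs s2 ''B'') j (Suc m) (l * Suc m - l + 1) (arrs s2 ''B'')"
        using b unfolding block_inv_def by blast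
      ultimately show "?c s2 \<and> block_inv (arrs s2 ''B'') j (Suc m) (l * Suc m - l + 1) (arrs s2 ''B'')"
        using p2 e1 frame_emitted[OF f2 fr(5)] by simp
    qed
  qed
  have PST: "executes (?S;; ?P;; ?T) s ((40 * l + 30) + tP + tT) (\<lambda>s'. ?c s' \<and> holds (arrs s' ''B'') j (Suc m))"
  proof (rule executes_Seq'[OF PS])
    fix s1 assume s1: "ok s1" and p1: "?c s1 \<and> block_inv (arrs s1 ''B'') j (Suc m) (l * Suc m - l + 1) (arrs s1 ''B'')"
    have env1: "env s1" and j1: "vars s1 ''j'' = int j" and hs1: "arrs s1 ''Hs'' = hs"
      and b1: "block_inv (arrs s1 ''B'') j (Suc m) (l * Suc m - l + 1) (arrs s1 ''B'')"
      and out1: "?out s1" and e1: "emitted s1 = emitted s" using p1 by blast+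
    have lB: "length (arrs s1 ''B'') = J * (2 * l)" using env1 by (simp add: env_def)
    show "executes ?T s1 tT (\<lambda>s'. ?c s' \<and> holds (arrs s' ''B'') j (Suc m))"
      unfolding tT_def
    proof (rule executes_conseq[OF sum_step[OF s1 env1 j1 hs1 s(4,5) hsj m(2) Sm lB b1] le_refl])
      fix s2 assume f2: "frame ?T s1 s2" and p2: "env s2 \<and> vars s2 ''j'' = int j \<and> arrs s2 ''Hs'' = hs \<and>
        (\<forall>k. k div (2 * l) \<noteq> j - 1 \<longrightarrow> arrs s2 ''B'' ! k = arrs s1 ''B'' ! k) \<and> holds (arrs s2 ''B'') j (Suc m)"
      then show "?c s2 \<and> holds (arrs s2 ''B'') j (Suc m)"
        using e1 frame_emitted[OF f2 fr(6)] out1 by simp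
    qed
  qed
  have vl: "l * Suc m - l + 1 = l * m + 1" by simp
  have F: "executes ?F s1 (20 * l + 15) (\<lambda>s'. env s' \<and> vars s' ''j'' = int j \<and> arrs s' ''Hs'' = hs \<and>
       ?out s' \<and> holds (arrs s' ''B'') j (Suc m) \<and>
       emitted s' = emitted s @ (if j = 1 then values_list (l * m + 1) (l * Suc m + 1) else []))"
    if s1: "ok s1" and p1: "?c s1 \<and> holds (arrs s1 ''B'') j (Suc m)" for s1
  proof (rule executes_le, rule executes_If[OF s1])
    show "exp_val (Var ''j'' \<^bold>= Const 1) s1 = Some (of_bool (j = 1))" using p1 by simp
    show "executes emit_block s1 (20 * l + 10) (\<lambda>s'. env s' \<and> vars s' ''j'' = int j \<and> arrs s' ''Hs'' = hs \<and>
       ?out s' \<and> holds (arrs s' ''B'') j (Suc m) \<and>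
       emitted s' = emitted s @ (if j = 1 then values_list (l * m + 1) (l * Suc m + 1) else []))"
      if j1: "of_bool (j = 1) \<noteq> (0::int)"
    proof -
      have j: "j = 1" using j1 by (simp split: if_splits)
      have h: "arrs s1 ''Hs'' ! 1 = int (l * Suc m)" using p1 hsj j by simp
      have hd: "holds (arrs s1 ''B'') 1 (Suc m)" and env1: "env s1" using p1 j by auto
      show ?thesis
      proof (rule executes_conseq[OF emit_block[OF s1 env1 h Sm m(2) hd] le_refl])
        fix s2 assume f: "frame emit_block s1 s2"
          and e: "emitted s2 = emitted s1 @ values_list (l * Suc m - l + 1) (l * Suc m + 1)"
        have ar: "arrs s2 A = arrs s1 A" for A using frame_arr[OF f] by simp
        have va: "vars s2 x = vars s1 x" if "x \<noteq> ''i''" for x using frame_var[OF f] that by simp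
        have "emitted s2 = emitted s @ (if j = 1 then values_list (l * m + 1) (l * Suc m + 1) else [])"
          using e p1 j unfolding vl by simp
        moreover have "env s2" using env1 va ar by (simp add: env_def)
        ultimately show "env s2 \<and> vars s2 ''j'' = int j \<and> arrs s2 ''Hs'' = hs \<and>
           ?out s2 \<and> holds (arrs s2 ''B'') j (Suc m) \<and>
           emitted s2 = emitted s @ (if j = 1 then values_list (l * m + 1) (l * Suc m + 1) else [])"
          using p1 va ar by simp
      qed
    qed
    show "executes Skip s1 1 (\<lambda>s'. env s' \<and> vars s' ''j'' = int j \<and> arrs s' ''Hs'' = hs \<and>
       ?out s' \<and> holds (arrs s' ''B'') j (Suc m) \<and>
       emitted s' = emitted s @ (if j = 1 then values_list (l * m + 1) (l * Suc m + 1) else []))"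
      if j1: "of_bool (j = 1) = (0::int)"
      by (rule executes_Skip[OF s1]) (use p1 j1 in \<open>simp split: if_splits\<close>)
  qed auto
  have tP: "tP \<le> 45 * (l * log_bound R) + 65 * floor_sqrt N + 10"
    using product_time_le[OF m(2)] unfolding tP_def by linarith
  have tT: "tT = l * (kMax_time (log_bound R) + 70) + 45 * (kMax_total (l * Suc m) - kMax_total (l * m)) + 10"
  proof -
    have "1 * 1 \<le> l * m" using pos m(3) by (intro mult_mono) auto
    moreover have "l * Suc m = l * m + l" by simp
    ultimately have "{2..l * Suc m} = {2..l * m} \<union> {l * m + 1..l * Suc m}"
      by (intro set_eqI) (simp only: atLeastAtMost_iff Un_iff, linarith)
    then have "kMax_total (l * Suc m) = kMax_total (l * m) + (\<Sum>n\<in>{l * m + 1..l * Suc m}. kMax n)"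
      unfolding kMax_total_def by (simp only:) (rule sum.union_disjoint; auto)
    then have k: "(\<Sum>n\<in>{l * m + 1..l * Suc m}. kMax n) = kMax_total (l * Suc m) - kMax_total (l * m)" by simp
    have "card {l * m + 1..l * Suc m} = l" by simp
    then have "(\<Sum>n\<in>{l * m + 1..l * Suc m}. kMax_time (log_bound R) + 70 + 45 * kMax n)
      = l * (kMax_time (log_bound R) + 70) + 45 * (\<Sum>n\<in>{l * m + 1..l * Suc m}. kMax n)"
      by (simp only: sum.distrib sum_constant sum_distrib_left[symmetric] distrib_left of_nat_id)
    then show ?thesis unfolding tT_def vl k by simp
  qed
  show ?thesis
    unfolding hs_def[symmetric]
    by (rule executes_le, rule executes_Seq'[OF PST], rule F, assumption, assumption)
      (use tP in \<open>simp add: tT algebra_simps\<close>)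
qed

end


context space_params
begin

definition live :: "nat \<Rightarrow> nat \<Rightarrow> bool" where
  "live j K \<longleftrightarrow> j = 1 \<or> g < ceil_div K j"

definition top :: "nat \<Rightarrow> nat \<Rightarrow> nat" where
  "top j K = max g (ceil_div K j)"

definition block_state :: "state \<Rightarrow> nat \<Rightarrow> nat \<Rightarrow> bool" where
  "block_state s j K \<longleftrightarrow>
     (if live j K then arrs s ''init'' ! j = 1 \<and> arrs s ''Hs'' ! j = int (l * top j K) \<and> holds (arrs s ''B'') j (top j K)
      else arrs s ''init'' ! j = 0)"

lemma block_state_cong:
  assumes "block_state s j K" "1 \<le> j" "arrs s' ''init'' ! j = arrs s ''init'' ! j" "arrs s' ''Hs'' ! j = arrs s ''Hs'' ! j"
    "\<And>k. k div (2 * l) = j - 1 \<Longrightarrow> arrs s' ''B'' ! k = arrs s ''B'' ! k"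
  shows "block_state s' j K"
  using assms idx_div unfolding block_state_def holds_def by (simp split: if_splits)

lemma block_state_dead: "\<not> live j K \<Longrightarrow> \<not> live j K' \<Longrightarrow> block_state s j K = block_state s j K'"
  by (simp add: block_state_def)

lemma top_ge: "2 \<le> top j K"
  using g_ge by (simp add: top_def)

lemma blocks_le_J: "g * j < blocks \<Longrightarrow> j < J"
proof -
  assume "g * j < blocks"
  have "J = ceil_div blocks g"
    using ceil_div_mult[of l g blocks] pos g_ge H_eq N_eq by (simp add: J_def)
  then show "j < J" using \<open>g * j < blocks\<close> g_ge by (simp add: less_ceil_div_iff)
qed

text \<open>
  \<open>b \<le> H\<^sub>j / a\<close> beyond \<open>H\<close> lies in the upper half of \<open>B\<^sub>a\<^sub>j\<close>, which was brought up to date before,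
  because \<open>\<lceil>\<lceil>K / j\<rceil> / a\<rceil> = \<lceil>K / (a j)\<rceil>\<close>.
\<close>

lemma pairs_readableI:
  assumes "Suc K \<le> blocks" "1 \<le> j" "j \<le> J" "m = ceil_div (Suc K) j"
    and bs: "\<And>j'. j < j' \<Longrightarrow> j' \<le> J \<Longrightarrow> block_state s j' (Suc K)"
  shows "pairs_readable (arrs s ''Hs'') (arrs s ''B'') j m"
  unfolding pairs_readable_def
proof (intro allI impI)
  fix a b assume ab: "2 \<le> a \<and> upper m (a * b) \<and> H < l * m div a"
  define m' where "m' = ceil_div (Suc K) (a * j)"
  have a: "1 \<le> a" "1 \<le> a * j" using ab assms(2) by (auto simp: Suc_le_eq)
  have m': "m' = ceil_div m a" using ceil_div_ceil_div[of j a "Suc K"] assms a by (simp add: m'_def)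
  have "H < l * m div a" using ab by simp
  then have "\<not> l * m div a \<le> l * g" using H_eq by linarith
  then have "a * (l * g) < l * m"
    using a(1) by (metis div_le_mono nonzero_mult_div_cancel_left not_le not_one_le_zero)
  then have "l * (a * g) < l * m" by (simp add: mult.left_commute)
  then have "a * g < m" by simp
  then have gm: "g < m'" unfolding m' using a(1) by (simp add: less_ceil_div_iff)
  then have "g * (a * j) < blocks"
    using assms(1) a(2) by (simp add: m'_def less_ceil_div_iff mult.commute)
  then have ajJ: "a * j < J" by (rule blocks_le_J)
  have "1 * j < a * j" using ab assms(2) by (intro mult_strict_right_mono) auto
  then have "block_state s (a * j) (Suc K)" using bs ajJ by simp
  moreover have "live (a * j) (Suc K)" "top (a * j) (Suc K) = m'"
    using gm by (auto simp: live_def top_def m'_def)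
  ultimately have bs': "arrs s ''Hs'' ! (a * j) = int (l * m')" "holds (arrs s ''B'') (a * j) m'"
    by (auto simp: block_state_def)
  have up: "l * m < a * b + l" "a * b \<le> l * m" using ab by (auto simp: upper_def)
  have "a * b \<le> a * (l * m')"
  proof -
    have "l * m \<le> l * (a * m')" unfolding m' using le_ceil_div[OF a(1), of m] by (intro mult_left_mono) auto
    moreover have "l * (a * m') = a * (l * m')" by simp
    ultimately show ?thesis using up(2) by linarith
  qed
  then have b1: "b \<le> l * m'" using a(1) by simp
  have b2: "l * m' < b + l"
  proof -
    have "a * (m' - 1) < m"
      using less_ceil_div_iff[OF a(1), of "m' - 1" m] gm by (simp flip: m')
    then have "l * (a * (m' - 1) + 1) \<le> l * m" by (intro mult_left_mono) auto
    moreover have "l * (a * (m' - 1) + 1) = a * (l * (m' - 1)) + l" by (simp add: algebra_simps)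
    ultimately have "a * (l * (m' - 1)) + l < a * b + l" using up(1) by linarith
    then have "a * (l * (m' - 1)) < a * b" by linarith
    then have "l * (m' - 1) < b" by simp
    moreover have "l * m' = l * (m' - 1) + l" using gm by (cases m') auto
    ultimately show ?thesis by linarith
  qed
  have w: "window m' b" using b1 b2 by (simp add: window_def)
  then have "arrs s ''B'' ! idx (a * j) m' b = int (complexity b)" using bs'(2) by (simp add: holds_def)
  then show "a * j \<le> J \<and> (\<exists>m'. arrs s ''Hs'' ! (a * j) = int (l * m') \<and> window m' b \<and>
       arrs s ''B'' ! idx (a * j) m' b = int (complexity b))"
    using ajJ w bs'(1) by (intro conjI exI[of _ m']) auto
qed

definition process_block :: com where
  "process_block =
    (''newH'' ::= Var ''l'' \<^bold>* ((Var ''h'' \<^bold>+ Var ''j'' \<^bold>* Var ''l'' \<^bold>- Const 1) \<^bold>/ (Var ''j'' \<^bold>* Var ''l''));;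
     (IF Read ''init'' (Var ''j'') \<^bold>= Const 0
      THEN IF Var ''H'' \<^bold>< Var ''newH'' THEN initialize (Var ''j'') ELSE Skip
      ELSE Skip);;
     (IF Read ''init'' (Var ''j'') \<^bold>= Const 1
      THEN IF Read ''Hs'' (Var ''j'') \<^bold>< Var ''newH''
           THEN shift (Var ''j'');;
                product_step (Var ''j'');;
                sum_step (Var ''j'');;
                (IF Var ''j'' \<^bold>= Const 1 THEN emit_block ELSE Skip)
           ELSE Skip
      ELSE Skip);;
     ''j'' ::= Var ''j'' \<^bold>- Const 1)"

lemma process_block:
  assumes s: "ok s" "env s" "vars s ''j'' = int j" "vars s ''h'' = int (l * Suc K)"
    and K: "Suc K \<le> blocks" "g \<le> K" and j: "1 \<le> j" "j \<le> J"
    and bs: "\<And>j'. 1 \<le> j' \<Longrightarrow> j' \<le> J \<Longrightarrow> block_state s j' (if j < j' then Suc K else K)"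
  shows "executes process_block s (overhead + 45 * (kMax_total (l * top j (Suc K)) - kMax_total (l * top j K)))
     (\<lambda>s'. env s' \<and> vars s' ''j'' = int j - 1 \<and> vars s' ''h'' = int (l * Suc K) \<and>
       (\<forall>j'. 1 \<le> j' \<and> j' \<le> J \<longrightarrow> block_state s' j' (if j \<le> j' then Suc K else K)) \<and>
       emitted s' = emitted s @ (if j = 1 then values_list (l * K + 1) (l * Suc K + 1) else []))"
proof -
  define m where "m = top j K"
  define y where "y = ceil_div (Suc K) j"
  have yN: "l * y \<le> N"
  proof -
    have "1 * Suc K \<le> j * Suc K" using j(1) by (intro mult_right_mono) auto
    then have "y \<le> Suc K" unfolding y_def using ceil_div_le_iff[OF j(1), of "Suc K" "Suc K"] by (simp only: mult_1)
    then have "l * y \<le> l * blocks" using K(1) by (intro mult_left_mono) auto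
    then show ?thesis using N_eq by linarith
  qed
  have jlJ: "j < J + 1" using j by simp
  have top1: "top 1 K = K" "top 1 (Suc K) = Suc K" using K(2) by (simp_all add: top_def ceil_div_1[unfolded One_nat_def])
  have first: "m = K" "y = Suc K" if "j = 1"
    using top1 ceil_div_1 that by (simp_all only: m_def y_def)
  have step: "y \<le> Suc (ceil_div K j)" "ceil_div K j \<le> y"
    unfolding y_def using j(1) by (auto intro: ceil_div_Suc ceil_div_mono)
  have upd: "m < y \<Longrightarrow> y = Suc m" "m < y \<Longrightarrow> top j (Suc K) = y" "\<not> m < y \<Longrightarrow> top j (Suc K) = m"
    using step unfolding m_def y_def[symmetric] top_def by auto
  have live_mono: "live j K \<Longrightarrow> live j (Suc K)" using step unfolding live_def y_def[symmetric] by auto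
  have fresh: "\<not> live j K \<Longrightarrow> m = g" unfolding live_def m_def top_def by auto
  have m_less: "m < y \<Longrightarrow> live j (Suc K)" unfolding live_def y_def m_def top_def by auto
  let ?b0 = "\<lambda>s'. env s' \<and> vars s' ''j'' = int j \<and> vars s' ''h'' = int (l * Suc K) \<and> vars s' ''newH'' = int (l * y)"
  let ?others = "\<lambda>s'. \<forall>j'. 1 \<le> j' \<and> j' \<le> J \<and> j' \<noteq> j \<longrightarrow> block_state s' j' (if j < j' then Suc K else K)"
  let ?b1 = "\<lambda>s'. ?b0 s' \<and> emitted s' = emitted s \<and> ?others s' \<and>
     (if live j (Suc K) then arrs s' ''init'' ! j = 1 \<and> arrs s' ''Hs'' ! j = int (l * m) \<and> holds (arrs s' ''B'') j m
      else arrs s' ''init'' ! j = 0)"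
  let ?b2 = "\<lambda>s'. env s' \<and> vars s' ''j'' = int j \<and> vars s' ''h'' = int (l * Suc K) \<and>
       (\<forall>j'. 1 \<le> j' \<and> j' \<le> J \<longrightarrow> block_state s' j' (if j \<le> j' then Suc K else K)) \<and>
       emitted s' = emitted s @ (if j = 1 then values_list (l * K + 1) (l * Suc K + 1) else [])"
  let ?S1 = "''newH'' ::= Var ''l'' \<^bold>* ((Var ''h'' \<^bold>+ Var ''j'' \<^bold>* Var ''l'' \<^bold>- Const 1) \<^bold>/ (Var ''j'' \<^bold>* Var ''l''))"
  let ?init = "initialize (Var ''j'')"
  let ?S2a = "IF Var ''H'' \<^bold>< Var ''newH'' THEN ?init ELSE Skip"
  let ?S2 = "IF Read ''init'' (Var ''j'') \<^bold>= Const 0 THEN ?S2a ELSE Skip"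
  let ?U = "shift (Var ''j'');; product_step (Var ''j'');; sum_step (Var ''j'');;
     (IF Var ''j'' \<^bold>= Const 1 THEN emit_block ELSE Skip)"
  let ?S3a = "IF Read ''Hs'' (Var ''j'') \<^bold>< Var ''newH'' THEN ?U ELSE Skip"
  let ?S3 = "IF Read ''init'' (Var ''j'') \<^bold>= Const 1 THEN ?S3a ELSE Skip"
  have S1: "executes ?S1 s 8 (\<lambda>s'. ?b0 s' \<and> arrs s' = arrs s \<and> emitted s' = emitted s)"
  proof (rule executes_le, rule executes_Assign[OF s(1)])
    have lj: "1 \<le> l * j" using pos j by (simp add: Suc_le_eq)
    have e: "(l * Suc K + l * j - 1) div (l * j) = y"
      unfolding y_def using pos j by (intro ceil_div_mult) auto
    have A: "int (l * Suc K) + int j * int l - 1 = int (l * Suc K + l * j - 1)"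
      using lj by (simp add: of_nat_diff mult.commute)
    have B: "int j * int l = int (l * j)" by simp
    have "(int (l * Suc K) + int j * int l - 1) div (int j * int l) = int y"
      by (subst A, subst B) (simp only: zdiv_int[symmetric] e)
    then show "exp_val (Var ''l'' \<^bold>* ((Var ''h'' \<^bold>+ Var ''j'' \<^bold>* Var ''l'' \<^bold>- Const 1) \<^bold>/ (Var ''j'' \<^bold>* Var ''l''))) s
      = Some (int (l * y))"
      using s j pos by (simp add: env_def del: of_nat_Suc)
    show "\<bar>int (l * y)\<bar> \<le> V" using le_V_linear[of "l * y"] yN R_le by linarith
    let ?s = "s\<lparr>vars := (vars s)(''newH'' := int (l * y))\<rparr>"
    show "?b0 ?s \<and> arrs ?s = arrs s \<and> emitted ?s = emitted s" using s by (simp add: env_def)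
  qed auto
  have bsj: "block_state s j K" using bs[of j] j by simp
  have S2: "executes ?S2 s1 (30 * l + 50) ?b1"
    if s1: "ok s1" and p1: "?b0 s1 \<and> arrs s1 = arrs s \<and> emitted s1 = emitted s" for s1
  proof -
    have oth: "?others s1" using bs p1 by (auto simp: block_state_def)
    have bj: "block_state s1 j K" using bsj p1 by (simp add: block_state_def)
    have iv: "arrs s1 ''init'' ! j = of_bool (live j K)" using bj by (simp add: block_state_def)
    have li: "length (arrs s1 ''init'') = J + 1" using p1 unfolding env_def by blast
    have g: "int H < int (l * y) \<longleftrightarrow> g < y"
    proof -
      have "H < l * y \<longleftrightarrow> l * g < l * y" using H_eq by simp
      also have "\<dots> \<longleftrightarrow> g < y" using pos by simp
      finally show ?thesis by (simp only: of_nat_less_iff)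
    qed
    have tst: "exp_val (Read ''init'' (Var ''j'') \<^bold>= Const 0) s1 = Some (of_bool (\<not> live j K))"
      using p1 iv li jlJ by simp
    have stay: "?b1 s1" if "live j K"
      using that live_mono p1 oth bj by (simp add: block_state_def m_def)
    have dead: "?b1 s1" if "\<not> live j K" "\<not> g < y"
    proof -
      have "\<not> live j (Suc K)" using that unfolding live_def y_def by simp
      then show ?thesis using that p1 oth bj by (simp add: block_state_def)
    qed
    have S2a: "executes ?S2a s1 (30 * l + 45) ?b1" if nl: "\<not> live j K"
    proof (rule executes_le, rule executes_If[OF s1])
      show "exp_val (Var ''H'' \<^bold>< Var ''newH'') s1 = Some (of_bool (g < y))"
        using p1 g by (simp add: env_def del: of_nat_mult)
      show "executes Skip s1 1 ?b1" if "of_bool (g < y) = (0::int)"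
        by (rule executes_Skip[OF s1]) (use dead[OF nl] that in simp)
      show "executes ?init s1 (30 * l + 30) ?b1" if gy: "of_bool (g < y) \<noteq> (0::int)"
      proof -
        have env1: "env s1" and ie: "index_exp (Var ''j'') s1 j" using p1 by (auto simp: index_exp_def)
        show ?thesis
        proof (rule executes_conseq[OF initialize[OF s1 env1 ie j] le_refl])
          fix s2 assume f: "frame ?init s1 s2" and p2: "env s2 \<and>
             arrs s2 ''Hs'' = (arrs s1 ''Hs'')[j := int H] \<and> arrs s2 ''init'' = (arrs s1 ''init'')[j := 1] \<and>
             (\<forall>k. k div (2 * l) \<noteq> j - 1 \<longrightarrow> arrs s2 ''B'' ! k = arrs s1 ''B'' ! k) \<and> holds (arrs s2 ''B'') j g"
          have v: "vars s2 x = vars s1 x" if "x \<noteq> ''i''" for x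
            using frame_var[OF f, of x] that by (simp add: initialize_def)
          have e: "emitted s2 = emitted s1" using frame_emitted[OF f] by (simp add: initialize_def)
          have lh: "length (arrs s1 ''Hs'') = J + 1" using env1 by (simp add: env_def)
          have "?others s2"
          proof (intro allI impI)
            fix j' assume j': "1 \<le> j' \<and> j' \<le> J \<and> j' \<noteq> j"
            show "block_state s2 j' (if j < j' then Suc K else K)"
            proof (rule block_state_cong)
              show "block_state s1 j' (if j < j' then Suc K else K)" using oth j' by blast
              show "arrs s2 ''B'' ! k = arrs s1 ''B'' ! k" if "k div (2 * l) = j' - 1" for k
              proof -
                have "k div (2 * l) \<noteq> j - 1" using that j' j by linarith
                then show ?thesis using p2 by blast
              qed
            qed (use p2 j' in auto)
          qed
          moreover have "live j (Suc K)" using gy unfolding live_def y_def by (simp split: if_splits)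
          moreover have "arrs s2 ''init'' ! j = 1" "arrs s2 ''Hs'' ! j = int (l * m)" "holds (arrs s2 ''B'') j m"
            using p2 li lh jlJ fresh[OF nl] H_eq by auto
          moreover have "?b0 s2" using p2 p1 v by simp
          ultimately show "?b1 s2" using p1 e by simp
        qed
      qed
    qed auto
    show ?thesis
      by (rule executes_le, rule executes_If[OF s1 tst], simp, rule S2a, simp split: if_splits,
          rule executes_Skip[OF s1], rule stay, simp split: if_splits, simp)
  qed
  have S3: "executes ?S3 s1 (120 + 140 * l + 45 * (l * log_bound R) + 65 * floor_sqrt N + l * kMax_time (log_bound R) +
       45 * (kMax_total (l * top j (Suc K)) - kMax_total (l * top j K))) ?b2"
    if s1: "ok s1" and p1: "?b1 s1" for s1
  proof -
    have li: "length (arrs s1 ''init'') = J + 1" "length (arrs s1 ''Hs'') = J + 1"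
      using p1 unfolding env_def by blast+
    have tst: "exp_val (Read ''init'' (Var ''j'') \<^bold>= Const 1) s1 = Some (of_bool (live j (Suc K)))"
      using p1 li jlJ by (simp split: if_splits)
    have oth: "?others s1" using p1 by blast
    have stay: "?b2 s1" if "\<not> m < y"
    proof -
      have "block_state s1 j (Suc K)"
        using p1 upd(3)[OF that] unfolding block_state_def by (simp split: if_splits)
      then have "block_state s1 j' (if j \<le> j' then Suc K else K)" if "1 \<le> j' \<and> j' \<le> J" for j'
        using oth that by (cases "j' = j") (auto split: if_splits)
      moreover have "j \<noteq> 1" using that first by auto
      ultimately show ?thesis using p1 by simp
    qed
    have S3a: "executes ?S3a s1 (110 + 140 * l + 45 * (l * log_bound R) + 65 * floor_sqrt N + l * kMax_time (log_bound R) +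
       45 * (kMax_total (l * top j (Suc K)) - kMax_total (l * top j K))) ?b2" if lv: "live j (Suc K)"
    proof (rule executes_le, rule executes_If[OF s1])
      have my: "int (l * m) < int (l * y) \<longleftrightarrow> m < y" using pos by (simp only: of_nat_less_iff) simp
      have hm: "arrs s1 ''Hs'' ! j = int (l * m)" "holds (arrs s1 ''B'') j m" using p1 lv by simp_all
      have v: "vars s1 ''j'' = int j" "vars s1 ''newH'' = int (l * y)" and env1: "env s1" using p1 by blast+
      show "exp_val (Read ''Hs'' (Var ''j'') \<^bold>< Var ''newH'') s1 = Some (of_bool (m < y))"
        using v hm(1) li(2) jlJ my by (simp del: of_nat_mult)
      show "executes Skip s1 1 ?b2" if "of_bool (m < y) = (0::int)"
        by (rule executes_Skip[OF s1], rule stay) (use that in \<open>simp split: if_splits\<close>)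
      show "executes ?U s1 (100 + 140 * l + 45 * (l * log_bound R) + 65 * floor_sqrt N + l * kMax_time (log_bound R) +
         45 * (kMax_total (l * top j (Suc K)) - kMax_total (l * top j K))) ?b2"
        if my: "of_bool (m < y) \<noteq> (0::int)"
      proof -
        have y: "y = Suc m" "top j (Suc K) = Suc m" using upd my by (auto split: if_splits)
        have yN': "l * Suc m \<le> N" using yN y by simp
        have m2: "2 \<le> m" using top_ge m_def by simp
        have rd: "pairs_readable (arrs s1 ''Hs'') (arrs s1 ''B'') j (Suc m)"
        proof (rule pairs_readableI[OF K(1) j])
          show "Suc m = ceil_div (Suc K) j" using y(1) y_def by simp
          show "block_state s1 j' (Suc K)" if "j < j'" "j' \<le> J" for j'
          proof -
            have "1 \<le> j' \<and> j' \<le> J \<and> j' \<noteq> j" using that j by linarith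
            then show ?thesis using oth that(1) by fastforce
          qed
        qed
        show ?thesis
        proof (rule executes_conseq[OF update_block[OF s1 env1 v(1) j hm(1) yN' m2 hm(2) rd]])
          fix s2 assume f: "frame ?U s1 s2" and p2: "env s2 \<and> vars s2 ''j'' = int j \<and>
             arrs s2 ''Hs'' = (arrs s1 ''Hs'')[j := int (l * Suc m)] \<and>
             (\<forall>k. k div (2 * l) \<noteq> j - 1 \<longrightarrow> arrs s2 ''B'' ! k = arrs s1 ''B'' ! k) \<and>
             holds (arrs s2 ''B'') j (Suc m) \<and>
             emitted s2 = emitted s1 @ (if j = 1 then values_list (l * m + 1) (l * Suc m + 1) else [])"
          have h: "vars s2 ''h'' = vars s1 ''h''"
            by (rule frame_var[OF f]) (simp add: shift_def product_step_def sum_step_def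
                lower_to_def compute_kMax_def compute_E_def)
          have i: "arrs s2 ''init'' = arrs s1 ''init''"
            by (rule frame_arr[OF f]) (simp add: shift_def product_step_def sum_step_def
                lower_to_def compute_kMax_def compute_E_def)
          have "block_state s2 j' (if j \<le> j' then Suc K else K)" if j': "1 \<le> j' \<and> j' \<le> J" for j'
          proof (cases "j' = j")
            case True
            have "arrs s2 ''Hs'' ! j = int (l * Suc m)" using p2 li(2) jlJ by simp
            then show ?thesis using True lv p1 p2 i y(2) by (simp add: block_state_def)
          next
            case False
            have "block_state s2 j' (if j < j' then Suc K else K)"
            proof (rule block_state_cong)
              show "block_state s1 j' (if j < j' then Suc K else K)" using oth j' False by blast
              show "arrs s2 ''B'' ! k = arrs s1 ''B'' ! k" if "k div (2 * l) = j' - 1" for k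
              proof -
                have "k div (2 * l) \<noteq> j - 1" using that j' j False by linarith
                then show ?thesis using p2 by blast
              qed
            qed (use p2 j' i False in auto)
            then show ?thesis using False by (auto split: if_splits)
          qed
          moreover have "emitted s2 = emitted s @ (if j = 1 then values_list (l * K + 1) (l * Suc K + 1) else [])"
            using p2 p1 first(1) by simp
          ultimately show "?b2 s2" using p1 p2 h by simp
        qed (simp add: y(2) m_def)
      qed
    qed auto
    show ?thesis
    proof (rule executes_le, rule executes_If[OF s1 tst])
      show "executes Skip s1 1 ?b2" if "of_bool (live j (Suc K)) = (0::int)"
      proof (rule executes_Skip[OF s1], rule stay)
        show "\<not> m < y" using m_less that by (auto split: if_splits)
      qed
    qed (use S3a in \<open>auto split: if_splits\<close>)
  qed
  have S12: "executes (?S1;; ?S2) s (8 + (30 * l + 50)) ?b1"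
    by (rule executes_Seq'[OF S1], rule S2)
  define T3 where "T3 = 120 + 140 * l + 45 * (l * log_bound R) + 65 * floor_sqrt N + l * kMax_time (log_bound R) +
       45 * (kMax_total (l * top j (Suc K)) - kMax_total (l * top j K))"
  have S123: "executes (?S1;; ?S2;; ?S3) s (8 + (30 * l + 50) + T3) ?b2"
    unfolding T3_def by (rule executes_Seq'[OF S12], rule S3)
  show ?thesis
    unfolding process_block_def
  proof (rule executes_le, rule executes_Seq'[OF S123], rule executes_Assign)
    fix s1 assume s1: "ok s1" and p1: "?b2 s1"
    have jv: "vars s1 ''j'' = int j" and env1: "env s1" using p1 by blast+
    show "ok s1" by (rule s1)
    show "exp_val (Var ''j'' \<^bold>- Const 1) s1 = Some (int j - 1)" using jv by simp
    show "\<bar>int j - 1\<bar> \<le> V" using le_V_linear[of j] j J_le R_le by linarith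
    let ?s = "s1\<lparr>vars := (vars s1)(''j'' := int j - 1)\<rparr>"
    have "env ?s" using env1 by (simp add: env_def)
    moreover have "block_state ?s j' K' = block_state s1 j' K'" for j' K' by (simp add: block_state_def)
    ultimately show "env ?s \<and> vars ?s ''j'' = int j - 1 \<and> vars ?s ''h'' = int (l * Suc K) \<and>
       (\<forall>j'. 1 \<le> j' \<and> j' \<le> J \<longrightarrow> block_state ?s j' (if j \<le> j' then Suc K else K)) \<and>
       emitted ?s = emitted s @ (if j = 1 then values_list (l * K + 1) (l * Suc K + 1) else [])"
      using p1 by simp
  qed (auto simp: T3_def overhead_def)
qed

end


context space_params
begin

definition main_body :: com where
  "main_body =
    (''h'' ::= Read ''Hs'' (Const 1) \<^bold>+ Var ''l'';;
     (IF Var ''N'' \<^bold>< Var ''h'' THEN ''h'' ::= Var ''N'' ELSE Skip);;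
     ''j'' ::= (Var ''h'' \<^bold>+ Var ''H'' \<^bold>- Const 1) \<^bold>/ Var ''H'' \<^bold>- Const 1;;
     WHILE Const 1 \<^bold>\<le> Var ''j'' DO process_block)"

definition main_inv :: "nat \<Rightarrow> state \<Rightarrow> bool" where
  "main_inv K s \<longleftrightarrow> env s \<and> (\<forall>j. 1 \<le> j \<and> j \<le> J \<longrightarrow> block_state s j K) \<and>
     emitted s = values_list 1 (min (l * K) N + 1)"

definition main_cost :: "nat \<Rightarrow> nat" where
  "main_cost K = (\<Sum>j\<in>{1..J}. overhead + 45 * (kMax_total (l * top j (Suc K)) - kMax_total (l * top j K)) + 2) + 20"

lemma top_1: "g \<le> K \<Longrightarrow> top 1 K = K"
  using ceil_div_1 by (simp add: top_def)

lemma live_1: "live 1 K"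
  by (simp add: live_def)

lemma main_body:
  assumes s: "ok s" "main_inv K s" and K: "g \<le> K" "Suc K \<le> blocks"
  shows "executes main_body s (main_cost K) (main_inv (Suc K))"
proof -
  define j0 where "j0 = ceil_div (Suc K) g - 1"
  have lKN: "l * Suc K \<le> N"
  proof -
    have "l * Suc K \<le> l * blocks" using K(2) by (intro mult_left_mono) auto
    then show ?thesis using N_eq by linarith
  qed
  have g1: "1 \<le> g" using g_ge by simp
  have cd: "1 < ceil_div (Suc K) g" using K(1) g1 by (simp add: less_ceil_div_iff)
  have j0: "1 \<le> j0" "j0 < J"
  proof -
    show "1 \<le> j0" using cd by (simp add: j0_def)
    have "ceil_div (Suc K) g - 1 < ceil_div (Suc K) g" using cd by simp
    then have "g * j0 < Suc K" using g1 unfolding j0_def by (simp add: less_ceil_div_iff)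
    then show "j0 < J" using K(2) by (intro blocks_le_J) simp
  qed
  have dead: "\<not> live j' (Suc K)" "\<not> live j' K" if "j0 < j'" for j'
  proof -
    have j': "ceil_div (Suc K) g \<le> j'" "1 \<le> j'" "j' \<noteq> 1" using that cd j0(1) by (auto simp: j0_def)
    then have "Suc K \<le> g * j'" using g1 by (simp add: ceil_div_le_iff)
    then have "ceil_div (Suc K) j' \<le> g" "ceil_div K j' \<le> g"
      using j'(2) by (simp_all add: ceil_div_le_iff mult.commute)
    then show "\<not> live j' (Suc K)" "\<not> live j' K" using j' by (auto simp: live_def)
  qed
  have env: "env s" and bs: "\<And>j. 1 \<le> j \<Longrightarrow> j \<le> J \<Longrightarrow> block_state s j K"
    and em: "emitted s = values_list 1 (l * K + 1)"
    using s(2) lKN by (auto simp: main_inv_def)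
  have h1: "arrs s ''Hs'' ! 1 = int (l * K)"
    using bs[of 1] J_ge live_1 top_1[OF K(1)] by (simp add: block_state_def)
  have lh: "1 < length (arrs s ''Hs'')" using env J_ge by (simp add: env_def)
  let ?E = "\<lambda>s'. env s' \<and> arrs s' = arrs s \<and> emitted s' = emitted s"
  let ?A = "''h'' ::= Read ''Hs'' (Const 1) \<^bold>+ Var ''l''"
  let ?B = "IF Var ''N'' \<^bold>< Var ''h'' THEN ''h'' ::= Var ''N'' ELSE Skip"
  let ?C = "''j'' ::= (Var ''h'' \<^bold>+ Var ''H'' \<^bold>- Const 1) \<^bold>/ Var ''H'' \<^bold>- Const 1"
  have A: "executes ?A s 3 (\<lambda>s'. ?E s' \<and> vars s' ''h'' = int (l * Suc K))"
  proof (rule executes_le, rule executes_Assign[OF s(1)])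
    have "int (l * K) + int l = int (l * Suc K)" by simp
    then show "exp_val (Read ''Hs'' (Const 1) \<^bold>+ Var ''l'') s = Some (int (l * Suc K))"
      using env h1 lh by (simp add: env_def del: of_nat_mult)
    show "\<bar>int (l * Suc K)\<bar> \<le> V" using le_V_linear[of "l * Suc K"] lKN R_le by linarith
    show "?E (s\<lparr>vars := (vars s)(''h'' := int (l * Suc K))\<rparr>) \<and>
      vars (s\<lparr>vars := (vars s)(''h'' := int (l * Suc K))\<rparr>) ''h'' = int (l * Suc K)"
      using env by (simp add: env_def)
  qed auto
  have B: "executes ?B s1 4 (\<lambda>s'. ?E s' \<and> vars s' ''h'' = int (l * Suc K))"
    if s1: "ok s1" "?E s1 \<and> vars s1 ''h'' = int (l * Suc K)" for s1
  proof (rule executes_le, rule executes_If[OF s1(1)])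
    have "vars s1 ''N'' = int N" using s1(2) unfolding env_def by blast
    then show "exp_val (Var ''N'' \<^bold>< Var ''h'') s1 = Some (of_bool (int N < int (l * Suc K)))"
      using s1(2) by simp
    show "executes (''h'' ::= Var ''N'') s1 1 (\<lambda>s'. ?E s' \<and> vars s' ''h'' = int (l * Suc K))"
      if "of_bool (int N < int (l * Suc K)) \<noteq> (0::int)"
      using that lKN by (simp only: of_nat_less_iff of_bool_eq_0_iff) linarith
    show "executes Skip s1 1 (\<lambda>s'. ?E s' \<and> vars s' ''h'' = int (l * Suc K))"
      by (rule executes_Skip, rule s1(1), rule s1(2))
  qed auto
  have C: "executes ?C s1 5 (\<lambda>s'. ?E s' \<and> vars s' ''h'' = int (l * Suc K) \<and> vars s' ''j'' = int j0)"
    if s1: "ok s1" and p1: "?E s1 \<and> vars s1 ''h'' = int (l * Suc K)" for s1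
  proof (rule executes_le, rule executes_Assign[OF s1])
    have e: "(l * Suc K + H - 1) div H = ceil_div (Suc K) g"
      using ceil_div_mult[of l g "Suc K"] pos g1 H_eq by simp
    have A: "int (l * Suc K) + int H - 1 = int (l * Suc K + H - 1)"
      using pos by (simp add: of_nat_diff)
    have "(int (l * Suc K) + int H - 1) div int H - 1 = int j0"
    proof -
      have "int (l * Suc K + H - 1) div int H = int (ceil_div (Suc K) g)" by (simp only: zdiv_int[symmetric] e)
      then show ?thesis unfolding A j0_def using cd by (simp add: of_nat_diff)
    qed
    moreover have "vars s1 ''H'' = int H" using p1 unfolding env_def by blast
    ultimately show "exp_val ((Var ''h'' \<^bold>+ Var ''H'' \<^bold>- Const 1) \<^bold>/ Var ''H'' \<^bold>- Const 1) s1 = Some (int j0)"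
      using p1 pos by (simp del: of_nat_mult)
    show "\<bar>int j0\<bar> \<le> V" using le_V_linear[of j0] j0(2) J_le R_le by linarith
    let ?s = "s1\<lparr>vars := (vars s1)(''j'' := int j0)\<rparr>"
    have "env s1" using p1 by blast
    then have "env ?s" by (simp add: env_def)
    then show "?E ?s \<and> vars ?s ''h'' = int (l * Suc K) \<and> vars ?s ''j'' = int j0" using p1 by simp
  qed auto
  let ?\<tau> = "\<lambda>j. overhead + 45 * (kMax_total (l * top j (Suc K)) - kMax_total (l * top j K))"
  let ?I = "\<lambda>i s'. env s' \<and> vars s' ''h'' = int (l * Suc K) \<and> vars s' ''j'' = int j0 - int i \<and>
      (\<forall>j'. 1 \<le> j' \<and> j' \<le> J \<longrightarrow> block_state s' j' (if j0 - i < j' then Suc K else K)) \<and>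
      emitted s' = values_list 1 (l * (if i = j0 then Suc K else K) + 1)"
  have loop: "executes (WHILE Const 1 \<^bold>\<le> Var ''j'' DO process_block) s1
     ((\<Sum>i<j0. ?\<tau> (j0 - i) + exp_time (Const 1 \<^bold>\<le> Var ''j'') + 1) + exp_time (Const 1 \<^bold>\<le> Var ''j'') + 1) (?I j0)"
    if s1: "ok s1" "?I 0 s1" for s1
  proof (rule executes_While[where I = ?I])
    show "exp_val (Const 1 \<^bold>\<le> Var ''j'') s' = Some (of_bool (i < j0))" if "i \<le> j0" "ok s'" "?I i s'" for i s'
      using that by simp
    show "executes process_block s' (?\<tau> (j0 - i)) (?I (Suc i))" if i: "i < j0" "ok s'" "?I i s'" for i s'
    proof -
      define j where "j = j0 - i"
      have j: "1 \<le> j" "j \<le> J" "int j0 - int i = int j" using i(1) j0(2) by (auto simp: j_def)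
      have p: "env s'" "vars s' ''j'' = int j" "vars s' ''h'' = int (l * Suc K)"
        "emitted s' = values_list 1 (l * K + 1)" using i j(3) by auto
      have pb: "block_state s' j' (if j < j' then Suc K else K)" if "1 \<le> j'" "j' \<le> J" for j'
        using i(3) that unfolding j_def by blast
      show ?thesis
        unfolding j_def[symmetric]
      proof (rule executes_conseq[OF process_block[OF i(2) p(1-3) K(2,1) j(1,2) pb] le_refl], assumption, assumption)
        fix s2 assume p2: "env s2 \<and> vars s2 ''j'' = int j - 1 \<and> vars s2 ''h'' = int (l * Suc K) \<and>
          (\<forall>j'. 1 \<le> j' \<and> j' \<le> J \<longrightarrow> block_state s2 j' (if j \<le> j' then Suc K else K)) \<and>
          emitted s2 = emitted s' @ (if j = 1 then values_list (l * K + 1) (l * Suc K + 1) else [])"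
        have e: "j0 - Suc i < j' \<longleftrightarrow> j \<le> j'" if "1 \<le> j'" for j' using that i(1) unfolding j_def by linarith
        have f: "j = 1 \<longleftrightarrow> Suc i = j0" using i(1) unfolding j_def by linarith
        have "values_list 1 (l * K + 1) @ values_list (l * K + 1) (l * Suc K + 1) = values_list 1 (l * Suc K + 1)"
          by (rule values_list_append) auto
        then have "emitted s2 = values_list 1 (l * (if Suc i = j0 then Suc K else K) + 1)"
          using p2 p(4) f by auto
        moreover have "vars s2 ''j'' = int j0 - int (Suc i)" using p2 j(3) by simp
        moreover have "\<forall>j'. 1 \<le> j' \<and> j' \<le> J \<longrightarrow> block_state s2 j' (if j0 - Suc i < j' then Suc K else K)"
          using p2 e by simp
        ultimately show "?I (Suc i) s2" using p2 by blast
      qed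
    qed
  qed (use s1 in auto)
  have AB: "executes (?A;; ?B) s (3 + 4) (\<lambda>s'. ?E s' \<and> vars s' ''h'' = int (l * Suc K))"
    by (rule executes_Seq'[OF A], rule B)
  have ABC: "executes (?A;; ?B;; ?C) s (3 + 4 + 5) (\<lambda>s'. ?E s' \<and> vars s' ''h'' = int (l * Suc K) \<and> vars s' ''j'' = int j0)"
    by (rule executes_Seq'[OF AB], rule C)
  have start: "?I 0 s1" if "?E s1 \<and> vars s1 ''h'' = int (l * Suc K) \<and> vars s1 ''j'' = int j0" for s1
  proof -
    have "block_state s1 j' (if j0 - 0 < j' then Suc K else K)" if j': "1 \<le> j' \<and> j' \<le> J" for j'
    proof -
      have "block_state s1 j' K" using bs[of j'] j' \<open>?E s1 \<and> _\<close> by (simp add: block_state_def)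
      then show ?thesis using block_state_dead[of j' "Suc K" K s1] dead[of j'] by auto
    qed
    then show ?thesis using that em j0(1) by auto
  qed
  have "(\<Sum>i<j0. ?\<tau> (j0 - i) + exp_time (Const 1 \<^bold>\<le> Var ''j'') + 1) = (\<Sum>j\<in>{1..j0}. ?\<tau> j + 2)"
    by (rule sum.reindex_bij_witness[of _ "\<lambda>j. j0 - j" "\<lambda>i. j0 - i"]) auto
  also have "\<dots> \<le> (\<Sum>j\<in>{1..J}. ?\<tau> j + 2)" using j0 by (intro sum_mono2) auto
  finally have time: "(\<Sum>i<j0. ?\<tau> (j0 - i) + exp_time (Const 1 \<^bold>\<le> Var ''j'') + 1) \<le> \<dots>" .
  show ?thesis
    unfolding main_body_def
  proof (rule executes_le, rule executes_Seq'[OF ABC], rule executes_conseq[OF loop le_refl])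
    fix s' assume p: "?I j0 s'"
    have "block_state s' j (Suc K)" if "1 \<le> j \<and> j \<le> J" for j
      using p that by force
    moreover have "min (l * Suc K) N = l * Suc K" using lKN by simp
    ultimately show "main_inv (Suc K) s'" using p unfolding main_inv_def by simp
  qed (use start time in \<open>auto simp: main_cost_def\<close>)
qed

lemma ok_input_state: "ok (input_state N H l)"
  using le_V_linear[of N] le_V_linear[of H] le_V_linear[of l] two_l_le R_le V_ge
  by (auto simp: ok_def input_state_def)

lemma emit_first:
  assumes s: "ok s" "vars s ''H'' = int H" "vars s ''N'' = int N" "length (arrs s ''B0'') = H + 1"
    "\<forall>n\<in>{1..H}. arrs s ''B0'' ! n = int (complexity n)" "emitted s = []"
  shows "executes (FOR ''i'' FROM Const 1 TO Var ''H'' DO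
       (IF Var ''i'' \<^bold>\<le> Var ''N'' THEN Emit (Read ''B0'' (Var ''i'')) ELSE Skip)) s (10 * H + 10)
     (\<lambda>s'. emitted s' = values_list 1 (min H N + 1))"
proof (rule executes_conseq, rule executes_For[OF s(1), where n = H and a = 1 and h = "int H" and \<tau> = "\<lambda>_. 4" and
    I = "\<lambda>i s'. vars s' ''H'' = int H \<and> vars s' ''N'' = int N \<and> arrs s' = arrs s \<and>
      emitted s' = values_list 1 (min i N + 1)"])
  show "\<bar>int H\<bar> < V" using le_V_linear[of H] R_le by linarith
  show "executes (IF Var ''i'' \<^bold>\<le> Var ''N'' THEN Emit (Read ''B0'' (Var ''i'')) ELSE Skip) s' 4
     (\<lambda>s'. vars s' ''H'' = int H \<and> vars s' ''N'' = int N \<and> arrs s' = arrs s \<and>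
      emitted s' = values_list 1 (min (Suc i) N + 1))"
    if i: "i < H" "ok s'" "vars s' ''H'' = int H \<and> vars s' ''N'' = int N \<and> arrs s' = arrs s \<and>
      emitted s' = values_list 1 (min i N + 1)" "vars s' ''i'' = 1 + int i" for i s'
  proof (rule executes_le, rule executes_If[OF i(2)])
    show "exp_val (Var ''i'' \<^bold>\<le> Var ''N'') s' = Some (of_bool (Suc i \<le> N))" using i by simp
    show "executes (Emit (Read ''B0'' (Var ''i''))) s' (exp_time (Read ''B0'' (Var ''i'')) + 1)
       (\<lambda>s'. vars s' ''H'' = int H \<and> vars s' ''N'' = int N \<and> arrs s' = arrs s \<and>
        emitted s' = values_list 1 (min (Suc i) N + 1))" if "of_bool (Suc i \<le> N) \<noteq> (0::int)"
    proof (rule executes_Emit[OF i(2), where v = "int (complexity (Suc i))"])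
      have "nat (1 + int i) = Suc i" by linarith
      then show "exp_val (Read ''B0'' (Var ''i'')) s' = Some (int (complexity (Suc i)))"
        using i s(4,5) by simp
    qed (use i(3) that in \<open>auto simp: values_list_Suc split: if_splits\<close>)
    show "executes Skip s' 1 (\<lambda>s'. vars s' ''H'' = int H \<and> vars s' ''N'' = int N \<and> arrs s' = arrs s \<and>
        emitted s' = values_list 1 (min (Suc i) N + 1))" if "of_bool (Suc i \<le> N) = (0::int)"
      by (rule executes_Skip[OF i(2)]) (use i(3) that in \<open>auto split: if_splits\<close>)
  qed auto
qed (use s V_ge in \<open>auto simp: values_list_empty\<close>)

definition total_time :: nat where
  "total_time = 200 + 60 * log_bound R + 20 * H + 100 * l + 2 * J + J * (2 * l) +
     (\<Sum>n\<in>{2..H}. kMax_time (log_bound H) + 50 + 16 * kMax n + 20 * floor_sqrt H) +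
     (\<Sum>i<blocks - g. main_cost (g + i) + 5)"

theorem space_improved_correct:
  "executes space_improved (input_state N H l) total_time (\<lambda>s. emitted s = values_list 1 (N + 1))"
proof -
  let ?s0 = "input_state N H l"
  let ?A = "''L'' ::= Const 2 \<^bold>* Var ''l''"
  let ?B = "time_improved ''B0'' (Var ''H'')"
  let ?C = "FOR ''i'' FROM Const 1 TO Var ''H'' DO
       (IF Var ''i'' \<^bold>\<le> Var ''N'' THEN Emit (Read ''B0'' (Var ''i'')) ELSE Skip)"
  let ?D = "compute_bound ''U'' (Var ''N'')"
  let ?F = "''J'' ::= (Var ''N'' \<^bold>+ Var ''H'' \<^bold>- Const 1) \<^bold>/ Var ''H''"
  let ?G1 = "Alloc ''Hs'' (Var ''J'' \<^bold>+ Const 1) (Const 0)"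
  let ?G2 = "Alloc ''init'' (Var ''J'' \<^bold>+ Const 1) (Const 0)"
  let ?G3 = "Alloc ''B'' (Var ''J'' \<^bold>* Var ''L'') (Const 0)"
  let ?M = "initialize (Const 1)"
  let ?W = "WHILE Read ''Hs'' (Const 1) \<^bold>< Var ''N'' DO main_body"
  let ?P0 = "\<lambda>s. vars s ''N'' = int N \<and> vars s ''H'' = int H \<and> vars s ''l'' = int l \<and> vars s ''L'' = int (2 * l)"
  let ?Q0 = "\<lambda>s. length (arrs s ''B0'') = H + 1 \<and> (\<forall>n\<in>{1..H}. arrs s ''B0'' ! n = int (complexity n))"
  let ?e = "\<lambda>s. emitted s = values_list 1 (min H N + 1)"
  define tB where "tB = 20 * log_bound H + 30 + H + (\<Sum>n\<in>{2..H}. kMax_time (log_bound H) + 50 + 16 * kMax n + 20 * floor_sqrt H)"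
  have vs: "vars ?s0 ''N'' = int N" "vars ?s0 ''H'' = int H" "vars ?s0 ''l'' = int l" "emitted ?s0 = []"
    by (auto simp: input_state_def)
  have A: "executes ?A ?s0 2 (\<lambda>s. ?P0 s \<and> emitted s = [])"
    by (rule executes_le, rule executes_Assign[OF ok_input_state, where v = "int (2 * l)"])
      (use vs le_V_linear[of "2 * l"] two_l_le R_le in auto)
  have AB: "executes (?A;; ?B) ?s0 (2 + tB) (\<lambda>s. ?P0 s \<and> ?Q0 s \<and> emitted s = [])"
  proof (rule executes_Seq'[OF A])
    fix s1 assume s1: "ok s1" "?P0 s1 \<and> emitted s1 = []"
    have V1: "int (2 * H ^ 3) < V" using le_V[of "2 * H ^ 3 + 1"] cubes by linarith
    have h1: "vars s1 ''H'' = int H" using s1(2) by blast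
    have l1: "H + 1 \<le> len ''B0''" by (simp add: len_def)
    have e1: "int (log_bound H) \<le> ent ''B0''" using log_bound_mono[of H R] R_le by (simp add: ent_def)
    have r: "u \<le> floor_sqrt H" if "u * u \<le> H" for u
      by (rule le_floor_sqrtI) (use that in \<open>simp add: power2_eq_square\<close>)
    show "executes ?B s1 tB (\<lambda>s. ?P0 s \<and> ?Q0 s \<and> emitted s = [])"
      unfolding tB_def
    proof (rule executes_conseq[OF time_improved[OF s1(1) h1 pos(2) V1 l1 e1 r] le_refl], assumption)
      fix s2 assume f: "frame ?B s1 s2" and q: "?Q0 s2"
      have "vars s2 x = vars s1 x" if "x \<in> {''N'', ''H'', ''l'', ''L''}" for x
        by (rule frame_var[OF f])
          (use that in \<open>auto simp: time_improved_def compute_bound_def lower_to_def compute_kMax_def compute_E_def\<close>)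
      moreover have "emitted s2 = emitted s1"
        by (rule frame_emitted[OF f])
          (simp add: time_improved_def compute_bound_def lower_to_def compute_kMax_def compute_E_def)
      ultimately show "?P0 s2 \<and> ?Q0 s2 \<and> emitted s2 = []" using q s1(2) by simp
    qed
  qed
  have ABC: "executes (?A;; ?B;; ?C) ?s0 (2 + tB + (10 * H + 10)) (\<lambda>s. ?P0 s \<and> ?Q0 s \<and> ?e s)"
  proof (rule executes_Seq'[OF AB])
    fix s1 assume s1: "ok s1" and p1: "?P0 s1 \<and> ?Q0 s1 \<and> emitted s1 = []"
    have "executes ?C s1 (10 * H + 10) ?e" by (rule emit_first[OF s1]) (use p1 in auto)
    then show "executes ?C s1 (10 * H + 10) (\<lambda>s. ?P0 s \<and> ?Q0 s \<and> ?e s)"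
    proof (rule executes_conseq[OF _ le_refl])
      fix s2 assume f: "frame ?C s1 s2" and "?e s2"
      then show "?P0 s2 \<and> ?Q0 s2 \<and> ?e s2" using p1 frame_var[OF f] frame_arr[OF f] by simp
    qed
  qed
  have ABCD: "executes (?A;; ?B;; ?C;; ?D) ?s0 (2 + tB + (10 * H + 10) + (10 * log_bound N + 10))
    (\<lambda>s. ?P0 s \<and> vars s ''U'' = int (log_bound N) \<and> ?Q0 s \<and> ?e s)"
  proof (rule executes_Seq'[OF ABC])
    fix s1 assume s1: "ok s1" and p1: "?P0 s1 \<and> ?Q0 s1 \<and> ?e s1"
    have n1: "vars s1 ''N'' = int N" using p1 by blast
    have V1: "int (2 * N ^ 3) \<le> V" using le_V[of "2 * N ^ 3"] cubes by linarith
    show "executes ?D s1 (10 * log_bound N + 10) (\<lambda>s. ?P0 s \<and> vars s ''U'' = int (log_bound N) \<and> ?Q0 s \<and> ?e s)"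
    proof (rule executes_conseq[OF compute_bound[OF s1 n1 pos(1) _ _ _ V1] le_refl])
      fix s2 assume f: "frame ?D s1 s2" and "vars s2 ''U'' = int (log_bound N)"
      then show "?P0 s2 \<and> vars s2 ''U'' = int (log_bound N) \<and> ?Q0 s2 \<and> ?e s2"
        using p1 frame_var[OF f] frame_arr[OF f] frame_emitted[OF f] by (simp add: compute_bound_def)
    qed auto
  qed
  let ?R = "\<lambda>s. env s \<and> ?e s \<and> arrs s ''init'' = replicate (J + 1) 0"
  have JV: "int J + 1 \<le> V" using le_V_linear[of "J + 1"] J_le R_le by linarith
  have nJ: "nat (int J + 1) = J + 1" "nat (int J * (2 * int l)) = J * (2 * l)"
    by (simp_all add: nat_add_distrib nat_mult_distrib)
  have vJ: "exp_val ((Var ''N'' \<^bold>+ Var ''H'' \<^bold>- Const 1) \<^bold>/ Var ''H'') s1 = Some (int J)"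
    if "?P0 s1 \<and> vars s1 ''U'' = int (log_bound N) \<and> ?Q0 s1 \<and> ?e s1" for s1
  proof -
    have "int N + int H - 1 = int (N + H - 1)" using pos by (simp add: of_nat_diff)
    then show ?thesis using that pos by (simp add: J_def zdiv_int)
  qed
  have init: "executes (?A;; ?B;; ?C;; ?D;; ?F;; ?G1;; ?G2;; ?G3) ?s0
    (2 + tB + (10 * H + 10) + (10 * log_bound N + 10) + 4 + (J + 3) + (J + 3) + (J * (2 * l) + 2)) ?R"
    apply (rule executes_le)
     apply (rule executes_Seq, rule executes_Seq, rule executes_Seq, rule executes_Seq)
     apply (rule executes_conseq[OF ABCD le_refl])
     apply (rule executes_Assign, assumption, rule vJ, assumption)
       apply simp
    subgoal using JV by simp
     apply (rule executes_Alloc[where k = "int J + 1" and v = 0], assumption)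
            apply simp
           apply simp
          apply simp
         apply simp
        apply simp
    subgoal by (simp add: nJ len_def)
    subgoal using V_ge by (simp add: ent_def)
     apply (rule executes_Alloc[where k = "int J + 1" and v = 0], assumption)
            apply simp
           apply simp
          apply simp
         apply simp
        apply simp
    subgoal by (simp add: nJ len_def)
    subgoal by (simp add: ent_def)
     apply (rule executes_Alloc[where k = "int J * (2 * int l)" and v = 0], assumption)
            apply simp
           apply simp
          apply simp
         apply simp
        apply simp
    subgoal by (simp add: nJ len_def)
    subgoal by (simp add: ent_def)
    subgoal by (simp add: env_def nJ)
    by (simp add: nJ)
  have start: "main_inv g s2" if f: "frame ?M s1 s2" and p1: "env s1 \<and> ?e s1 \<and> arrs s1 ''init'' = replicate (J + 1) 0"
    and p2: "env s2 \<and> arrs s2 ''Hs'' = (arrs s1 ''Hs'')[1 := int H] \<and> arrs s2 ''init'' = (arrs s1 ''init'')[1 := 1] \<and>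
     (\<forall>k. k div (2 * l) \<noteq> 1 - 1 \<longrightarrow> arrs s2 ''B'' ! k = arrs s1 ''B'' ! k) \<and> holds (arrs s2 ''B'') 1 g" for s1 s2
  proof -
    have "emitted s2 = emitted s1" by (rule frame_emitted[OF f]) (simp add: initialize_def)
    then have e: "?e s2" using p1 by simp
    have lh: "length (arrs s1 ''Hs'') = J + 1" using p1 unfolding env_def by blast
    have J1: "1 < J + 1" using J_ge by simp
    have "block_state s2 j g" if j: "1 \<le> j \<and> j \<le> J" for j
    proof (cases "j = 1")
      case True
      have "arrs s2 ''init'' ! 1 = 1" "arrs s2 ''Hs'' ! 1 = int (l * g)"
        using p1 p2 lh J1 H_eq by (simp_all del: replicate_Suc)
      then show ?thesis using True p2 live_1 top_1[of g] by (simp add: block_state_def)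
    next
      case False
      have "g * 1 \<le> j * g" using j by simp
      then have "ceil_div g j \<le> g" using j by (simp add: ceil_div_le_iff)
      then have "\<not> live j g" using False by (simp add: live_def)
      moreover have "arrs s2 ''init'' ! j = 0" using p1 p2 False j by (simp del: replicate_Suc)
      ultimately show ?thesis by (simp add: block_state_def)
    qed
    then show ?thesis using p2 e H_eq unfolding main_inv_def by simp
  qed
  have W: "executes ?W s1 ((\<Sum>i<blocks - g. main_cost (g + i) + 2 + 1) + 2 + 1) (\<lambda>s. emitted s = values_list 1 (N + 1))"
    if s1: "ok s1" "main_inv g s1" for s1
  proof -
    have n: "g + i \<le> blocks" if "i \<le> blocks - g" "g \<le> blocks" for i using that by linarith
    have "executes ?W s1 ((\<Sum>i<blocks - g. main_cost (g + i) + exp_time (Read ''Hs'' (Const 1) \<^bold>< Var ''N'') + 1) +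
       exp_time (Read ''Hs'' (Const 1) \<^bold>< Var ''N'') + 1) (\<lambda>s. main_inv (g + (blocks - g)) s)"
    proof (rule executes_While[where I = "\<lambda>i s. main_inv (g + i) s"])
      show "exp_val (Read ''Hs'' (Const 1) \<^bold>< Var ''N'') s = Some (of_bool (i < blocks - g))"
        if i: "i \<le> blocks - g" "ok s" "main_inv (g + i) s" for i s
      proof -
        have env: "env s" and b: "block_state s 1 (g + i)" using i(3) J_ge unfolding main_inv_def by auto
        have h: "arrs s ''Hs'' ! 1 = int (l * (g + i))"
          using b live_1 top_1[of "g + i"] by (simp add: block_state_def)
        have "l * (g + i) < N \<longleftrightarrow> l * (g + i) < l * blocks" using N_eq by simp
        also have "\<dots> \<longleftrightarrow> i < blocks - g" using pos by auto
        finally have "int (l * (g + i)) < int N \<longleftrightarrow> i < blocks - g" by (simp only: of_nat_less_iff)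
        then show ?thesis using env h J_ge by (simp add: env_def del: of_nat_mult of_nat_add)
      qed
      show "executes main_body s (main_cost (g + i)) (main_inv (g + Suc i))"
        if i: "i < blocks - g" "ok s" "main_inv (g + i) s" for i s
        using main_body[OF i(2,3)] i(1) by simp
    qed (use s1 in auto)
    then show ?thesis
    proof (rule executes_conseq)
      fix s2 assume m: "main_inv (g + (blocks - g)) s2"
      have "min (l * (g + (blocks - g))) N = N"
      proof -
        have "l * blocks \<le> l * (g + (blocks - g))" by (intro mult_left_mono) auto
        then show ?thesis using N_eq by linarith
      qed
      then show "emitted s2 = values_list 1 (N + 1)" using m unfolding main_inv_def by simp
    qed simp
  qed
  have M: "executes (?A;; ?B;; ?C;; ?D;; ?F;; ?G1;; ?G2;; ?G3;; ?M) ?s0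
    (2 + tB + (10 * H + 10) + (10 * log_bound N + 10) + 4 + (J + 3) + (J + 3) + (J * (2 * l) + 2) + (30 * l + 30)) (main_inv g)"
  proof (rule executes_Seq'[OF init])
    fix s1 assume s1: "ok s1" and p1: "?R s1"
    have env1: "env s1" and ie: "index_exp (Const 1) s1 1" using p1 by (auto simp: index_exp_def)
    show "executes ?M s1 (30 * l + 30) (main_inv g)"
      by (rule executes_conseq[OF initialize[OF s1 env1 ie _ J_ge] le_refl], simp, rule start, assumption, rule p1, assumption)
  qed
  have eq: "space_improved = (?A;; ?B;; ?C;; ?D;; ?F;; ?G1;; ?G2;; ?G3;; ?M;; ?W)"
    by (simp add: space_improved_def main_body_def process_block_def)
  have lb: "log_bound N \<le> log_bound R" "log_bound H \<le> log_bound R" using log_bound_mono R_le by auto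
  have cost: "(\<Sum>i<blocks - g. main_cost (g + i) + 2 + 1) \<le> (\<Sum>i<blocks - g. main_cost (g + i) + 5)"
    by (intro sum_mono) simp
  have "executes (?A;; ?B;; ?C;; ?D;; ?F;; ?G1;; ?G2;; ?G3;; ?M;; ?W) ?s0 total_time
    (\<lambda>s. emitted s = values_list 1 (N + 1))"
    by (rule executes_le, rule executes_Seq'[OF M], rule W, assumption, assumption)
      (use lb cost in \<open>simp add: total_time_def tB_def\<close>)
  then show ?thesis by (simp only: eq[symmetric])
qed

end


subsection \<open>Bounds on time and storage\<close>

context space_params
begin

lemma J_H_le: "J * H \<le> N + H"
  unfolding J_def using div_times_less_eq_dividend[of "N + H - 1" H] by linarith

lemma J_L_le: "J * (2 * l) \<le> 2 * H"
proof -
  have "J * (2 * l) * H = 2 * l * (J * H)" by simp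
  also have "\<dots> \<le> 2 * l * (N + H)" using J_H_le by (intro mult_left_mono) auto
  also have "\<dots> = 2 * l * N + 2 * l * H" by (simp add: algebra_simps)
  also have "\<dots> \<le> H ^ 2 + H * H" using H_square two_l_le by (intro add_mono mult_right_mono) auto
  also have "\<dots> = 2 * H * H" by (simp add: power2_eq_square)
  finally show ?thesis using pos by simp
qed

lemma kMax_total_mono: "m \<le> n \<Longrightarrow> kMax_total m \<le> kMax_total n"
  unfolding kMax_total_def by (intro sum_mono2) auto

lemma top_mono: "1 \<le> j \<Longrightarrow> top j K \<le> top j (Suc K)"
  unfolding top_def using ceil_div_mono[of j K "Suc K"] by (intro max.mono) auto

lemma top_bound:
  assumes "1 \<le> j" "j \<le> J" "g \<le> blocks"
  shows "l * top j blocks * j \<le> 2 * N"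
proof -
  have HN: "H \<le> N"
  proof -
    have "l * g \<le> l * blocks" using assms(3) by (intro mult_left_mono) auto
    then show ?thesis using H_eq N_eq by linarith
  qed
  have jH: "H * j \<le> 2 * N"
  proof (cases "j = 1")
    case False
    then have "j \<le> 2 * (j - 1)" using assms(1) by linarith
    moreover have "H * (j - 1) \<le> N"
    proof -
      have "H * j \<le> H * J" using assms(2) by (intro mult_left_mono) auto
      moreover have "H * J \<le> N + H" using J_H_le by (simp only: mult.commute)
      ultimately have "H * j \<le> N + H" by linarith
      then show ?thesis by (simp add: diff_mult_distrib2)
    qed
    ultimately show ?thesis using mult_left_mono[of j "2 * (j - 1)" H] by linarith
  qed (use HN in simp)
  have "l * ceil_div blocks j * j \<le> 2 * N"
  proof -
    have "ceil_div blocks j * j \<le> blocks + j - 1"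
      unfolding ceil_div_def by (rule div_times_less_eq_dividend)
    then have "l * (ceil_div blocks j * j) \<le> l * (blocks + j)" by (intro mult_left_mono) auto
    also have "\<dots> = N + l * j" using N_eq by (simp add: distrib_left)
    finally have "l * ceil_div blocks j * j \<le> N + l * j" by (simp add: mult.assoc)
    moreover have "2 * l * j \<le> H * j" using two_l_le by (intro mult_right_mono) auto
    ultimately show ?thesis using jH by linarith
  qed
  then show ?thesis using jH H_eq unfolding top_def by (cases "g \<le> ceil_div blocks j") (simp_all add: max_def)
qed

definition kMax_blocks :: nat where
  "kMax_blocks = (if g \<le> blocks then \<Sum>j\<in>{1..J}. kMax_total (l * top j blocks) else 0)"

lemma main_cost_sum_le:
  "(\<Sum>i<blocks - g. main_cost (g + i) + 5) \<le> blocks * (J * (overhead + 2) + 25) + 45 * kMax_blocks"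
proof (cases "g \<le> blocks")
  case True
  let ?G = "\<lambda>j K. kMax_total (l * top j K)"
  have tel: "(\<Sum>i<k. ?G j (Suc (g + i)) - ?G j (g + i)) = ?G j (g + k) - ?G j g" if "1 \<le> j" for j k
  proof (induction k)
    case (Suc k)
    have mono: "?G j (g + i) \<le> ?G j (Suc (g + i))" for i
      using top_mono[OF that] by (intro kMax_total_mono mult_left_mono) auto
    have "?G j g \<le> ?G j (g + k)"
      by (induction k) (use mono in \<open>auto intro: order_trans\<close>)
    then show ?case using Suc mono[of k] by simp
  qed simp
  define D where "D K j = ?G j (Suc K) - ?G j K" for K j
  define c where "c = J * (overhead + 2) + 25"
  have cost: "main_cost K + 5 = c + (\<Sum>j\<in>{1..J}. 45 * D K j)" for K
  proof -
    have "main_cost K = (\<Sum>j\<in>{1..J}. overhead + 45 * D K j + 2) + 20"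
      by (simp only: main_cost_def D_def)
    also have "(\<Sum>j\<in>{1..J}. overhead + 45 * D K j + 2) = J * (overhead + 2) + (\<Sum>j\<in>{1..J}. 45 * D K j)"
      by (simp only: sum.distrib) simp
    finally show ?thesis by (simp add: c_def)
  qed
  have "(\<Sum>i<blocks - g. main_cost (g + i) + 5) = (\<Sum>i<blocks - g. c) + (\<Sum>i<blocks - g. \<Sum>j\<in>{1..J}. 45 * D (g + i) j)"
    by (simp only: cost sum.distrib)
  also have "(\<Sum>i<blocks - g. \<Sum>j\<in>{1..J}. 45 * D (g + i) j) = (\<Sum>j\<in>{1..J}. \<Sum>i<blocks - g. 45 * D (g + i) j)"
    by (rule sum.swap)
  also have "\<dots> = (\<Sum>j\<in>{1..J}. 45 * (\<Sum>i<blocks - g. D (g + i) j))"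
    by (simp only: sum_distrib_left)
  also have "\<dots> \<le> (\<Sum>j\<in>{1..J}. 45 * ?G j blocks)"
  proof (intro sum_mono mult_left_mono)
    fix j assume "j \<in> {1..J}"
    then have "(\<Sum>i<blocks - g. D (g + i) j) = ?G j (g + (blocks - g)) - ?G j g"
      unfolding D_def by (intro tel) simp
    then show "(\<Sum>i<blocks - g. D (g + i) j) \<le> ?G j blocks" using True by simp
  qed simp
  also have "(\<Sum>j\<in>{1..J}. 45 * ?G j blocks) = 45 * kMax_blocks"
    using True by (simp only: kMax_blocks_def sum_distrib_left if_True)
  also have "(\<Sum>i<blocks - g. c) \<le> blocks * c" by simp
  finally show ?thesis unfolding c_def by simp
qed simp

lemma total_time_le:
  "total_time \<le> 200 + 60 * log_bound R + 24 * H + 100 * l + 2 * J +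
     H * (kMax_time (log_bound R) + 50 + 20 * floor_sqrt H) + 16 * kMax_total R +
     J * (302 * blocks + N * (200 + 45 * log_bound R + kMax_time (log_bound R)) + 65 * (blocks * floor_sqrt N)) +
     25 * blocks + 45 * kMax_blocks"
proof -
  define c where "c = kMax_time (log_bound H) + 50 + 20 * floor_sqrt H"
  have "(\<Sum>n\<in>{2..H}. kMax_time (log_bound H) + 50 + 16 * kMax n + 20 * floor_sqrt H) = (\<Sum>n\<in>{2..H}. c + 16 * kMax n)"
    by (simp add: c_def ac_simps)
  also have "\<dots> = card {2..H} * c + 16 * kMax_total H"
    unfolding kMax_total_def by (simp only: sum.distrib sum_constant sum_distrib_left[symmetric] of_nat_id)
  also have "\<dots> \<le> H * (kMax_time (log_bound R) + 50 + 20 * floor_sqrt H) + 16 * kMax_total R"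
  proof (intro add_mono mult_mono)
    show "c \<le> kMax_time (log_bound R) + 50 + 20 * floor_sqrt H"
      using kMax_time_mono[OF log_bound_mono[of H R]] R_le by (simp add: c_def)
    show "kMax_total H \<le> kMax_total R" by (rule kMax_total_mono[OF R_le(2)])
  qed auto
  finally have 1: "(\<Sum>n\<in>{2..H}. kMax_time (log_bound H) + 50 + 16 * kMax n + 20 * floor_sqrt H) \<le> \<dots>" .
  define Y where "Y = 200 + 45 * log_bound R + kMax_time (log_bound R)"
  have ov: "overhead = 300 + l * Y + 65 * floor_sqrt N"
    by (simp add: overhead_def Y_def algebra_simps)
  have "blocks * (J * (overhead + 2) + 25) = J * (302 * blocks + (l * blocks) * Y + 65 * (blocks * floor_sqrt N)) + 25 * blocks"
    unfolding ov by (simp add: algebra_simps)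
  also have "l * blocks = N" using N_eq by simp
  finally show ?thesis using 1 main_cost_sum_le J_L_le unfolding total_time_def Y_def by linarith
qed

lemma budget_le:
  "budget \<le> (card (com_vars space_improved) + 20000) * bits V + (3 * H + 1) * bits (int (log_bound R)) + (J + 1) * (bits V + 2)"
proof -
  let ?f = "\<lambda>A. len A * bits (ent A)"
  let ?S = "{''B0'', ''Hs'', ''init'', ''B''}"
  have "sum ?f (com_arrs space_improved) = sum ?f (com_arrs space_improved \<inter> ?S)"
    by (rule sum.mono_neutral_right) (auto simp: finite_com_arrs len_def)
  also have "\<dots> \<le> sum ?f ?S" by (intro sum_mono2) auto
  also have "\<dots> = (H + 1 + J * (2 * l)) * bits (int (log_bound R)) + (J + 1) * (bits V + 2)"
    by (simp add: len_def ent_def algebra_simps)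
  also have "\<dots> \<le> (3 * H + 1) * bits (int (log_bound R)) + (J + 1) * (bits V + 2)"
  proof -
    have "H + 1 + J * (2 * l) \<le> 3 * H + 1" using J_L_le by linarith
    then have "(H + 1 + J * (2 * l)) * bits (int (log_bound R)) \<le> (3 * H + 1) * bits (int (log_bound R))"
      by (rule mult_right_mono) simp
    then show ?thesis by (rule add_right_mono)
  qed
  finally show ?thesis unfolding budget_def by (simp add: algebra_simps)
qed

lemma kMax_blocks_le:
  fixes C a :: real
  assumes C: "C \<ge> 0" "\<And>n. real (\<Sum>k\<in>{2..n}. kMax k) \<le> C * real n powr a" and a: "a \<ge> 1"
  shows "real kMax_blocks \<le> C * (2 * real N) powr a * (1 + ln (real J))"
proof (cases "g \<le> blocks")
  case True
  have harm: "(\<Sum>j\<in>{1..k}. 1 / real j) \<le> 1 + ln (real k)" if "k \<ge> 1" for k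
    using that
  proof (induction k rule: nat_induct_at_least)
    case (Suc k)
    have "ln (real k / real (Suc k)) \<le> real k / real (Suc k) - 1"
      using Suc by (intro ln_le_minus_one) simp
    also have "\<dots> = - (1 / real (Suc k))" by (simp add: field_simps)
    finally have "1 / real (Suc k) \<le> ln (real (Suc k)) - ln (real k)"
      using Suc by (simp add: ln_div)
    then show ?case using Suc by simp
  qed simp
  have "real kMax_blocks = (\<Sum>j\<in>{1..J}. real (kMax_total (l * top j blocks)))"
    using True by (simp add: kMax_blocks_def)
  also have "\<dots> \<le> (\<Sum>j\<in>{1..J}. C * (2 * real N) powr a * (1 / real j))"
  proof (rule sum_mono)
    fix j assume j: "j \<in> {1..J}"
    then have "real (l * top j blocks * j) \<le> real (2 * N)"
      using True by (intro of_nat_mono top_bound) auto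
    then have "real (l * top j blocks) \<le> 2 * real N / real j" using j by (simp add: field_simps)
    then have "real (l * top j blocks) powr a \<le> (2 * real N / real j) powr a"
      using a by (intro powr_mono2) auto
    also have "\<dots> = (2 * real N) powr a / real j powr a" using j by (simp add: powr_divide)
    also have "\<dots> \<le> (2 * real N) powr a / real j powr 1"
      using j a by (intro divide_left_mono powr_mono) auto
    finally have "C * real (l * top j blocks) powr a \<le> C * ((2 * real N) powr a / real j)"
      using C(1) j by (intro mult_left_mono) auto
    then show "real (kMax_total (l * top j blocks)) \<le> C * (2 * real N) powr a * (1 / real j)"
      using C(2)[of "l * top j blocks"] unfolding kMax_total_def by simp
  qed
  also have "\<dots> = C * (2 * real N) powr a * (\<Sum>j\<in>{1..J}. 1 / real j)" by (simp add: sum_distrib_left)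
  also have "\<dots> \<le> C * (2 * real N) powr a * (1 + ln (real J))"
    using harm[OF J_ge] C(1) by (intro mult_left_mono) auto
  finally show ?thesis .
next
  case False
  then show ?thesis using C(1) J_ge by (simp add: kMax_blocks_def)
qed

lemma run_exists:
  "\<exists>t m s. run space_improved (input_state N H l) t m s \<and> t \<le> total_time \<and> m \<le> budget \<and>
     emitted s = map (\<lambda>n. int (complexity n)) [1..<N + 1]"
proof -
  obtain t m s where "exec (state_bits space_improved) space_improved (input_state N H l) t m s"
    "t \<le> total_time" "m \<le> budget" "emitted s = values_list 1 (N + 1)"
    using space_improved_correct unfolding executes_def by blast
  then show ?thesis unfolding run_def values_list_def by blast
qed

end

subsection \<open>Choice of the parameters\<close>

definition beta :: real where "beta = ln 3 / ln 2 - 1"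

lemma beta_bounds: "0.55 \<le> beta" "beta \<le> 0.6"
proof -
  have "ln ((2::real) ^ 31) \<le> ln (3 ^ 20)" by (subst ln_le_cancel_iff) auto
  then have "31 * ln 2 \<le> 20 * ln (3::real)" by ((simp only: ln_realpow); simp)
  then show "0.55 \<le> beta" unfolding beta_def by (simp add: field_simps)
  have "ln ((3::real) ^ 5) \<le> ln (2 ^ 8)" by (subst ln_le_cancel_iff) auto
  then have "5 * ln 3 \<le> 8 * ln (2::real)" by ((simp only: ln_realpow); simp)
  then show "beta \<le> 0.6" unfolding beta_def by (simp add: field_simps)
qed

definition l_of :: "nat \<Rightarrow> nat" where
  "l_of N = nat \<lceil>2 * (2 * real N) powr beta\<rceil> + 1"

definition N_of :: "nat \<Rightarrow> nat" where
  "N_of N = l_of N * ceil_div N (l_of N)"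

definition H_of :: "nat \<Rightarrow> nat" where
  "H_of N = l_of N * nat \<lceil>sqrt (2 * real (N_of N) / real (l_of N))\<rceil>"

lemma l_of_bounds:
  assumes "N \<ge> 1"
  shows "2 * (2 * real N) powr beta < real (l_of N)" "real (l_of N) \<le> 6 * real N powr beta"
    "real N powr beta \<le> real (l_of N)" "1 \<le> l_of N"
proof -
  let ?x = "2 * (2 * real N) powr beta"
  have x: "?x \<ge> 0" by simp
  then have "real (l_of N) = of_int \<lceil>?x\<rceil> + 1" unfolding l_of_def by (simp add: of_nat_nat)
  then have l: "?x + 1 \<le> real (l_of N)" "real (l_of N) \<le> ?x + 2" by linarith+
  show "?x < real (l_of N)" using l by simp
  show "1 \<le> l_of N" by (simp add: l_of_def)
  have p: "(2 * real N) powr beta = 2 powr beta * real N powr beta" by (simp add: powr_mult)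
  have "(2::real) powr beta \<le> 2 powr 1" using beta_bounds by (intro powr_mono) auto
  then have "(2 * real N) powr beta \<le> 2 * real N powr beta" unfolding p by (intro mult_right_mono) auto
  moreover have "1 \<le> real N powr beta" using assms beta_bounds by (intro ge_one_powr_ge_zero) auto
  ultimately show "real (l_of N) \<le> 6 * real N powr beta" using l by linarith
  have "real N powr beta \<le> (2 * real N) powr beta" using beta_bounds by (intro powr_mono2) auto
  then show "real N powr beta \<le> real (l_of N)" using l powr_ge_zero[of "2 * real N" beta] by linarith
qed

lemma N_of_bounds:
  assumes "N \<ge> 1"
  shows "N \<le> N_of N" "N_of N < N + l_of N" "N_of N \<le> 2 * N \<or> N_of N \<le> l_of N" "real (N_of N) \<le> 7 * real N"
proof -
  have l: "1 \<le> l_of N" by (rule l_of_bounds[OF assms])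
  show le: "N \<le> N_of N" unfolding N_of_def by (rule le_ceil_div[OF l])
  have "ceil_div N (l_of N) * l_of N \<le> N + l_of N - 1"
    unfolding ceil_div_def by (rule div_times_less_eq_dividend)
  then show less: "N_of N < N + l_of N" using l assms by (simp add: N_of_def mult.commute)
  show "N_of N \<le> 2 * N \<or> N_of N \<le> l_of N"
  proof (cases "N \<le> l_of N")
    case True
    then have "ceil_div N (l_of N) \<le> 1" using l by (simp add: ceil_div_le_iff)
    then have "l_of N * ceil_div N (l_of N) \<le> l_of N * 1" by (rule mult_left_mono) simp
    then show ?thesis by (simp add: N_of_def)
  qed (use less in simp)
  have "real N powr beta \<le> real N powr 1" using assms beta_bounds by (intro powr_mono) auto
  then have "real (l_of N) \<le> 6 * real N" using l_of_bounds(2)[OF assms] assms by simp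
  then show "real (N_of N) \<le> 7 * real N" using less by linarith
qed

lemma H_of_ge: "N \<ge> 1 \<Longrightarrow> sqrt (2 * real (l_of N) * real (N_of N)) \<le> real (H_of N)"
  and H_of_le: "N \<ge> 1 \<Longrightarrow> real (H_of N) \<le> sqrt (2 * real (l_of N) * real (N_of N)) + real (l_of N)"
proof -
  assume N: "N \<ge> 1"
  let ?l = "real (l_of N)" and ?N = "real (N_of N)"
  let ?q = "sqrt (2 * ?N / ?l)"
  have l: "?l > 0" using l_of_bounds(4)[OF N] by simp
  have "2 * ?l * ?N = ?l ^ 2 * (2 * ?N / ?l)" using l by (simp add: power2_eq_square)
  then have "sqrt (2 * ?l * ?N) = sqrt (?l ^ 2) * ?q" by (simp only: real_sqrt_mult)
  then have e: "sqrt (2 * ?l * ?N) = ?l * ?q" using l by simp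
  have "?q \<ge> 0" by simp
  then have H: "real (H_of N) = ?l * of_int \<lceil>?q\<rceil>" unfolding H_of_def by (simp add: of_nat_nat)
  have "?l * ?q \<le> ?l * of_int \<lceil>?q\<rceil>" using l by (intro mult_left_mono) auto
  then show "sqrt (2 * ?l * ?N) \<le> real (H_of N)" unfolding e H .
  have "?l * of_int \<lceil>?q\<rceil> \<le> ?l * (?q + 1)" using l by (intro mult_left_mono) linarith+
  then show "real (H_of N) \<le> sqrt (2 * ?l * ?N) + ?l" unfolding e H by (simp add: algebra_simps)
qed

lemma admissible_of:
  assumes N: "N \<ge> 1"
  shows "admissible (N_of N) (H_of N) (l_of N)"
proof -
  let ?l = "real (l_of N)" and ?N = "real (N_of N)"
  have l: "l_of N \<ge> 1" and N1: "N_of N \<ge> 1" using l_of_bounds(4)[OF N] N_of_bounds(1)[OF N] N by auto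
  have ge: "sqrt (2 * ?l * ?N) \<le> real (H_of N)" by (rule H_of_ge[OF N])
  have "0 < sqrt (2 * ?l * ?N)" using l N1 by simp
  then have "0 < real (H_of N)" using ge by linarith
  then have H1: "H_of N > 0" by simp
  have k: "kMax n < l_of N" if n: "n \<in> {2..N_of N}" for n
  proof (cases "n \<le> l_of N")
    case True
    then show ?thesis using kMax_less[of n] n by simp
  next
    case False
    then have "n \<le> 2 * N" using N_of_bounds(3)[OF N] n by auto
    then have "real n powr beta \<le> (2 * real N) powr beta" using beta_bounds by (intro powr_mono2) auto
    moreover have "real (kMax n) \<le> 2 * real n powr beta"
      using kMax_le_powr[of n] n by (simp add: beta_def)
    ultimately have "real (kMax n) < ?l" using l_of_bounds(1)[OF N] by linarith
    then show ?thesis by simp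
  qed
  have cube: "?N \<le> 2 * ?l ^ 3"
  proof (cases "N_of N \<le> l_of N")
    case True
    have "l_of N \<le> l_of N ^ 3" using l by (intro self_le_power) auto
    then have "N_of N \<le> 2 * l_of N ^ 3" using True by linarith
    then have "real (N_of N) \<le> real (2 * l_of N ^ 3)" by (rule of_nat_mono)
    then show ?thesis by simp
  next
    case False
    then have "N_of N \<le> 2 * N" using N_of_bounds(3)[OF N] by blast
    then have "real (N_of N) \<le> real (2 * N)" by (rule of_nat_mono)
    then have "?N \<le> 2 * real N" by simp
    also have "2 * real N = (2 * real N) powr 1" using N by simp
    also have "\<dots> \<le> (2 * real N) powr (beta * 3)" using beta_bounds N by (intro powr_mono) auto
    also have "\<dots> = ((2 * real N) powr beta) powr real 3" by (simp only: powr_powr of_nat_numeral)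
    also have "\<dots> = ((2 * real N) powr beta) ^ 3" using N by (intro powr_realpow) simp
    also have "\<dots> \<le> ?l ^ 3"
      using l_of_bounds(1)[OF N] powr_ge_zero[of "2 * real N" beta] by (intro power_mono) linarith+
    also have "\<dots> \<le> 2 * ?l ^ 3" by simp
    finally show ?thesis .
  qed
  have "?N ^ 2 \<le> (?l * sqrt (2 * ?l * ?N)) ^ 2"
  proof -
    have "?N * ?N \<le> 2 * ?l ^ 3 * ?N" using cube by (intro mult_right_mono) auto
    also have "\<dots> = ?l ^ 2 * (2 * ?l * ?N)" by (simp add: power2_eq_square power3_eq_cube)
    also have "2 * ?l * ?N = sqrt (2 * ?l * ?N) ^ 2" by (rule real_sqrt_pow2[symmetric]) simp
    finally show ?thesis by (simp only: power_mult_distrib power2_eq_square[of ?N])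
  qed
  then have "?N \<le> ?l * sqrt (2 * ?l * ?N)" by (rule power2_le_imp_le) simp
  also have "\<dots> \<le> ?l * real (H_of N)" using ge by (intro mult_left_mono) auto
  finally have "real (N_of N) \<le> real (l_of N * H_of N)" by simp
  then have "N_of N \<le> l_of N * H_of N" by (simp only: of_nat_le_iff)
  moreover have "l_of N dvd H_of N" "l_of N dvd N_of N" by (simp_all add: H_of_def N_of_def)
  moreover have "sqrt (real (2 * l_of N) * real (N_of N)) \<le> real (H_of N)" using ge by simp
  ultimately show ?thesis
    unfolding admissible_def using l N1 H1 k by (intro conjI ballI) simp_all
qed


definition lambda_bd :: "real \<Rightarrow> real" where
  "lambda_bd x = 1 + 3 * log 2 (23 * x)"

definition kappa_bd :: "real \<Rightarrow> real" where
  "kappa_bd x = (lambda_bd x + 1) * (4 * lambda_bd x + 40)"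

definition omega_bd :: "real \<Rightarrow> real" where
  "omega_bd x = 2 + log 2 (200 * (23 * x) ^ 3)"

definition time_bd1 :: "real \<Rightarrow> real" where
  "time_bd1 x = 200 + 60 * lambda_bd x + 384 * x powr 0.8 + 600 * x powr 0.6 + 6 * x powr 0.225 +
     16 * x powr 0.8 * (kappa_bd x + 50 + 80 * x powr 0.4) +
     3 * x powr 0.225 * (2114 * x powr 0.45 + 7 * x * (200 + 45 * lambda_bd x + kappa_bd x) + 1365 * (x powr 0.45 * x powr 0.5)) +
     175 * x powr 0.45"

definition time_bd2 :: "real \<Rightarrow> real" where
  "time_bd2 x = 16 * (23 * x) powr (27/22) + 45 * ((14 * x) powr (27/22) * (1 + ln (3 * x powr 0.225)))"

definition space_bd :: "real \<Rightarrow> real" where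
  "space_bd x = real (card (com_vars space_improved) + 20000) * omega_bd x +
     49 * x powr ((1 + beta) / 2) * (2 + log 2 (lambda_bd x)) + (3 * x powr 0.225 + 1) * (omega_bd x + 2)"

lemma time_bd1_bigo: "(\<lambda>n::nat. time_bd1 (real n)) \<in> O(\<lambda>n. real n powr 1.230175)"
  unfolding time_bd1_def kappa_bd_def lambda_bd_def by real_asymp

lemma time_bd2_bigo: "(\<lambda>n::nat. time_bd2 (real n)) \<in> O(\<lambda>n. real n powr 1.230175)"
  unfolding time_bd2_def by real_asymp

lemma space_bd_bigo: "(\<lambda>n::nat. space_bd (real n)) \<in> O(\<lambda>n. real n powr ((1 + beta) / 2) * ln (ln (real n)))"
proof -
  define c where "c = real (card (com_vars space_improved) + 20000)"
  have 1: "(\<lambda>n::nat. omega_bd (real n)) \<in> O(\<lambda>n. real n powr 0.775 * ln (ln (real n)))"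
    unfolding omega_bd_def by real_asymp
  have 2: "(\<lambda>n::nat. (3 * real n powr 0.225 + 1) * (omega_bd (real n) + 2)) \<in> O(\<lambda>n. real n powr 0.775 * ln (ln (real n)))"
    unfolding omega_bd_def by real_asymp
  have 3: "(\<lambda>n::nat. 2 + log 2 (lambda_bd (real n))) \<in> O(\<lambda>n. ln (ln (real n)))"
    unfolding lambda_bd_def by real_asymp
  have "(\<lambda>n::nat. real n powr 0.775) \<in> O(\<lambda>n. real n powr ((1 + beta) / 2))"
    using beta_bounds by (intro landau_o.big_mono eventually_sequentiallyI[of 1]) (auto intro!: powr_mono)
  then have 4: "(\<lambda>n::nat. real n powr 0.775 * ln (ln (real n))) \<in> O(\<lambda>n. real n powr ((1 + beta) / 2) * ln (ln (real n)))"
    by (intro landau_o.big.mult landau_o.big_refl)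
  have "c \<noteq> 0" by (simp add: c_def)
  then have 5: "(\<lambda>n::nat. c * omega_bd (real n)) \<in> O(\<lambda>n. real n powr 0.775 * ln (ln (real n)))"
    using 1 by simp
  have 6: "(\<lambda>n::nat. 49 * real n powr ((1 + beta) / 2) * (2 + log 2 (lambda_bd (real n))))
    \<in> O(\<lambda>n. real n powr ((1 + beta) / 2) * ln (ln (real n)))"
    using 3 by (intro landau_o.big.mult) auto
  show ?thesis
    unfolding space_bd_def c_def[symmetric]
    by (intro sum_in_bigo landau_o.big_trans[OF 5 4] landau_o.big_trans[OF 2 4] 6)
qed

lemma floor_sqrt_le_sqrt: "real (floor_sqrt n) \<le> sqrt (real n)"
proof (rule real_le_rsqrt)
  have "real ((floor_sqrt n)\<^sup>2) \<le> real n" by (intro of_nat_mono floor_sqrt_power2_le)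
  then show "(real (floor_sqrt n))\<^sup>2 \<le> real n" by simp
qed

lemma bits_le_log:
  assumes "n \<ge> 1"
  shows "real (bits (int n)) \<le> 2 + log 2 (real n)"
proof -
  have "0 \<le> log 2 (real n)" using assms by simp
  then have "real (floorlog 2 n) \<le> log 2 (real n) + 1"
    using assms by (simp add: floorlog_def)
  then show ?thesis by (simp add: bits_def)
qed

lemma parameter_bounds:
  assumes N: "N \<ge> 1"
  defines "x \<equiv> real N"
  shows "real (H_of N) \<le> 16 * x powr ((1 + beta) / 2)"
    "real (space_params.J (N_of N) (H_of N)) \<le> 3 * x powr 0.225"
    "real (space_params.blocks (N_of N) (l_of N)) \<le> 7 * x powr 0.45"
    "real (space_params.R (N_of N) (H_of N)) \<le> 23 * x"
proof -
  interpret P: space_params "N_of N" "H_of N" "l_of N"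
    by unfold_locales (rule admissible_of[OF N])
  let ?l = "real (l_of N)" and ?N = "real (N_of N)" and ?H = "real (H_of N)"
  have x: "x \<ge> 1" using N by (simp add: x_def)
  note b = beta_bounds
  have l: "?l \<le> 6 * x powr beta" "x powr beta \<le> ?l" "?l \<ge> 1"
    using l_of_bounds[OF N] by (auto simp: x_def)
  have N7: "?N \<le> 7 * x" "?N \<ge> x" using N_of_bounds[OF N] by (auto simp: x_def)
  have "2 * ?l * ?N \<le> 2 * (6 * x powr beta) * (7 * x)" using l N7 x by (intro mult_mono) auto
  also have "\<dots> = 84 * x powr (1 + beta)" using x by (simp add: powr_add)
  also have "\<dots> \<le> 100 * x powr (1 + beta)" by simp
  also have "\<dots> = (10 * x powr ((1 + beta) / 2)) ^ 2"
  proof -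
    have "(x powr ((1 + beta) / 2)) ^ 2 = x powr (1 + beta)"
      by (simp add: power2_eq_square flip: powr_add)
    then show ?thesis by (simp add: power_mult_distrib)
  qed
  finally have "sqrt (2 * ?l * ?N) \<le> 10 * x powr ((1 + beta) / 2)" by (intro real_le_lsqrt) auto
  moreover have "x powr beta \<le> x powr ((1 + beta) / 2)" using b x by (intro powr_mono) auto
  ultimately show H: "?H \<le> 16 * x powr ((1 + beta) / 2)" using H_of_le[OF N] l by linarith
  have "x powr ((1 + beta) / 2) \<le> x powr 1" using b x by (intro powr_mono) auto
  then show "real P.R \<le> 23 * x" using H N7 x by (simp add: P.R_def)
  have low: "x powr 0.55 \<le> ?l"
    using powr_mono[of "0.55" beta x] b x l by linarith
  have "real (P.blocks) = ?N / ?l" using P.N_eq l by (metis nonzero_mult_div_cancel_left of_nat_mult of_nat_0_less_iff less_numeral_extra(3) not_one_le_zero of_nat_0 )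
  also have "\<dots> \<le> 7 * x / x powr 0.55" using N7 low x by (intro frac_le) auto
  also have "\<dots> = 7 * x powr 0.45" using x powr_diff[of x 1 "0.55"] by simp
  finally show "real P.blocks \<le> 7 * x powr 0.45" .
  have Hpos: "?H > 0" using P.pos by simp
  have "?N \<le> ?H * (2 * x powr 0.225)"
  proof -
    have p: "(x powr 0.225) ^ 2 * x powr 0.55 = x"
      using x by (simp add: power2_eq_square flip: powr_add)
    have "?N \<le> 8 * (x powr 0.225) ^ 2 * x powr 0.55"
      using N7 x p by (simp add: mult.assoc)
    also have "\<dots> \<le> 8 * (x powr 0.225) ^ 2 * ?l" using low by (intro mult_left_mono) auto
    finally have "?N * ?N \<le> 8 * (x powr 0.225) ^ 2 * ?l * ?N" by (intro mult_right_mono) auto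
    also have "\<dots> = (2 * ?l * ?N) * (2 * x powr 0.225) ^ 2" by (simp add: power_mult_distrib)
    also have "\<dots> \<le> ?H ^ 2 * (2 * x powr 0.225) ^ 2"
    proof -
      have "real (2 * l_of N * N_of N) \<le> real (H_of N ^ 2)" by (intro of_nat_mono P.H_square)
      then show ?thesis by (intro mult_right_mono) auto
    qed
    finally have "?N ^ 2 \<le> (?H * (2 * x powr 0.225)) ^ 2" by (simp add: power_mult_distrib power2_eq_square[of ?N])
    then show ?thesis by (rule power2_le_imp_le) simp
  qed
  moreover have "real P.J * ?H \<le> ?N + ?H" using P.J_H_le by (metis of_nat_add of_nat_le_iff of_nat_mult)
  ultimately have "real P.J * ?H \<le> (2 * x powr 0.225 + 1) * ?H" by (simp add: algebra_simps)
  then have "real P.J \<le> 2 * x powr 0.225 + 1" using Hpos by simp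
  moreover have "1 \<le> x powr 0.225" using x by (intro ge_one_powr_ge_zero) auto
  ultimately show "real P.J \<le> 3 * x powr 0.225" by linarith
qed

lemma run_bounds:
  assumes N: "N \<ge> 1" and C: "C \<ge> 0" "\<And>n. real (\<Sum>k\<in>{2..n}. kMax k) \<le> C * real n powr (27/22)"
  shows "\<exists>t m s. run space_improved (input_state (N_of N) (H_of N) (l_of N)) t m s \<and>
     emitted s = map (\<lambda>n. int (complexity n)) [1..<N_of N + 1] \<and>
     real t \<le> time_bd1 (real N) + C * time_bd2 (real N) \<and> real m \<le> space_bd (real N)"
proof -
  interpret P: space_params "N_of N" "H_of N" "l_of N"
    by unfold_locales (rule admissible_of[OF N])
  define x where "x = real N"
  have x: "x \<ge> 1" using N by (simp add: x_def)
  define lb where "lb = log_bound P.R"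
  note pb = parameter_bounds[OF N, folded x_def]
  have powr1: "1 \<le> x powr e" if "e \<ge> 0" for e using x that by (intro ge_one_powr_ge_zero) auto
  have R1: "real P.R \<ge> 1" using P.R_le(3) by simp
  have lb: "real lb \<le> lambda_bd x" "lb \<ge> 1"
  proof -
    have "real (2 ^ lb) \<le> real (2 * P.R ^ 3)" unfolding lb_def by (intro of_nat_mono log_bound_upper P.R_le)
    then have "log 2 (2 ^ lb) \<le> log 2 (2 * real P.R ^ 3)" by (subst log_le_cancel_iff) (use R1 in auto)
    also have "\<dots> = 1 + 3 * log 2 (real P.R)" using R1 by (simp add: log_mult log_nat_power)
    also have "\<dots> \<le> lambda_bd x" using pb(4) R1 by (simp add: lambda_bd_def)
    finally show "real lb \<le> lambda_bd x" by (simp add: log_nat_power)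
    show "lb \<ge> 1" unfolding lb_def by (rule log_bound)
  qed
  have kap: "real (kMax_time lb) \<le> kappa_bd x"
    unfolding kMax_time_def kappa_bd_def using lb(1) by (simp add: algebra_simps) (intro add_mono mult_mono; simp)
  have H: "real (H_of N) \<le> 16 * x powr 0.8"
  proof -
    have "(1 + beta) / 2 \<le> 0.8" using beta_bounds by simp
    from powr_mono[OF this x] show ?thesis using pb(1) by linarith
  qed
  have l6: "real (l_of N) \<le> 6 * x powr 0.6"
    using l_of_bounds(2)[OF N] powr_mono[of beta "0.6" x] beta_bounds x unfolding x_def by linarith
  have N7: "real (N_of N) \<le> 7 * x" using N_of_bounds(4)[OF N] by (simp add: x_def)
  have sH: "real (floor_sqrt (H_of N)) \<le> 4 * x powr 0.4"
  proof (rule order_trans[OF floor_sqrt_le_sqrt], rule real_le_lsqrt)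
    have "(4 * x powr 0.4)\<^sup>2 = 16 * x powr 0.8" by (simp add: power2_eq_square flip: powr_add)
    then show "real (H_of N) \<le> (4 * x powr 0.4)\<^sup>2" using H by simp
  qed simp_all
  have sN: "real (floor_sqrt (N_of N)) \<le> 3 * x powr 0.5"
  proof (rule order_trans[OF floor_sqrt_le_sqrt], rule real_le_lsqrt)
    have "(3 * x powr 0.5)\<^sup>2 = 9 * x" using x by (simp add: power2_eq_square flip: powr_add)
    then show "real (N_of N) \<le> (3 * x powr 0.5)\<^sup>2" using N7 x by simp
  qed simp_all
  have kR: "real (P.kMax_total P.R) \<le> C * (23 * x) powr (27/22)"
  proof -
    have "real (P.kMax_total P.R) \<le> C * real P.R powr (27/22)" unfolding P.kMax_total_def by (rule C(2))
    also have "\<dots> \<le> C * (23 * x) powr (27/22)" using pb(4) C(1) by (intro mult_left_mono powr_mono2) auto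
    finally show ?thesis .
  qed
  have kB: "real P.kMax_blocks \<le> C * ((14 * x) powr (27/22) * (1 + ln (3 * x powr 0.225)))"
  proof -
    have "real P.kMax_blocks \<le> C * (2 * real (N_of N)) powr (27/22) * (1 + ln (real P.J))"
      by (rule P.kMax_blocks_le[OF C]) simp
    also have "\<dots> \<le> C * (14 * x) powr (27/22) * (1 + ln (3 * x powr 0.225))"
    proof (rule mult_mono)
      have "1 \<le> real P.J" using P.J_ge by simp
      moreover from this have "ln (real P.J) \<le> ln (3 * x powr 0.225)"
        using pb(2) by (intro ln_mono) auto
      ultimately show "1 + ln (real P.J) \<le> 1 + ln (3 * x powr 0.225)" "0 \<le> 1 + ln (real P.J)"
        by (simp_all add: add_nonneg_nonneg)
      have "(2 * real (N_of N)) powr (27/22) \<le> (14 * x) powr (27/22)" using N7 by (intro powr_mono2) auto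
      then show "C * (2 * real (N_of N)) powr (27/22) \<le> C * (14 * x) powr (27/22)"
        using C(1) by (rule mult_left_mono)
    qed (use C(1) in auto)
    finally show ?thesis by (simp add: mult.assoc)
  qed
  obtain t m s where run: "run space_improved (input_state (N_of N) (H_of N) (l_of N)) t m s"
    "t \<le> P.total_time" "m \<le> P.budget" "emitted s = map (\<lambda>n. int (complexity n)) [1..<N_of N + 1]"
    using P.run_exists by blast
  have "real t \<le> 200 + 60 * real lb + 24 * real (H_of N) + 100 * real (l_of N) + 2 * real P.J +
     real (H_of N) * (real (kMax_time lb) + 50 + 20 * real (floor_sqrt (H_of N))) + 16 * real (P.kMax_total P.R) +
     real P.J * (302 * real P.blocks + real (N_of N) * (200 + 45 * real lb + real (kMax_time lb)) +
       65 * (real P.blocks * real (floor_sqrt (N_of N)))) +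
     25 * real P.blocks + 45 * real P.kMax_blocks"
    using of_nat_mono[OF order_trans[OF run(2) P.total_time_le], where 'a = real] by (simp add: lb_def)
  also have "\<dots> \<le> 200 + 60 * lambda_bd x + 24 * (16 * x powr 0.8) + 100 * (6 * x powr 0.6) + 2 * (3 * x powr 0.225) +
     16 * x powr 0.8 * (kappa_bd x + 50 + 20 * (4 * x powr 0.4)) + 16 * (C * (23 * x) powr (27/22)) +
     3 * x powr 0.225 * (302 * (7 * x powr 0.45) + 7 * x * (200 + 45 * lambda_bd x + kappa_bd x) +
       65 * (7 * x powr 0.45 * (3 * x powr 0.5))) +
     25 * (7 * x powr 0.45) + 45 * (C * ((14 * x) powr (27/22) * (1 + ln (3 * x powr 0.225))))"
    using lb(1) kap H l6 N7 sH sN kR kB pb(2,3) x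
    by (intro add_mono mult_mono mult_left_mono add_nonneg_nonneg mult_nonneg_nonneg) auto
  also have "\<dots> = time_bd1 x + C * time_bd2 x"
    unfolding time_bd1_def time_bd2_def by (simp add: algebra_simps)
  finally have time: "real t \<le> time_bd1 x + C * time_bd2 x" .
  have om: "real (bits P.V) \<le> omega_bd x"
  proof -
    have "real (bits P.V) \<le> 2 + log 2 (real (100 * P.R ^ 3 + 100))"
      unfolding P.V_def by (rule bits_le_log) simp
    also have "\<dots> \<le> 2 + log 2 (200 * (23 * x) ^ 3)"
    proof -
      have "real P.R ^ 3 \<le> (23 * x) ^ 3" using pb(4) by (intro power_mono) auto
      moreover have "1 \<le> real P.R ^ 3" using R1 by simp
      ultimately have "real (100 * P.R ^ 3 + 100) \<le> 200 * (23 * x) ^ 3" by simp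
      moreover have "0 < real (100 * P.R ^ 3 + 100)" by (simp only: of_nat_0_less_iff)
      ultimately have "log 2 (real (100 * P.R ^ 3 + 100)) \<le> log 2 (200 * (23 * x) ^ 3)"
        by (intro log_mono) simp_all
      then show ?thesis by simp
    qed
    finally show ?thesis by (simp add: omega_bd_def)
  qed
  have ll: "real (bits (int lb)) \<le> 2 + log 2 (lambda_bd x)"
  proof -
    have "real (bits (int lb)) \<le> 2 + log 2 (real lb)" by (rule bits_le_log[OF lb(2)])
    moreover have "log 2 (real lb) \<le> log 2 (lambda_bd x)" using lb by (intro log_mono) auto
    ultimately show ?thesis by linarith
  qed
  have H3: "3 * real (H_of N) + 1 \<le> 49 * x powr ((1 + beta) / 2)"
    using pb(1) powr1[of "(1 + beta) / 2"] beta_bounds by simp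
  define c where "c = card (com_vars space_improved) + 20000"
  have "m \<le> c * bits P.V + (3 * H_of N + 1) * bits (int lb) + (P.J + 1) * (bits P.V + 2)"
    using order_trans[OF run(3) P.budget_le] unfolding c_def lb_def .
  then have "real m \<le> real (c * bits P.V + (3 * H_of N + 1) * bits (int lb) + (P.J + 1) * (bits P.V + 2))"
    by (rule of_nat_mono)
  also have "\<dots> = real c * real (bits P.V) + (3 * real (H_of N) + 1) * real (bits (int lb)) + (real P.J + 1) * (real (bits P.V) + 2)"
    by (simp only: of_nat_add of_nat_mult of_nat_numeral of_nat_1)
  also have "\<dots> \<le> real c * omega_bd x + 49 * x powr ((1 + beta) / 2) * (2 + log 2 (lambda_bd x)) +
      (3 * x powr 0.225 + 1) * (omega_bd x + 2)"
    using om ll H3 pb(2) by (intro add_mono mult_mono) auto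
  finally have "real m \<le> space_bd x" unfolding space_bd_def c_def .
  then show ?thesis using run(1,4) time unfolding x_def by blast
qed

theorem proposition14:
  fixes \<alpha> \<beta> :: real
  assumes "\<alpha> = 1.230175" and "\<beta> = ln 3 / ln 2 - 1"
  shows "\<exists>(N' :: nat \<Rightarrow> nat) (H :: nat \<Rightarrow> nat) (l :: nat \<Rightarrow> nat) (time :: nat \<Rightarrow> nat) (space :: nat \<Rightarrow> nat).
    (\<forall>N\<ge>1.
       N \<le> N' N \<and> N' N < N + l N \<and> admissible (N' N) (H N) (l N) \<and>
       (\<exists>s. run space_improved (input_state (N' N) (H N) (l N)) (time N) (space N) s \<and>
            emitted s = map (\<lambda>n. int (complexity n)) [1..<N' N + 1])) \<and>
    (\<lambda>N. real (time N)) \<in> O(\<lambda>N. real N powr \<alpha>) \<and>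
    (\<lambda>N. real (space N)) \<in> O(\<lambda>N. real N powr ((1 + \<beta>) / 2) * ln (ln (real N)))"
proof -
  obtain C where C: "C \<ge> 0" "\<And>n. real (\<Sum>k\<in>{2..n}. kMax k) \<le> C * real n powr (27/22)"
    using kMax_sum_le[of "27/22"] by auto
  have "\<exists>p. N \<ge> 1 \<longrightarrow> (\<exists>s. run space_improved (input_state (N_of N) (H_of N) (l_of N)) (fst p) (snd p) s \<and>
     emitted s = map (\<lambda>n. int (complexity n)) [1..<N_of N + 1]) \<and>
     real (fst p) \<le> time_bd1 (real N) + C * time_bd2 (real N) \<and> real (snd p) \<le> space_bd (real N)" for N
    using run_bounds[OF _ C] by (metis fst_conv snd_conv)
  then obtain p where p: "\<And>N. N \<ge> 1 \<Longrightarrow> (\<exists>s. run space_improved (input_state (N_of N) (H_of N) (l_of N)) (fst (p N)) (snd (p N)) s \<and>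
     emitted s = map (\<lambda>n. int (complexity n)) [1..<N_of N + 1]) \<and>
     real (fst (p N)) \<le> time_bd1 (real N) + C * time_bd2 (real N) \<and> real (snd (p N)) \<le> space_bd (real N)"
    by metis
  have "(\<lambda>N. real (fst (p N))) \<in> O(\<lambda>N. time_bd1 (real N) + C * time_bd2 (real N))"
    using p by (intro landau_o.big_mono eventually_sequentiallyI[of 1]) fastforce
  moreover have "(\<lambda>N. C * time_bd2 (real N)) \<in> O(\<lambda>N. real N powr \<alpha>)"
    unfolding assms(1) using time_bd2_bigo by (cases "C = 0") simp_all
  then have "(\<lambda>N. time_bd1 (real N) + C * time_bd2 (real N)) \<in> O(\<lambda>N. real N powr \<alpha>)"
    using time_bd1_bigo unfolding assms(1) by (intro sum_in_bigo)
  ultimately have time: "(\<lambda>N. real (fst (p N))) \<in> O(\<lambda>N. real N powr \<alpha>)"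
    by (rule landau_o.big_trans)
  have "(\<lambda>N. real (snd (p N))) \<in> O(\<lambda>N. space_bd (real N))"
    using p by (intro landau_o.big_mono eventually_sequentiallyI[of 1]) fastforce
  then have space: "(\<lambda>N. real (snd (p N))) \<in> O(\<lambda>N. real N powr ((1 + \<beta>) / 2) * ln (ln (real N)))"
    using landau_o.big_trans[OF _ space_bd_bigo] by (simp add: assms(2) beta_def)
  show ?thesis
    using p admissible_of N_of_bounds(1,2) time space
    by (intro exI[of _ N_of] exI[of _ H_of] exI[of _ l_of] exI[of _ "\<lambda>N. fst (p N)"] exI[of _ "\<lambda>N. snd (p N)"]) auto
qed



end
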